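(* Let $W$ be a Weyl group of type $Y_{a,b,c}$ ($a,b,c\ge1$) other than $W(D_4)$, let $V$ be the reflection representation of $W$ over a field $F$ of characteristic zero, and let $N$ be a nontrivial irreducible direct summand of the module $S^2(V)$ corresponding to a $W$-orbit $X$ of real 2-roots (that is, $N=F(\mathcal{B}\cap X)$). If $X$ is not the small orbit in type $D_n$, then the following hold. (i) The kernel of the action of $W$ on $N$ is the centre, $Z(W)$, of $W$. (ii) The group $W$ acts faithfully on $N$ if and only if one of the following conditions holds: (1) $W$ is infinite; (2) $W$ is of type $D_n$ and $n$ is odd; (3) $W$ is of type $E_6$.
   Context: $Y_{a,b,c}$ ($a,b,c\ge1$) is the tree with $n=a+b+c+1$ vertices consisting of three paths with $a$, $b$ and $c$ vertices, each joined by one of its endpoints to a common trivalent branch vertex; $D_n=Y_{1,1,n-3}$ and $E_n=Y_{1,2,n-4}$. Its Cartan matrix $A$ has $A_{ii}=2$, $A_{ij}=-1$ if $i,j$ are adjacent, and $A_{ij}=0$ otherwise. $W$ is the group generated by $s_1,\dots,s_n$ subject to $s_i^2=1$, $s_is_j=s_js_i$ if $A_{ij}=0$, and $s_is_js_i=s_js_is_j$ if $A_{ij}=-1$. $V$ is the $F$-vector space with basis the simple roots $\Pi=\{\alpha_1,\dots,\alpha_n\}$, with symmetric bilinear form $B(\alpha_i,\alpha_j)=A_{ij}$, on which $W$ acts by $s_i(v)=v-B(\alpha_i,v)\alpha_i$. A real root is a vector $w(\alpha_i)$ with $w\in W$. For $\alpha,\beta\in V$, $\alpha\vee\beta=\alpha\otimes\beta+\beta\otimes\alpha$;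 $S^2(V)\subseteq V\otimes V$ is the span of these elements, with the diagonal $W$-action. A real 2-root is $\alpha\vee\beta$ with $\alpha,\beta$ real roots such that $B(\alpha,\beta)=0$; $W$ permutes the real 2-roots. Canonical basis. The highest root of a type $D_m$ ($m\ge4$) root system is the sum of the simple roots with coefficient $1$ at the endpoints of the diagram and $2$ at all other vertices. For a simple root $\alpha_i$, a positive root $\beta$ is elementary with respect to $\alpha_i$ if: (1) $\beta=\alpha_j$ is simple with $A_{ij}=0$; (2) $\beta=\alpha_h+\alpha_i+\alpha_j$ for a path $h$--$i$--$j$ in $Y_{a,b,c}$; or (3) $i$ is not the branch vertex and $\beta=\theta_i$ is the highest root of the standard parabolic subsystem of type $D_m$ ($m\ge 4$) whose simple roots are those on the path from $i$ to the branch vertex together with all neighbours of the branch vertex. $\mathcal{B}$ is the set of all $\alpha_i\vee\beta$ with $\alpha_i\in\Pi$ and $\beta$ elementary with respect to $\alpha_i$; its elements are linearly independent real 2-roots. $F(\mathcal{B}\cap X)$ is the $F$-span of $\mathcal{B}\cap X$, a $W$-submodule of $S^2(V)$. Small orbit. In type $D_n$ ($n\ge5$), realize the positive roots as $\varepsilon_i\pm\varepsilon_j$ ($1\le i<j\le n$) with $\varepsilon_1,\dots,\varepsilon_n$ orthonormal. There are two $W$-orbits of real 2-roots; the small orbit is the one whose positive members (those $\alpha\vee\beta$ with $\alpha,\beta$ both positive) are $(\varepsilon_i-\varepsilon_j)\vee(\varepsilon_i+\varepsilon_j)$, $1\le i<j\le n$. *)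

theory Defs
  imports "HOL-Algebra.Group_Action" "HOL-Library.Multiset"
    "HOL-Library.Function_Algebras" Complex_Main
begin

section \<open>The trees $Y_{a,b,c}$\<close>

text \<open>The vertex \<open>Arm k d\<close> is the vertex of the \<open>k\<close>-th arm (\<open>k = 0, 1, 2\<close>) at distance
  \<open>d \<ge> 1\<close> from the branch vertex. Everything below depends on \<open>a, b, c\<close> only through the
  vertex set \<open>Y a b c\<close>, which is passed around as the parameter \<open>S\<close>.\<close>

datatype vertex = Branch | Arm nat nat

definition Y :: "nat \<Rightarrow> nat \<Rightarrow> nat \<Rightarrow> vertex set" where
  "Y a b c = {Branch} \<union> Arm 0 ` {1..a} \<union> Arm 1 ` {1..b} \<union> Arm 2 ` {1..c}"

fun adjacent :: "vertex \<Rightarrow> vertex \<Rightarrow> bool" where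
  "adjacent Branch Branch \<longleftrightarrow> False"
| "adjacent Branch (Arm k d) \<longleftrightarrow> d = 1"
| "adjacent (Arm k d) Branch \<longleftrightarrow> d = 1"
| "adjacent (Arm k d) (Arm l e) \<longleftrightarrow> k = l \<and> (d = Suc e \<or> e = Suc d)"

definition cartan :: "vertex \<Rightarrow> vertex \<Rightarrow> int" where
  "cartan i j = (if i = j then 2 else if adjacent i j then -1 else 0)"

text \<open>The order of the three arms is immaterial for the type.\<close>

definition type_D :: "nat \<Rightarrow> nat \<Rightarrow> nat \<Rightarrow> nat \<Rightarrow> bool" where
  "type_D a b c n \<longleftrightarrow> n \<ge> 4 \<and> {#a, b, c#} = {#1, 1, n - 3#}"

definition type_E :: "nat \<Rightarrow> nat \<Rightarrow> nat \<Rightarrow> nat \<Rightarrow> bool" where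
  "type_E a b c n \<longleftrightarrow> n \<ge> 5 \<and> {#a, b, c#} = {#1, 2, n - 4#}"


section \<open>The Weyl group, given by generators and relations\<close>

text \<open>Since the generators are involutions, the presented group is the set of words in
  the generators modulo the congruence generated by the relations; formal inverses are not
  needed.\<close>

inductive_set weyl_cong :: "vertex set \<Rightarrow> (vertex list \<times> vertex list) set"
  for S :: "vertex set" where
  refl: "u \<in> lists S \<Longrightarrow> (u, u) \<in> weyl_cong S"
| sym: "(u, v) \<in> weyl_cong S \<Longrightarrow> (v, u) \<in> weyl_cong S"
| trans: "(u, v) \<in> weyl_cong S \<Longrightarrow> (v, w) \<in> weyl_cong S \<Longrightarrow> (u, w) \<in> weyl_cong S"
| append: "(u, u') \<in> weyl_cong S \<Longrightarrow> (v, v') \<in> weyl_cong S \<Longrightarrow> (u @ v, u' @ v') \<in> weyl_cong S"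
| square: "i \<in> S \<Longrightarrow> ([i, i], []) \<in> weyl_cong S"
| commute: "i \<in> S \<Longrightarrow> j \<in> S \<Longrightarrow> cartan i j = 0 \<Longrightarrow> ([i, j], [j, i]) \<in> weyl_cong S"
| braid: "i \<in> S \<Longrightarrow> j \<in> S \<Longrightarrow> cartan i j = -1 \<Longrightarrow> ([i, j, i], [j, i, j]) \<in> weyl_cong S"

definition weyl_group :: "vertex set \<Rightarrow> vertex list set monoid" where
  "weyl_group S =
    \<lparr>carrier = lists S // weyl_cong S,
     monoid.mult = (\<lambda>C D. \<Union>u\<in>C. \<Union>v\<in>D. weyl_cong S `` {u @ v}),
     monoid.one = weyl_cong S `` {[]}\<rparr>"

definition centre :: "('g, 'm) monoid_scheme \<Rightarrow> 'g set" where
  "centre G = {z \<in> carrier G. \<forall>g\<in>carrier G. z \<otimes>\<^bsub>G\<^esub> g = g \<otimes>\<^bsub>G\<^esub> z}"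


section \<open>The reflection representation\<close>

definition fun_scale :: "'f::field \<Rightarrow> ('x \<Rightarrow> 'f) \<Rightarrow> 'x \<Rightarrow> 'f" where
  "fun_scale r v = (\<lambda>x. r * v x)"

global_interpretation fun_space: vector_space fun_scale
  by unfold_locales (auto simp: fun_scale_def fun_eq_iff algebra_simps)

text \<open>A vector is the family of its coordinates with respect to the simple roots.\<close>

definition refl_space :: "vertex set \<Rightarrow> (vertex \<Rightarrow> 'f::field_char_0) set" where
  "refl_space S = {v. \<forall>i. i \<notin> S \<longrightarrow> v i = 0}"

definition simple_root :: "vertex \<Rightarrow> vertex \<Rightarrow> 'f::field_char_0" where
  "simple_root i = (\<lambda>j. if j = i then 1 else 0)"

definition bil :: "vertex set \<Rightarrow> (vertex \<Rightarrow> 'f::field_char_0) \<Rightarrow> (vertex \<Rightarrow> 'f) \<Rightarrow> 'f" where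
  "bil S v w = (\<Sum>i\<in>S. \<Sum>j\<in>S. v i * of_int (cartan i j) * w j)"

definition reflection ::
    "vertex set \<Rightarrow> vertex \<Rightarrow> (vertex \<Rightarrow> 'f::field_char_0) \<Rightarrow> vertex \<Rightarrow> 'f" where
  "reflection S i v = v - fun_scale (bil S (simple_root i) v) (simple_root i)"

definition word_act ::
    "vertex set \<Rightarrow> vertex list \<Rightarrow> (vertex \<Rightarrow> 'f::field_char_0) \<Rightarrow> vertex \<Rightarrow> 'f" where
  "word_act S u = foldr (reflection S) u"

text \<open>The value does not depend on the representing word: see \<open>weyl_act_class\<close> below.\<close>

definition weyl_act ::
    "vertex set \<Rightarrow> vertex list set \<Rightarrow> (vertex \<Rightarrow> 'f::field_char_0) \<Rightarrow> vertex \<Rightarrow> 'f" where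
  "weyl_act S w = the_elem (word_act S ` w)"

definition real_roots :: "vertex set \<Rightarrow> (vertex \<Rightarrow> 'f::field_char_0) set" where
  "real_roots S = {weyl_act S w (simple_root i) | w i. w \<in> carrier (weyl_group S) \<and> i \<in> S}"

definition positive_roots :: "vertex set \<Rightarrow> (vertex \<Rightarrow> 'f::field_char_0) set" where
  "positive_roots S = {\<beta> \<in> real_roots S. \<forall>i\<in>S. \<beta> i \<in> \<nat>}"


section \<open>The symmetric square and real 2-roots\<close>

text \<open>\<open>V \<otimes> V\<close> is identified with functions on pairs of vertices, the basis vector
  \<open>\<alpha>\<^sub>i \<otimes> \<alpha>\<^sub>j\<close> being the indicator function of \<open>(i, j)\<close>.\<close>

definition tensor ::
    "(vertex \<Rightarrow> 'f::field_char_0) \<Rightarrow> (vertex \<Rightarrow> 'f) \<Rightarrow> vertex \<times> vertex \<Rightarrow> 'f" where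
  "tensor v w = (\<lambda>(i, j). v i * w j)"

definition vee ::
    "(vertex \<Rightarrow> 'f::field_char_0) \<Rightarrow> (vertex \<Rightarrow> 'f) \<Rightarrow> vertex \<times> vertex \<Rightarrow> 'f" where
  "vee v w = tensor v w + tensor w v"

definition sym_square :: "vertex set \<Rightarrow> (vertex \<times> vertex \<Rightarrow> 'f::field_char_0) set" where
  "sym_square S = fun_space.span {vee v w | v w. v \<in> refl_space S \<and> w \<in> refl_space S}"

definition diag_act ::
    "vertex set \<Rightarrow> vertex list set \<Rightarrow> (vertex \<times> vertex \<Rightarrow> 'f::field_char_0) \<Rightarrow> vertex \<times> vertex \<Rightarrow> 'f"
  where
  "diag_act S w t =
    (\<Sum>i\<in>S. \<Sum>j\<in>S. fun_scale (t (i, j))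
       (tensor (weyl_act S w (simple_root i)) (weyl_act S w (simple_root j))))"

text \<open>The permutation action on a stable subset \<open>E\<close>; elements of \<open>BijGroup E\<close> are extensional.\<close>

definition action_on ::
    "vertex set \<Rightarrow> (vertex \<times> vertex \<Rightarrow> 'f::field_char_0) set
      \<Rightarrow> vertex list set \<Rightarrow> (vertex \<times> vertex \<Rightarrow> 'f) \<Rightarrow> vertex \<times> vertex \<Rightarrow> 'f" where
  "action_on S E w = (\<lambda>t\<in>E. diag_act S w t)"

definition real_2_roots :: "vertex set \<Rightarrow> (vertex \<times> vertex \<Rightarrow> 'f::field_char_0) set" where
  "real_2_roots S =
    {vee \<alpha> \<beta> | \<alpha> \<beta>. \<alpha> \<in> real_roots S \<and> \<beta> \<in> real_roots S \<and> bil S \<alpha> \<beta> = 0}"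

definition positive_2_roots :: "vertex set \<Rightarrow> (vertex \<times> vertex \<Rightarrow> 'f::field_char_0) set" where
  "positive_2_roots S =
    {vee \<alpha> \<beta> | \<alpha> \<beta>. \<alpha> \<in> positive_roots S \<and> \<beta> \<in> positive_roots S \<and> bil S \<alpha> \<beta> = 0}"

definition two_root_orbits :: "vertex set \<Rightarrow> (vertex \<times> vertex \<Rightarrow> 'f::field_char_0) set set" where
  "two_root_orbits S =
    orbits (weyl_group S) (real_2_roots S) (action_on S (real_2_roots S))"


section \<open>The canonical basis\<close>

fun path_to_branch :: "vertex \<Rightarrow> vertex set" where
  "path_to_branch Branch = {Branch}"
| "path_to_branch (Arm k d) = insert Branch (Arm k ` {1..d})"

definition D_vertices :: "vertex set \<Rightarrow> vertex \<Rightarrow> vertex set" where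
  "D_vertices S i = path_to_branch i \<union> {j \<in> S. adjacent Branch j}"

definition theta :: "vertex set \<Rightarrow> vertex \<Rightarrow> vertex \<Rightarrow> 'f::field_char_0" where
  "theta S i = (\<lambda>j. if j \<notin> D_vertices S i then 0
                    else if card {h \<in> D_vertices S i. adjacent h j} = 1 then 1 else 2)"

definition elementary :: "vertex set \<Rightarrow> vertex \<Rightarrow> (vertex \<Rightarrow> 'f::field_char_0) \<Rightarrow> bool" where
  "elementary S i \<beta> \<longleftrightarrow> \<beta> \<in> positive_roots S \<and>
    ((\<exists>j\<in>S. cartan i j = 0 \<and> \<beta> = simple_root j) \<or>
     (\<exists>h\<in>S. \<exists>j\<in>S. h \<noteq> j \<and> adjacent h i \<and> adjacent i j \<and>
        \<beta> = simple_root h + simple_root i + simple_root j) \<or>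
     (i \<noteq> Branch \<and> \<beta> = theta S i))"

definition canonical_basis :: "vertex set \<Rightarrow> (vertex \<times> vertex \<Rightarrow> 'f::field_char_0) set" where
  "canonical_basis S = {vee (simple_root i) \<beta> | i \<beta>. i \<in> S \<and> elementary S i \<beta>}"


section \<open>The small orbit in type D\<close>

text \<open>Meaningful when \<open>S\<close> is the diagram of type \<open>D\<^sub>n\<close> with \<open>n = card S \<ge> 5\<close>. The positive
  roots then determine the vectors \<open>\<epsilon>\<^sub>i\<close> up to the sign of \<open>\<epsilon>\<^sub>n\<close>, which does not affect the
  condition on \<open>X\<close>.\<close>

definition small_orbit ::
    "vertex set \<Rightarrow> (vertex \<times> vertex \<Rightarrow> 'f::field_char_0) set \<Rightarrow> bool" where
  "small_orbit S X \<longleftrightarrow> X \<in> two_root_orbits S \<and>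
    (\<exists>\<epsilon> :: nat \<Rightarrow> vertex \<Rightarrow> 'f.
      (\<forall>i\<in>{1..card S}. \<epsilon> i \<in> refl_space S) \<and>
      (\<forall>i\<in>{1..card S}. \<forall>j\<in>{1..card S}. bil S (\<epsilon> i) (\<epsilon> j) = (if i = j then 1 else 0)) \<and>
      positive_roots S =
        {\<epsilon> i - \<epsilon> j | i j. 1 \<le> i \<and> i < j \<and> j \<le> card S} \<union>
        {\<epsilon> i + \<epsilon> j | i j. 1 \<le> i \<and> i < j \<and> j \<le> card S} \<and>
      X \<inter> positive_2_roots S =
        {vee (\<epsilon> i - \<epsilon> j) (\<epsilon> i + \<epsilon> j) | i j. 1 \<le> i \<and> i < j \<and> j \<le> card S})"


section \<open>Submodules of the symmetric square\<close>

definition submodule :: "vertex set \<Rightarrow> (vertex \<times> vertex \<Rightarrow> 'f::field_char_0) set \<Rightarrow> bool" where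
  "submodule S M \<longleftrightarrow> fun_space.subspace M \<and> M \<subseteq> sym_square S \<and>
    (\<forall>w\<in>carrier (weyl_group S). \<forall>t\<in>M. diag_act S w t \<in> M)"

definition irreducible_submodule ::
    "vertex set \<Rightarrow> (vertex \<times> vertex \<Rightarrow> 'f::field_char_0) set \<Rightarrow> bool" where
  "irreducible_submodule S N \<longleftrightarrow> submodule S N \<and> N \<noteq> {0} \<and>
    (\<forall>M. submodule S M \<and> M \<subseteq> N \<longrightarrow> M = {0} \<or> M = N)"

definition direct_summand ::
    "vertex set \<Rightarrow> (vertex \<times> vertex \<Rightarrow> 'f::field_char_0) set \<Rightarrow> bool" where
  "direct_summand S N \<longleftrightarrow> submodule S N \<and>
    (\<exists>M. submodule S M \<and> N \<inter> M = {0} \<and> {s + t | s t. s \<in> N \<and> t \<in> M} = sym_square S)"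

definition trivial_module ::
    "vertex set \<Rightarrow> (vertex \<times> vertex \<Rightarrow> 'f::field_char_0) set \<Rightarrow> bool" where
  "trivial_module S N \<longleftrightarrow> (\<forall>w\<in>carrier (weyl_group S). \<forall>t\<in>N. diag_act S w t = t)"


section \<open>Well-definedness\<close>

lemma weyl_cong_lists: "(u, v) \<in> weyl_cong S \<Longrightarrow> u \<in> lists S \<and> v \<in> lists S"
  by (induction rule: weyl_cong.induct) auto

lemma equiv_weyl_cong: "equiv (lists S) (weyl_cong S)"
proof (rule equivI)
  show "weyl_cong S \<subseteq> lists S \<times> lists S"
    using weyl_cong_lists by fastforce
  show "refl_on (lists S) (weyl_cong S)"
    by (rule refl_onI) (auto intro: weyl_cong.refl)
  show "Relation.sym (weyl_cong S)" by (rule symI) (rule weyl_cong.sym)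
  show "Relation.trans (weyl_cong S)" by (rule transI) (rule weyl_cong.trans)
qed

lemma finite_Y: "finite (Y a b c)"
  by (simp add: Y_def)

lemma adjacent_sym: "adjacent i j = adjacent j i"
  by (cases i; cases j) auto

lemma cartan_sym: "cartan i j = cartan j i"
  using adjacent_sym by (auto simp: cartan_def)

lemma bil_simple_left:
  assumes "finite S" "i \<in> S"
  shows "bil S (simple_root i) v = (\<Sum>j\<in>S. of_int (cartan i j) * v j)"
proof -
  have "bil S (simple_root i) v =
      (\<Sum>h\<in>S. if h = i then \<Sum>j\<in>S. of_int (cartan i j) * v j else 0)"
    unfolding bil_def simple_root_def by (intro sum.cong) auto
  then show ?thesis using assms by simp
qed

lemma bil_simple_simple:
  assumes "finite S" "i \<in> S" "j \<in> S"
  shows "bil S (simple_root i) (simple_root j) = of_int (cartan i j)"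
proof -
  have "bil S (simple_root i) (simple_root j) =
      (\<Sum>h\<in>S. if h = j then of_int (cartan i j) else 0)"
    unfolding bil_simple_left[OF assms(1,2)] by (intro sum.cong) (auto simp: simple_root_def)
  then show ?thesis using assms by simp
qed

lemma bil_diff_scale:
  "bil S v (x - fun_scale r y) = bil S v x - r * bil S v y"
  by (simp add: bil_def fun_scale_def algebra_simps sum_subtractf sum_distrib_left)

lemma bil_reflection:
  assumes "finite S" "i \<in> S" "j \<in> S"
  shows "bil S (simple_root i) (reflection S j v) =
    bil S (simple_root i) v - bil S (simple_root j) v * of_int (cartan i j)"
  using assms by (simp add: reflection_def bil_diff_scale bil_simple_simple)

lemma reflection_apply:
  "reflection S i v x = v x - bil S (simple_root i) v * simple_root i x"
  by (simp add: reflection_def fun_scale_def)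

lemma word_act_append: "word_act S (u @ v) = word_act S u \<circ> word_act S v"
  by (rule ext) (simp add: word_act_def)

lemma word_act_cong:
  assumes "finite S" "(u, v) \<in> weyl_cong S"
  shows "word_act S u = (word_act S v :: (vertex \<Rightarrow> 'f::field_char_0) \<Rightarrow> _)"
  using assms(2)
proof (induction rule: weyl_cong.induct)
  case (append u u' v v')
  then show ?case by (simp only: word_act_append)
next
  case (square i)
  have "reflection S i (reflection S i x) = x" for x :: "vertex \<Rightarrow> 'f"
    by (rule ext) (simp add: reflection_apply bil_reflection assms(1) square cartan_def algebra_simps)
  then show ?case by (simp add: word_act_def fun_eq_iff)
next
  case (commute i j)
  have "cartan j i = 0" using commute(3) cartan_sym[of i j] by simp
  then have "reflection S i (reflection S j x) = reflection S j (reflection S i x)"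
    for x :: "vertex \<Rightarrow> 'f"
    by (intro ext) (simp add: reflection_apply bil_reflection assms(1) commute)
  then show ?case by (simp add: word_act_def fun_eq_iff)
next
  case (braid i j)
  have "cartan j i = -1" "cartan i i = 2" "cartan j j = 2"
    using braid(3) cartan_sym[of i j] by (auto simp: cartan_def)
  then have "reflection S i (reflection S j (reflection S i x)) =
      reflection S j (reflection S i (reflection S j x))" for x :: "vertex \<Rightarrow> 'f"
    by (intro ext) (simp add: reflection_apply bil_reflection assms(1) braid algebra_simps)
  then show ?case by (simp add: word_act_def fun_eq_iff)
qed auto

lemma weyl_act_class:
  assumes "finite S" "u \<in> lists S"
  shows "weyl_act S (weyl_cong S `` {u}) = (word_act S u :: (vertex \<Rightarrow> 'f::field_char_0) \<Rightarrow> _)"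
proof -
  have "(word_act S ` (weyl_cong S `` {u}) :: ((vertex \<Rightarrow> 'f) \<Rightarrow> _) set) = {word_act S u}"
  proof (intro equalityI subsetI)
    fix f :: "(vertex \<Rightarrow> 'f) \<Rightarrow> vertex \<Rightarrow> 'f"
    assume "f \<in> word_act S ` (weyl_cong S `` {u})"
    then obtain v where v: "(u, v) \<in> weyl_cong S" "f = word_act S v" by auto
    show "f \<in> {word_act S u}"
      unfolding v(2) word_act_cong[OF assms(1) v(1)] by simp
  qed (use weyl_cong.refl[OF assms(2)] in auto)
  then show ?thesis by (simp add: weyl_act_def)
qed

lemma weyl_mult_class:
  assumes "u \<in> lists S" "v \<in> lists S"
  shows "weyl_cong S `` {u} \<otimes>\<^bsub>weyl_group S\<^esub> weyl_cong S `` {v} = weyl_cong S `` {u @ v}"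
proof -
  have eq: "weyl_cong S `` {u' @ v'} = weyl_cong S `` {u @ v}"
    if "u' \<in> weyl_cong S `` {u}" "v' \<in> weyl_cong S `` {v}" for u' v'
    using equiv_class_eq[OF equiv_weyl_cong weyl_cong.append[of u u' S v v']] that by simp
  have "u \<in> weyl_cong S `` {u}" "v \<in> weyl_cong S `` {v}"
    using assms by (auto intro: weyl_cong.refl)
  then have "(\<Union>u'\<in>weyl_cong S `` {u}. \<Union>v'\<in>weyl_cong S `` {v}. weyl_cong S `` {u' @ v'}) =
      weyl_cong S `` {u @ v}"
    using eq by (metis (no_types, lifting) UN_constant_eq empty_iff)
  then show ?thesis by (simp add: weyl_group_def)
qed

lemma group_weyl_group: "group (weyl_group S)"
proof (rule groupI)
  have carr: "carrier (weyl_group S) = (\<lambda>u. weyl_cong S `` {u}) ` lists S"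
    by (auto simp: weyl_group_def quotient_def)
  have one: "\<one>\<^bsub>weyl_group S\<^esub> = weyl_cong S `` {[]}"
    by (simp add: weyl_group_def)
  show "\<one>\<^bsub>weyl_group S\<^esub> \<in> carrier (weyl_group S)"
    unfolding carr one by blast
  fix x assume "x \<in> carrier (weyl_group S)"
  then obtain u where u: "u \<in> lists S" "x = weyl_cong S `` {u}" unfolding carr by blast
  show "\<one>\<^bsub>weyl_group S\<^esub> \<otimes>\<^bsub>weyl_group S\<^esub> x = x"
    using u weyl_mult_class[of "[]" S u] by (simp add: one)
  have "(rev u @ u, []) \<in> weyl_cong S" using u(1)
  proof (induction u)
    case Nil
    then show ?case by (simp add: weyl_cong.refl)
  next
    case (Cons i u)
    have "(rev u @ [i, i] @ u, rev u @ [] @ u) \<in> weyl_cong S"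
      using Cons by (intro weyl_cong.append weyl_cong.square weyl_cong.refl) auto
    with Cons show ?case by (auto intro: weyl_cong.trans)
  qed
  then have "weyl_cong S `` {rev u @ u} = weyl_cong S `` {[]}"
    by (rule equiv_class_eq[OF equiv_weyl_cong])
  then show "\<exists>y\<in>carrier (weyl_group S). y \<otimes>\<^bsub>weyl_group S\<^esub> x = \<one>\<^bsub>weyl_group S\<^esub>"
    using u weyl_mult_class[of "rev u" S u]
    by (intro bexI[of _ "weyl_cong S `` {rev u}"]) (simp_all add: one carr in_lists_conv_set)
  fix y assume "y \<in> carrier (weyl_group S)"
  then obtain v where v: "v \<in> lists S" "y = weyl_cong S `` {v}" unfolding carr by blast
  show "x \<otimes>\<^bsub>weyl_group S\<^esub> y \<in> carrier (weyl_group S)"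
    using u v by (auto simp: weyl_mult_class carr)
  fix z assume "z \<in> carrier (weyl_group S)"
  then obtain w where w: "w \<in> lists S" "z = weyl_cong S `` {w}" unfolding carr by blast
  show "x \<otimes>\<^bsub>weyl_group S\<^esub> y \<otimes>\<^bsub>weyl_group S\<^esub> z = x \<otimes>\<^bsub>weyl_group S\<^esub> (y \<otimes>\<^bsub>weyl_group S\<^esub> z)"
    using u v w by (simp add: weyl_mult_class append_in_lists_conv)
qed

end

theory Submission
  imports Defs
begin

text \<open>
  Both parts rest on the elements of \<open>W\<close> that act on \<open>V\<close> as \<open>1\<close> or \<open>-1\<close>. They act trivially on
  \<open>S\<^sup>2(V)\<close>, and they are central because \<open>W\<close> acts faithfully on \<open>V\<close> (\<open>int_act_faithful\<close>, the
  usual argument that relates the length of \<open>w s\<^sub>i\<close> to the sign of \<open>w(\<alpha>\<^sub>i)\<close>). Conversely, a central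
  element commutes with each \<open>s\<^sub>i\<close> and preserves the line of \<open>\<alpha>\<^sub>i\<close>, and an element that preserves
  the lines of all simple roots is \<open>1\<close> or \<open>-1\<close>, since the diagram is connected and \<open>B\<close> is invariant
  (\<open>diagonal_imp_sign\<close>). So the centre consists of these elements.

  That the kernel contains nothing else is the content of \<open>fixing_word_sign\<close>. An element that
  fixes \<open>\<alpha> \<or> \<beta>\<close> permutes the lines of \<open>\<alpha>\<close> and \<open>\<beta>\<close>. Every element of the canonical basis lies in
  the orbit of some \<open>\<alpha>\<^sub>x \<or> \<alpha>\<^sub>y\<close> with \<open>x\<close>, \<open>y\<close> distinct and not adjacent (\<open>elementary_reduction\<close>).
  If a vertex \<open>z\<close> is adjacent to \<open>y\<close> but not to \<open>x\<close>, the orbit also contains \<open>\<alpha>\<^sub>x \<or> (\<alpha>\<^sub>y + \<alpha>\<^sub>z)\<close>, and the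
  two 2-roots together force the kernel to preserve the line of \<open>\<alpha>\<^sub>x\<close>. The kernel is normal and
  all simple roots are conjugate, so it preserves the lines of all of them. If \<open>x\<close> and \<open>y\<close> have the same
  neighbours, they are two arms of length one. The type is then \<open>D\<^sub>n\<close>, and in orthonormal
  coordinates the 2-root is \<open>(\<epsilon>\<^bsub>n-1\<^esub> - \<epsilon>\<^sub>n) \<or> (\<epsilon>\<^bsub>n-1\<^esub> + \<epsilon>\<^sub>n)\<close>, which generates the small orbit
  (\<open>small_orbit_of_short_arms\<close>).

  By the first part the action is faithful unless \<open>-1 \<in> W\<close>. If \<open>-1 \<in> W\<close>, every reduced word
  is an initial segment of a reduced expression of \<open>-1\<close>, so \<open>W\<close> is finite
  (\<open>minus_one_imp_finite\<close>). Suppose that \<open>W\<close> is finite, with longest element \<open>w\<close>. As \<open>w\<close> makes all simple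
  roots negative, there is no nonzero vector \<open>d \<ge> 0\<close> with all \<open>B(\<alpha>\<^sub>i, d) \<le> 0\<close>, which leaves
  only the types \<open>D\<^sub>n\<close>, \<open>E\<^sub>6\<close>, \<open>E\<^sub>7\<close> and \<open>E\<^sub>8\<close> (\<open>finite_imp_type\<close>). Moreover \<open>-w\<close> permutes the
  simple roots by a diagram automorphism (\<open>longest_word_automorphism\<close>). The rest follows from
  the fact that \<open>W\<close> acts trivially on the weight lattice modulo the root lattice
  (\<open>int_act_mod\<close>): a weight of order four for odd \<open>n\<close>, or of order three for \<open>E\<^sub>6\<close>, shows that
  \<open>-1\<close> is not in \<open>W\<close>, and a weight of order two shows that for even \<open>n\<close> the automorphism does
  not exchange the short arms of \<open>D\<^sub>n\<close>, so that \<open>w = -1\<close> in the remaining cases.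
\<close>

section \<open>The integral form of the reflection representation\<close>

text \<open>The matrices of \<open>W\<close> in the basis of simple roots are integral. Signs and congruences of
  coordinates, which make no sense in \<open>F\<close>, are therefore studied on integral vectors, and
  \<open>of_int_vec\<close> carries the results over to \<open>V\<close>.\<close>

definition int_simple :: "vertex \<Rightarrow> vertex \<Rightarrow> int" where
  "int_simple i = (\<lambda>j. if j = i then 1 else 0)"

definition int_pairing :: "vertex set \<Rightarrow> vertex \<Rightarrow> (vertex \<Rightarrow> int) \<Rightarrow> int" where
  "int_pairing S i v = (\<Sum>j\<in>S. cartan i j * v j)"

definition int_refl :: "vertex set \<Rightarrow> vertex \<Rightarrow> (vertex \<Rightarrow> int) \<Rightarrow> vertex \<Rightarrow> int" where
  "int_refl S i v = (\<lambda>x. v x - int_pairing S i v * int_simple i x)"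

definition int_act :: "vertex set \<Rightarrow> vertex list \<Rightarrow> (vertex \<Rightarrow> int) \<Rightarrow> vertex \<Rightarrow> int" where
  "int_act S u = foldr (int_refl S) u"

definition of_int_vec :: "(vertex \<Rightarrow> int) \<Rightarrow> vertex \<Rightarrow> 'f::field_char_0" where
  "of_int_vec v = (\<lambda>x. of_int (v x))"

lemma of_int_vec_simple: "of_int_vec (int_simple i) = simple_root i"
  by (auto simp: of_int_vec_def int_simple_def simple_root_def)

lemma of_int_vec_inject: "of_int_vec v = (of_int_vec w :: vertex \<Rightarrow> 'f::field_char_0) \<longleftrightarrow> v = w"
  by (auto simp: of_int_vec_def fun_eq_iff)

lemma bil_simple_of_int_vec:
  assumes "finite S" "i \<in> S"
  shows "bil S (simple_root i) (of_int_vec v :: vertex \<Rightarrow> 'f::field_char_0) =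
    of_int (int_pairing S i v)"
  using assms by (simp add: bil_simple_left int_pairing_def of_int_vec_def)

lemma reflection_of_int_vec:
  assumes "finite S" "i \<in> S"
  shows "reflection S i (of_int_vec v :: vertex \<Rightarrow> 'f::field_char_0) = of_int_vec (int_refl S i v)"
proof
  fix x
  have "reflection S i (of_int_vec v :: vertex \<Rightarrow> 'f) x =
      of_int (v x) - of_int (int_pairing S i v) * simple_root i x"
    using bil_simple_of_int_vec[OF assms, of v, where 'f = 'f]
    by (simp add: reflection_apply) (simp add: of_int_vec_def)
  then show "reflection S i (of_int_vec v :: vertex \<Rightarrow> 'f) x = of_int_vec (int_refl S i v) x"
    by (simp add: int_refl_def of_int_vec_def int_simple_def simple_root_def)
qed

lemma word_act_of_int_vec:
  assumes "finite S" "u \<in> lists S"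
  shows "word_act S u (of_int_vec v :: vertex \<Rightarrow> 'f::field_char_0) = of_int_vec (int_act S u v)"
  using assms(2)
  by (induction u) (simp_all add: word_act_def int_act_def reflection_of_int_vec[OF assms(1)])

lemma int_act_Nil [simp]: "int_act S [] v = v"
  by (simp add: int_act_def)

lemma int_act_Cons: "int_act S (i # u) v = int_refl S i (int_act S u v)"
  by (simp add: int_act_def)

lemma int_act_append: "int_act S (u @ v) x = int_act S u (int_act S v x)"
  by (simp add: int_act_def)

text \<open>The defining relations are already known to hold for matrices over a field of
  characteristic zero, and the integers embed into the rationals.\<close>

lemma int_act_cong:
  assumes "finite S" "(u, v) \<in> weyl_cong S"
  shows "int_act S u x = int_act S v x"
proof -
  have "of_int_vec (int_act S u x) = (of_int_vec (int_act S v x) :: vertex \<Rightarrow> rat)"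
    using word_act_cong[OF assms, where 'f = rat] weyl_cong_lists[OF assms(2)]
    by (metis assms(1) word_act_of_int_vec)
  then show ?thesis by (simp add: of_int_vec_inject)
qed

lemma int_pairing_linear:
  "int_pairing S i (\<lambda>x. p * v x + q * w x) = p * int_pairing S i v + q * int_pairing S i w"
  by (simp add: int_pairing_def sum_distrib_left sum.distrib algebra_simps)

lemma int_refl_linear:
  "int_refl S i (\<lambda>x. p * v x + q * w x) = (\<lambda>x. p * int_refl S i v x + q * int_refl S i w x)"
  by (simp add: int_refl_def int_pairing_linear algebra_simps fun_eq_iff)

lemma int_act_linear:
  "int_act S u (\<lambda>x. p * v x + q * w x) = (\<lambda>x. p * int_act S u v x + q * int_act S u w x)"
  by (induction u) (simp_all add: int_act_Cons int_refl_linear)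

lemma int_act_zero: "int_act S u (\<lambda>x. 0) = (\<lambda>x. 0)"
  using int_act_linear[of S u 0 "\<lambda>x. 0" 0 "\<lambda>x. 0"] by simp

lemma int_act_scale: "int_act S u (\<lambda>x. p * v x) = (\<lambda>x. p * int_act S u v x)"
  using int_act_linear[of S u p v 0 v] by simp

lemma int_act_uminus: "int_act S u (\<lambda>x. - v x) = (\<lambda>x. - int_act S u v x)"
  using int_act_scale[of S u "-1" v] by simp

lemma int_act_sum:
  assumes "finite A"
  shows "int_act S u (\<lambda>x. \<Sum>i\<in>A. c i * f i x) = (\<lambda>x. \<Sum>i\<in>A. c i * int_act S u (f i) x)"
  using assms
proof (induction A rule: finite_induct)
  case empty
  then show ?case by (simp add: int_act_zero)
next
  case (insert a A)
  then show ?case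
    using int_act_linear[of S u "c a" "f a" 1 "\<lambda>x. \<Sum>i\<in>A. c i * f i x"] by simp
qed

text \<open>Vectors are functions on all vertices; those that vanish outside the diagram are the
  ones that are combinations of its simple roots.\<close>

definition supported :: "vertex set \<Rightarrow> (vertex \<Rightarrow> 'r::zero) \<Rightarrow> bool" where
  "supported S v \<longleftrightarrow> (\<forall>x. x \<notin> S \<longrightarrow> v x = 0)"

lemma supportedI: "(\<And>x. x \<notin> S \<Longrightarrow> v x = 0) \<Longrightarrow> supported S v"
  by (simp add: supported_def)

lemma supportedD: "supported S v \<Longrightarrow> x \<notin> S \<Longrightarrow> v x = 0"
  by (simp add: supported_def)

lemma int_vec_expand:
  assumes "finite S" "supported S v"
  shows "v = (\<lambda>x. \<Sum>i\<in>S. v i * int_simple i x)"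
proof
  fix x
  have "(\<Sum>i\<in>S. v i * int_simple i x) = (\<Sum>i\<in>S. if i = x then v x else 0)"
    by (intro sum.cong) (auto simp: int_simple_def)
  then show "v x = (\<Sum>i\<in>S. v i * int_simple i x)"
    using assms by (simp add: supportedD)
qed

lemma int_act_expand:
  assumes "finite S" "supported S v"
  shows "int_act S u v = (\<lambda>x. \<Sum>i\<in>S. v i * int_act S u (int_simple i) x)"
  using int_act_sum[OF assms(1), of S u v int_simple] int_vec_expand[OF assms] by simp

lemma int_act_outside:
  assumes "u \<in> lists S" "x \<notin> S"
  shows "int_act S u v x = v x"
  using assms by (induction u) (auto simp: int_act_Cons int_refl_def int_simple_def)

lemma int_pairing_simple:
  assumes "finite S" "j \<in> S"
  shows "int_pairing S i (int_simple j) = cartan i j"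
proof -
  have "int_pairing S i (int_simple j) = (\<Sum>h\<in>S. if h = j then cartan i j else 0)"
    unfolding int_pairing_def by (intro sum.cong) (auto simp: int_simple_def)
  then show ?thesis using assms by simp
qed

lemma int_refl_simple:
  assumes "finite S" "j \<in> S"
  shows "int_refl S i (int_simple j) = (\<lambda>x. int_simple j x - cartan i j * int_simple i x)"
  using assms by (simp add: int_refl_def int_pairing_simple)

lemma cartan_cases: "i \<noteq> j \<Longrightarrow> cartan i j = 0 \<or> cartan i j = -1"
  by (simp add: cartan_def)

lemma cartan_diag [simp]: "cartan i i = 2"
  by (simp add: cartan_def)

section \<open>Reduced words and the sign of roots\<close>

definition reduced :: "vertex set \<Rightarrow> vertex list \<Rightarrow> bool" where
  "reduced S u \<longleftrightarrow> u \<in> lists S \<and> (\<forall>v. (u, v) \<in> weyl_cong S \<longrightarrow> length u \<le> length v)"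

lemma weyl_cong_parity:
  "(u, v) \<in> weyl_cong S \<Longrightarrow> even (length u) = even (length v)"
  by (induction rule: weyl_cong.induct) auto

lemma weyl_cong_left:
  "(u, v) \<in> weyl_cong S \<Longrightarrow> w \<in> lists S \<Longrightarrow> (w @ u, w @ v) \<in> weyl_cong S"
  by (intro weyl_cong.append weyl_cong.refl)

lemma weyl_cong_right:
  "(u, v) \<in> weyl_cong S \<Longrightarrow> w \<in> lists S \<Longrightarrow> (u @ w, v @ w) \<in> weyl_cong S"
  by (intro weyl_cong.append weyl_cong.refl)

lemma weyl_cong_cancel:
  assumes "u \<in> lists S" "s \<in> S" "v \<in> lists S"
  shows "(u @ [s, s] @ v, u @ v) \<in> weyl_cong S"
  using weyl_cong_left[OF weyl_cong_right[OF weyl_cong.square[OF assms(2)] assms(3)] assms(1)]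
  by simp

lemma weyl_cong_rev:
  "(u, v) \<in> weyl_cong S \<Longrightarrow> (rev u, rev v) \<in> weyl_cong S"
proof (induction rule: weyl_cong.induct)
  case (refl u)
  then show ?case by (intro weyl_cong.refl) (auto simp: in_lists_conv_set)
next
  case (append u u' v v')
  then show ?case by (simp add: weyl_cong.append)
qed (auto intro: weyl_cong.intros)

lemma weyl_cong_rev_cancel:
  assumes "u \<in> lists S"
  shows "(rev u @ u, []) \<in> weyl_cong S"
  using assms
proof (induction u)
  case Nil
  then show ?case by (simp add: weyl_cong.refl)
next
  case (Cons i u)
  then have "(rev u @ [i, i] @ u, rev u @ u) \<in> weyl_cong S"
    by (intro weyl_cong_cancel) (auto simp: in_lists_conv_set)
  with Cons show ?case by (auto intro: weyl_cong.trans)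
qed

lemma reduced_exists:
  assumes "u \<in> lists S"
  obtains v where "reduced S v" "(u, v) \<in> weyl_cong S"
proof -
  obtain v where v: "(u, v) \<in> weyl_cong S"
      "\<And>w. (u, w) \<in> weyl_cong S \<Longrightarrow> length v \<le> length w"
    using ex_has_least_nat[of "\<lambda>v. (u, v) \<in> weyl_cong S" u length] weyl_cong.refl[OF assms]
    by blast
  moreover have "reduced S v"
    unfolding reduced_def using v weyl_cong_lists[OF v(1)] by (blast intro: weyl_cong.trans)
  ultimately show ?thesis using that by blast
qed

lemma reduced_cong:
  assumes "reduced S u" "(u, v) \<in> weyl_cong S" "length v \<le> length u"
  shows "reduced S v"
  using assms weyl_cong_lists[OF assms(2)] unfolding reduced_def
  by (meson le_trans weyl_cong.trans)

lemma reduced_prefix: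
  assumes "reduced S (u @ v)"
  shows "reduced S u"
  unfolding reduced_def
proof (intro conjI allI impI)
  show "u \<in> lists S" using assms by (simp add: reduced_def)
  fix w assume "(u, w) \<in> weyl_cong S"
  then have "(u @ v, w @ v) \<in> weyl_cong S"
    using assms by (intro weyl_cong_right) (auto simp: reduced_def)
  then show "length u \<le> length w" using assms unfolding reduced_def by fastforce
qed

lemma reduced_rev:
  assumes "reduced S u"
  shows "reduced S (rev u)"
  unfolding reduced_def
proof (intro conjI allI impI)
  show "rev u \<in> lists S" using assms by (auto simp: reduced_def in_lists_conv_set)
  fix w assume "(rev u, w) \<in> weyl_cong S"
  from weyl_cong_rev[OF this] show "length (rev u) \<le> length w"
    using assms unfolding reduced_def by fastforce
qed

text \<open>The relations preserve the parity of the length, so a word that stops being reduced when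
  a letter is appended gets shorter by exactly one; cancelling that letter again yields a
  reduced expression of the original element that ends in it.\<close>

lemma not_reduced_snoc:
  assumes "reduced S u" "s \<in> S" "\<not> reduced S (u @ [s])"
  obtains v where "(u, v @ [s]) \<in> weyl_cong S" "reduced S (v @ [s])" "length u = Suc (length v)"
proof -
  have us: "u @ [s] \<in> lists S" "u \<in> lists S" using assms by (auto simp: reduced_def)
  then obtain v where v: "(u @ [s], v) \<in> weyl_cong S" "length v < Suc (length u)"
    using assms(3) unfolding reduced_def by (metis length_append_singleton not_le)
  have "even (Suc (length u)) = even (length v)" using weyl_cong_parity[OF v(1)] by simp
  with v(2) have len: "length v < length u" by (metis even_Suc less_antisym)
  have "(u @ [s] @ [s], v @ [s]) \<in> weyl_cong S"
    using weyl_cong_right[OF v(1), of "[s]"] assms(2) by simp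
  moreover have "(u @ [s] @ [s], u) \<in> weyl_cong S"
    using weyl_cong_cancel[of u S s "[]"] us assms(2) by simp
  ultimately have c: "(u, v @ [s]) \<in> weyl_cong S"
    by (blast intro: weyl_cong.sym weyl_cong.trans)
  moreover have "reduced S (v @ [s])"
    using reduced_cong[OF assms(1) c] len by simp
  moreover have "length u = Suc (length v)"
    using assms(1) c len unfolding reduced_def by fastforce
  ultimately show ?thesis using that by blast
qed

text \<open>This is the geometric meaning of length: \<open>us\<close> is longer than \<open>u\<close> only if \<open>u\<close> sends
  \<open>\<alpha>\<^sub>s\<close> to a positive root. Write \<open>u = wt\<close>. If \<open>ws\<close> is reduced as well, \<open>u(\<alpha>\<^sub>s)\<close> is a
  nonnegative combination of \<open>w(\<alpha>\<^sub>s)\<close> and \<open>w(\<alpha>\<^sub>t)\<close>, and induction applies to both. Otherwise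
  \<open>w\<close> has a reduced expression \<open>vs\<close>, and the argument is repeated with \<open>v\<close>. It stops because
  the relation between \<open>s\<close> and \<open>t\<close> has length at most three: one more step would make \<open>us\<close>
  shorter than \<open>u\<close>.\<close>

lemma reduced_snoc_nonneg:
  assumes "finite S" "reduced S (u @ [s])"
  shows "0 \<le> int_act S u (int_simple s) x"
  using assms(2)
proof (induction "length u" arbitrary: u s x rule: less_induct)
  case less
  have sS: "s \<in> S" and uS: "u \<in> lists S" using less.prems by (auto simp: reduced_def)
  show ?case
  proof (cases u rule: rev_cases)
    case Nil
    then show ?thesis by (simp add: int_simple_def)
  next
    case (snoc w t)
    have red_u: "reduced S u" using reduced_prefix less.prems by blast
    then have red_w: "reduced S w" using reduced_prefix snoc by blast
    have tS: "t \<in> S" and wS: "w \<in> lists S" using uS snoc by auto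
    have "t \<noteq> s"
    proof
      assume "t = s"
      then have "(u @ [s], w) \<in> weyl_cong S"
        using weyl_cong_cancel[of w S s "[]"] wS sS snoc by simp
      then show False using less.prems snoc by (fastforce simp: reduced_def)
    qed
    have pos_t: "0 \<le> int_act S w (int_simple t) x"
      using less.hyps[of w t] red_u snoc by simp
    have u_act: "int_act S u (int_simple s) =
        (\<lambda>x. int_act S w (int_simple s) x - cartan t s * int_act S w (int_simple t) x)"
      using int_act_linear[of S w 1 "int_simple s" "- cartan t s" "int_simple t"]
      by (simp add: snoc int_act_append int_act_Cons int_refl_simple assms(1) sS)
    show ?thesis
    proof (cases "reduced S (w @ [s])")
      case True
      then have "0 \<le> int_act S w (int_simple s) x"
        using less.hyps[of w s] snoc by simp
      then show ?thesis using pos_t cartan_cases[OF \<open>t \<noteq> s\<close>] u_act by auto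
    next
      case False
      then obtain v where v: "(w, v @ [s]) \<in> weyl_cong S" "reduced S (v @ [s])"
          "length w = Suc (length v)"
        using not_reduced_snoc red_w sS by blast
      have vS: "v \<in> lists S" using v(2) by (simp add: reduced_def)
      have red_v: "reduced S v" using v(2) reduced_prefix by blast
      have us_v: "(u @ [s], v @ [s, t, s]) \<in> weyl_cong S"
        using weyl_cong_right[OF v(1), of "[t, s]"] snoc tS sS by simp
      have act: "int_act S u y = int_act S v (int_act S [s, t] y)" for y
        using int_act_cong[OF assms(1) v(1)] snoc by (simp add: int_act_append int_act_Cons)
      consider "cartan s t = 0" | "cartan s t = -1" using cartan_cases \<open>t \<noteq> s\<close> by metis
      then show ?thesis
      proof cases
        case 1
        \<comment> \<open>Here \<open>us = vsts = vt\<close>, which is shorter than \<open>u\<close>.\<close>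
        have "(v @ ([s, t] @ [s]), v @ ([t, s] @ [s])) \<in> weyl_cong S"
          by (intro weyl_cong_left weyl_cong_right weyl_cong.commute) (use 1 sS tS vS in auto)
        moreover have "((v @ [t]) @ [s, s] @ [], (v @ [t]) @ []) \<in> weyl_cong S"
          by (intro weyl_cong_cancel) (use sS tS vS in auto)
        ultimately have "(u @ [s], v @ [t]) \<in> weyl_cong S"
          using us_v by (auto intro: weyl_cong.trans)
        then have False
          using less.prems v(3) snoc unfolding reduced_def by fastforce
        then show ?thesis ..
      next
        case 2
        then have ts: "cartan t s = -1" using cartan_sym by metis
        have "int_act S [s, t] (int_simple s) = int_simple t"
        proof -
          have "int_refl S t (int_simple s) = (\<lambda>x. 1 * int_simple s x + 1 * int_simple t x)"
            using assms(1) sS ts by (simp add: int_refl_simple)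
          then have "int_act S [s, t] (int_simple s) =
              (\<lambda>x. 1 * int_refl S s (int_simple s) x + 1 * int_refl S s (int_simple t) x)"
            by (simp only: int_act_Cons int_act_Nil int_refl_linear)
          then show ?thesis
            using assms(1) sS tS 2 by (simp add: int_refl_simple)
        qed
        then have *: "int_act S u (int_simple s) = int_act S v (int_simple t)"
          using act by simp
        show ?thesis
        proof (cases "reduced S (v @ [t])")
          case True
          then show ?thesis using less.hyps[of v t] v(3) snoc * by simp
        next
          case False
          then obtain y where y: "(v, y @ [t]) \<in> weyl_cong S" "reduced S (y @ [t])"
              "length v = Suc (length y)"
            using not_reduced_snoc red_v tS by blast
          have yS: "y \<in> lists S" using y(2) by (simp add: reduced_def)
          \<comment> \<open>Here \<open>us = ytsts = yst\<close> by the braid relation, which is shorter than \<open>u\<close>.\<close>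
          have "(v @ [s, t, s], y @ [t] @ [s, t, s]) \<in> weyl_cong S"
            using weyl_cong_right[OF y(1), of "[s, t, s]"] sS tS by simp
          moreover have "((y @ [t]) @ [s, t, s], (y @ [t]) @ [t, s, t]) \<in> weyl_cong S"
            by (intro weyl_cong_left weyl_cong.braid) (use 2 sS tS yS in auto)
          moreover have "(y @ [t, t] @ [s, t], y @ [s, t]) \<in> weyl_cong S"
            by (intro weyl_cong_cancel) (use sS tS yS in auto)
          ultimately have "(u @ [s], y @ [s, t]) \<in> weyl_cong S"
            using us_v by (auto intro: weyl_cong.trans)
          then have False
            using less.prems v(3) y(3) snoc unfolding reduced_def by fastforce
          then show ?thesis ..
        qed
      qed
    qed
  qed
qed

lemma int_act_snoc_self:
  assumes "finite S" "s \<in> S"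
  shows "int_act S (v @ [s]) (int_simple s) = (\<lambda>x. - int_act S v (int_simple s) x)"
  using int_act_uminus[of S v "int_simple s"] assms
  by (simp add: int_act_append int_act_Cons int_refl_simple)

lemma not_reduced_snoc_nonpos:
  assumes "finite S" "reduced S u" "s \<in> S" "\<not> reduced S (u @ [s])"
  shows "int_act S u (int_simple s) x \<le> 0"
proof -
  obtain v where v: "(u, v @ [s]) \<in> weyl_cong S" "reduced S (v @ [s])"
    using not_reduced_snoc assms by blast
  then show ?thesis
    using int_act_cong[OF assms(1) v(1)] int_act_snoc_self[OF assms(1,3)]
      reduced_snoc_nonneg[OF assms(1) v(2)] by simp
qed

text \<open>A nonempty reduced word that ends in \<open>s\<close> sends \<open>\<alpha>\<^sub>s\<close> to a vector without positive
  coordinates, so it cannot act trivially.\<close>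

lemma int_act_faithful:
  assumes "finite S" "u \<in> lists S" "\<And>s. s \<in> S \<Longrightarrow> int_act S u (int_simple s) = int_simple s"
  shows "(u, []) \<in> weyl_cong S"
proof -
  obtain v where v: "reduced S v" "(u, v) \<in> weyl_cong S"
    using reduced_exists[OF assms(2)] .
  show ?thesis
  proof (cases v rule: rev_cases)
    case Nil
    then show ?thesis using v(2) by simp
  next
    case (snoc w s)
    have sS: "s \<in> S" using v(1) snoc by (simp add: reduced_def)
    have "int_simple s = (\<lambda>x. - int_act S w (int_simple s) x)"
      using assms(3)[OF sS] int_act_cong[OF assms(1) v(2)] int_act_snoc_self[OF assms(1) sS, of w]
      by (simp add: snoc)
    then have "int_simple s s = - int_act S w (int_simple s) s" by (rule fun_cong)
    then show ?thesis
      using reduced_snoc_nonneg[of S w s s] assms(1) v(1) snoc by (simp add: int_simple_def)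
  qed
qed

lemma int_simple_nonzero: "int_simple i \<noteq> (\<lambda>x. 0)"
  by (auto simp: int_simple_def fun_eq_iff intro!: exI[of _ i])

lemma int_simple_inject: "int_simple i = int_simple j \<longleftrightarrow> i = j"
  by (auto simp: int_simple_def fun_eq_iff)

section \<open>Finite groups: the longest element\<close>

lemma finite_carrier_if_bounded:
  assumes "finite S" "\<And>v. reduced S v \<Longrightarrow> length v \<le> n"
  shows "finite (carrier (weyl_group S))"
proof (rule finite_subset)
  show "carrier (weyl_group S) \<subseteq>
      (\<lambda>u. weyl_cong S `` {u}) ` {u. set u \<subseteq> S \<and> length u \<le> n}"
  proof
    fix C assume "C \<in> carrier (weyl_group S)"
    then obtain u where u: "u \<in> lists S" "C = weyl_cong S `` {u}"
      by (auto simp: weyl_group_def quotient_def)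
    obtain v where v: "reduced S v" "(u, v) \<in> weyl_cong S" using reduced_exists[OF u(1)] .
    have "C = weyl_cong S `` {v}" using u(2) equiv_class_eq[OF equiv_weyl_cong v(2)] by simp
    moreover have "set v \<subseteq> S" "length v \<le> n"
      using v(1) assms(2) by (auto simp: reduced_def)
    ultimately show "C \<in> (\<lambda>u. weyl_cong S `` {u}) ` {u. set u \<subseteq> S \<and> length u \<le> n}" by blast
  qed
  show "finite ((\<lambda>u. weyl_cong S `` {u}) ` {u. set u \<subseteq> S \<and> length u \<le> n})"
    using finite_lists_length_le[OF assms(1)] by simp
qed

text \<open>Congruent reduced words have the same length, so in a finite group only finitely many
  lengths of reduced words occur.\<close>

lemma longest_word_exists:
  assumes "finite (carrier (weyl_group S))"
  obtains w where "reduced S w" "\<And>v. reduced S v \<Longrightarrow> length v \<le> length w"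
proof -
  let ?len = "\<lambda>C. LEAST n. n \<in> length ` C"
  have "length v \<in> ?len ` carrier (weyl_group S)" if "reduced S v" for v
  proof
    show "weyl_cong S `` {v} \<in> carrier (weyl_group S)"
      using that by (auto simp: weyl_group_def quotient_def reduced_def)
    have "v \<in> weyl_cong S `` {v}" using that by (auto simp: reduced_def intro: weyl_cong.refl)
    then show "length v = (LEAST n. n \<in> length ` (weyl_cong S `` {v}))"
      using that by (intro Least_equality[symmetric]) (auto simp: reduced_def)
  qed
  then have fin: "finite (length ` {v. reduced S v})"
    using finite_subset[of "length ` {v. reduced S v}"] assms by blast
  have "reduced S []" by (simp add: reduced_def)
  then have "Max (length ` {v. reduced S v}) \<in> length ` {v. reduced S v}"
    using fin by (intro Max_in) auto
  then obtain w where "reduced S w" "Max (length ` {v. reduced S v}) = length w" by auto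
  then show ?thesis using that Max_ge[OF fin] by (metis imageI mem_Collect_eq)
qed

lemma longest_word_nonpos:
  assumes "finite S" "reduced S w" "\<And>v. reduced S v \<Longrightarrow> length v \<le> length w" "s \<in> S"
  shows "int_act S w (int_simple s) x \<le> 0"
proof (rule not_reduced_snoc_nonpos[OF assms(1,2,4)])
  show "\<not> reduced S (w @ [s])" using assms(3)[of "w @ [s]"] by auto
qed

text \<open>Building up \<open>w\<close> letter by letter, each letter adds to the image of \<open>d\<close> a nonnegative
  multiple of a positive root.\<close>

lemma antidominant_le:
  assumes "finite S" "\<And>i. i \<in> S \<Longrightarrow> int_pairing S i d \<le> 0" "reduced S w"
  shows "d x \<le> int_act S w d x"
  using assms(3)
proof (induction w rule: rev_induct)
  case (snoc s w)
  have "int_act S (w @ [s]) d =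
      (\<lambda>x. int_act S w d x - int_pairing S s d * int_act S w (int_simple s) x)"
    using int_act_linear[of S w 1 d "- int_pairing S s d" "int_simple s"]
    by (simp add: int_act_append int_act_Cons int_refl_def)
  moreover have "0 \<le> int_act S w (int_simple s) x"
    using reduced_snoc_nonneg[OF assms(1) snoc.prems] .
  moreover have "int_pairing S s d \<le> 0" using assms(2) snoc.prems by (simp add: reduced_def)
  ultimately show ?case
    using snoc.IH[OF reduced_prefix[OF snoc.prems]] mult_nonpos_nonneg by fastforce
qed simp

text \<open>The longest element \<open>w\<close> sends every simple root to a nonpositive vector, so
  \<open>d \<le> w(d) \<le> 0\<close> for an antidominant \<open>d \<ge> 0\<close>.\<close>

lemma finite_no_antidominant:
  assumes "finite S" "finite (carrier (weyl_group S))"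
    and "\<And>x. 0 \<le> d x" "supported S d"
    and "\<And>i. i \<in> S \<Longrightarrow> int_pairing S i d \<le> 0"
  shows "d x = 0"
proof -
  obtain w where w: "reduced S w" "\<And>v. reduced S v \<Longrightarrow> length v \<le> length w"
    using longest_word_exists[OF assms(2)] by blast
  have "int_act S w d x = (\<Sum>i\<in>S. d i * int_act S w (int_simple i) x)"
    using int_act_expand[OF assms(1,4)] by simp
  also have "\<dots> \<le> 0"
    by (intro sum_nonpos mult_nonneg_nonpos assms(3) longest_word_nonpos[OF assms(1) w])
  finally show ?thesis using antidominant_le[OF assms(1,5) w(1), of x] assms(3)[of x] by simp
qed

definition minus_one_word :: "vertex set \<Rightarrow> vertex list \<Rightarrow> bool" where
  "minus_one_word S u \<longleftrightarrow>
    u \<in> lists S \<and> (\<forall>s\<in>S. int_act S u (int_simple s) = (\<lambda>x. - int_simple s x))"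

lemma minus_one_act:
  assumes "finite S" "minus_one_word S u" "supported S y"
  shows "int_act S u y = (\<lambda>x. - y x)"
proof
  fix x
  have "int_act S u y x = (\<Sum>i\<in>S. y i * int_act S u (int_simple i) x)"
    using int_act_expand[OF assms(1,3)] by simp
  also have "\<dots> = (\<Sum>i\<in>S. - (y i * int_simple i x))"
    using assms(2) by (intro sum.cong) (auto simp: minus_one_word_def)
  also have "\<dots> = - y x"
    using fun_cong[OF int_vec_expand[OF assms(1,3)], of x] by (simp add: sum_negf)
  finally show "int_act S u y x = - y x" .
qed

text \<open>Every reduced word \<open>v\<close> is an initial segment of a reduced expression \<open>vx\<close> of the element
  \<open>-1\<close>, which bounds the length of reduced words. To lengthen \<open>v\<close> by a letter \<open>s\<close> when \<open>vs\<close> is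
  reduced, note that \<open>x\<^sup>-\<^sup>1(\<alpha>\<^sub>s) = -v(\<alpha>\<^sub>s)\<close> is not positive, so that \<open>x\<close> has a reduced
  expression that starts with \<open>s\<close>.\<close>

lemma minus_one_imp_finite:
  assumes "finite S" "minus_one_word S u"
  shows "finite (carrier (weyl_group S))"
proof -
  obtain w where w: "reduced S w" "(u, w) \<in> weyl_cong S"
    using reduced_exists[of u S] assms(2) by (auto simp: minus_one_word_def)
  have act_w: "int_act S w y = (\<lambda>x. - y x)" if "supported S y" for y
    using int_act_cong[OF assms(1) w(2)] minus_one_act[OF assms that] by simp
  have "\<exists>x. (v @ x, w) \<in> weyl_cong S \<and> length v + length x = length w" if "reduced S v" for v
    using that
  proof (induction v rule: rev_induct)
    case Nil
    then show ?case using w(1) by (intro exI[of _ w]) (auto simp: reduced_def intro: weyl_cong.refl)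
  next
    case (snoc s v)
    have sS: "s \<in> S" and vS: "v \<in> lists S" using snoc.prems by (auto simp: reduced_def)
    obtain x where x: "(v @ x, w) \<in> weyl_cong S" "length v + length x = length w"
      using snoc.IH[OF reduced_prefix[OF snoc.prems]] by blast
    have xS: "x \<in> lists S" using weyl_cong_lists[OF x(1)] by simp
    then have rxS: "rev x \<in> lists S" by (auto simp: in_lists_conv_set)
    have red_x: "reduced S x"
      unfolding reduced_def
    proof (intro conjI allI impI xS)
      fix y assume "(x, y) \<in> weyl_cong S"
      then have "(v @ x, v @ y) \<in> weyl_cong S" using weyl_cong_left vS by blast
      then have "(w, v @ y) \<in> weyl_cong S" using x(1) by (blast intro: weyl_cong.sym weyl_cong.trans)
      then show "length x \<le> length y" using w(1) x(2) unfolding reduced_def by fastforce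
    qed
    let ?y = "int_act S (rev x) (int_simple s)"
    have xy: "int_act S x ?y = int_simple s"
      using int_act_cong[OF assms(1) weyl_cong_rev_cancel[OF rxS]] by (simp add: int_act_append)
    have "int_act S v (int_simple s) = int_act S w ?y"
      using xy int_act_cong[OF assms(1) x(1), of ?y] by (simp add: int_act_append)
    also have "\<dots> = (\<lambda>z. - ?y z)"
      using sS by (intro act_w supportedI) (auto simp: int_act_outside[OF rxS] int_simple_def)
    finally have neg: "?y z \<le> 0" for z
      using reduced_snoc_nonneg[OF assms(1) snoc.prems, of z] by simp
    have "\<not> reduced S (rev x @ [s])"
    proof
      assume "reduced S (rev x @ [s])"
      then have "?y = (\<lambda>z. 0)"
        using neg reduced_snoc_nonneg[OF assms(1)] by (intro ext order_antisym) auto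
      then have "int_simple s = (\<lambda>z. 0)" using xy by (simp add: int_act_zero)
      then show False by (simp add: int_simple_nonzero)
    qed
    then obtain y where y: "(rev x, y @ [s]) \<in> weyl_cong S" "length (rev x) = Suc (length y)"
      using not_reduced_snoc[OF reduced_rev[OF red_x] sS] by blast
    have "(x, s # rev y) \<in> weyl_cong S" using weyl_cong_rev[OF y(1)] by simp
    then have "(v @ x, v @ s # rev y) \<in> weyl_cong S" using weyl_cong_left vS by blast
    then have "((v @ [s]) @ rev y, w) \<in> weyl_cong S"
      using x(1) by (auto intro: weyl_cong.sym weyl_cong.trans)
    moreover have "length (v @ [s]) + length (rev y) = length w" using x(2) y(2) by simp
    ultimately show ?case by blast
  qed
  then have "length v \<le> length w" if "reduced S v" for v
    using that by (metis le_add1)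
  then show ?thesis using finite_carrier_if_bounded[OF assms(1)] by blast
qed

section \<open>The diagram automorphism of the longest element\<close>

definition int_form :: "vertex set \<Rightarrow> (vertex \<Rightarrow> int) \<Rightarrow> (vertex \<Rightarrow> int) \<Rightarrow> int" where
  "int_form S v w = (\<Sum>i\<in>S. v i * int_pairing S i w)"

lemma int_form_commute: "int_form S v w = int_form S w v"
proof -
  have "int_form S v w = (\<Sum>i\<in>S. \<Sum>j\<in>S. v i * cartan i j * w j)"
    by (simp add: int_form_def int_pairing_def sum_distrib_left mult.assoc)
  also have "\<dots> = (\<Sum>j\<in>S. \<Sum>i\<in>S. v i * cartan i j * w j)" by (rule sum.swap)
  also have "\<dots> = int_form S w v"
    unfolding int_form_def int_pairing_def sum_distrib_left
    by (auto intro!: sum.cong) (metis cartan_sym mult.assoc mult.commute)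
  finally show ?thesis .
qed

lemma int_form_simple_left:
  assumes "finite S" "i \<in> S"
  shows "int_form S (int_simple i) w = int_pairing S i w"
proof -
  have "int_form S (int_simple i) w = (\<Sum>h\<in>S. if h = i then int_pairing S i w else 0)"
    unfolding int_form_def by (intro sum.cong) (auto simp: int_simple_def)
  then show ?thesis using assms by simp
qed

lemma int_form_diff_left:
  "int_form S (\<lambda>x. v x - q * v' x) w = int_form S v w - q * int_form S v' w"
  by (simp add: int_form_def algebra_simps sum_subtractf sum_distrib_left)

lemma int_form_refl:
  assumes "finite S" "i \<in> S"
  shows "int_form S (int_refl S i v) (int_refl S i w) = int_form S v w"
proof -
  have right: "int_form S y (\<lambda>x. v x - q * v' x) = int_form S y v - q * int_form S y v'" for y v q v'
    using int_form_diff_left[of S v q v' y] by (simp only: int_form_commute[of S _ y])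
  have [simp]: "int_form S y (int_simple i) = int_pairing S i y" for y
    using int_form_simple_left[OF assms] int_form_commute by metis
  show ?thesis
    unfolding int_refl_def int_form_diff_left right
    using assms by (simp add: int_form_simple_left int_pairing_simple algebra_simps)
qed

lemma int_form_act:
  assumes "finite S" "u \<in> lists S"
  shows "int_form S (int_act S u v) (int_act S u w) = int_form S v w"
  using assms(2) by (induction u) (simp_all add: int_act_Cons int_form_refl assms(1))

text \<open>If \<open>w\<close> is longest, so is its inverse, and the matrices of \<open>-w\<close> and of its inverse are both
  nonnegative. A nonnegative integral matrix with a nonnegative integral inverse permutes the
  basis, and this permutation preserves \<open>B\<close>.\<close>

lemma longest_word_automorphism:
  assumes "finite S" "finite (carrier (weyl_group S))"
  obtains w \<sigma> where "w \<in> lists S" "\<sigma> ` S \<subseteq> S" "inj_on \<sigma> S"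
    "\<And>i. i \<in> S \<Longrightarrow> int_act S w (int_simple i) = (\<lambda>x. - int_simple (\<sigma> i) x)"
    "\<And>i j. i \<in> S \<Longrightarrow> j \<in> S \<Longrightarrow> cartan (\<sigma> i) (\<sigma> j) = cartan i j"
proof -
  obtain w where w: "reduced S w" "\<And>v. reduced S v \<Longrightarrow> length v \<le> length w"
    using longest_word_exists[OF assms(2)] by blast
  have wS: "w \<in> lists S" "rev w \<in> lists S"
    using w(1) reduced_rev[OF w(1)] by (auto simp: reduced_def)
  have inv: "int_act S (rev w) (int_act S w y) = y" "int_act S w (int_act S (rev w) y) = y" for y
    using int_act_cong[OF assms(1) weyl_cong_rev_cancel[OF wS(1)]]
      int_act_cong[OF assms(1) weyl_cong_rev_cancel[OF wS(2)]] by (simp_all add: int_act_append)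
  have neg: "int_act S w (int_simple i) x \<le> 0" "int_act S (rev w) (int_simple i) x \<le> 0"
    if "i \<in> S" for i x
    using longest_word_nonpos[OF assms(1) w that]
      longest_word_nonpos[OF assms(1) reduced_rev[OF w(1)] _ that] w(2) by auto
  have out: "supported S (int_act S w (int_simple i))" if "i \<in> S" for i
    using that wS by (intro supportedI) (auto simp: int_act_outside int_simple_def)
  have "\<exists>t\<in>S. int_act S w (int_simple i) = (\<lambda>x. - int_simple t x)" if i: "i \<in> S" for i
  proof -
    let ?m = "\<lambda>x. - int_act S w (int_simple i) x"
    have "\<exists>t\<in>S. ?m t > 0"
    proof (rule ccontr)
      assume "\<not> ?thesis"
      then have "int_act S w (int_simple i) = (\<lambda>x. 0)"
        using neg(1)[OF i] supportedD[OF out[OF i]] by (intro ext order_antisym) (force simp: not_less)+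
      then have "int_simple i = (\<lambda>x. 0)" using inv(1)[of "int_simple i"] by (simp add: int_act_zero)
      then show False by (simp add: int_simple_nonzero)
    qed
    then obtain t where t: "t \<in> S" "?m t > 0" by blast
    let ?y = "int_act S (rev w) (int_simple t)"
    \<comment> \<open>Expand \<open>\<alpha>\<^sub>i\<close> as the image of \<open>-w(\<alpha>\<^sub>i)\<close> under the inverse of \<open>-w\<close>: no term is negative, so
      the image of \<open>\<alpha>\<^sub>t\<close> is at most \<open>\<alpha>\<^sub>i\<close>, and being nonzero it equals \<open>\<alpha>\<^sub>i\<close>.\<close>
    have le: "- ?y x \<le> int_simple i x" for x
    proof -
      have "int_simple i x = int_act S (rev w) (int_act S w (int_simple i)) x"
        using inv by simp
      also have "\<dots> = (\<Sum>h\<in>S. ?m h * - int_act S (rev w) (int_simple h) x)"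
        using int_act_expand[OF assms(1) out[OF i], where u = "rev w"] by simp
      finally have eq: "int_simple i x = (\<Sum>h\<in>S. ?m h * - int_act S (rev w) (int_simple h) x)" .
      have "1 * - ?y x \<le> ?m t * - ?y x"
        using t neg(2)[OF t(1), of x] by (intro mult_right_mono) auto
      then have "- ?y x \<le> ?m t * - ?y x" by simp
      also have "\<dots> \<le> (\<Sum>h\<in>S. ?m h * - int_act S (rev w) (int_simple h) x)"
        using neg i t by (intro member_le_sum assms(1)) (auto intro: mult_nonpos_nonpos)
      finally show ?thesis using eq by simp
    qed
    have "?y = (\<lambda>x. - int_simple i x)"
    proof (cases "?y i = 0")
      case True
      then have "?y x = 0" for x
        using le[of x] neg(2)[OF t(1), of x] by (cases "x = i") (auto simp: int_simple_def)
      then have "?y = (\<lambda>x. 0)" by auto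
      then have "int_simple t = (\<lambda>x. 0)" using inv(2)[of "int_simple t"] by (simp add: int_act_zero)
      then show ?thesis by (simp add: int_simple_nonzero)
    next
      case False
      show ?thesis
      proof
        fix x
        show "?y x = - int_simple i x"
          using le[of x] neg(2)[OF t(1), of x] False by (cases "x = i") (auto simp: int_simple_def)
      qed
    qed
    then have "int_simple t = (\<lambda>x. - int_act S w (int_simple i) x)"
      using inv(2)[of "int_simple t"] by (simp add: int_act_uminus)
    then show ?thesis using t(1) by (intro bexI[of _ t]) auto
  qed
  then obtain \<sigma> where \<sigma>: "\<And>i. i \<in> S \<Longrightarrow> \<sigma> i \<in> S"
      "\<And>i. i \<in> S \<Longrightarrow> int_act S w (int_simple i) = (\<lambda>x. - int_simple (\<sigma> i) x)"
    by metis
  have inj: "inj_on \<sigma> S"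
  proof (rule inj_onI)
    fix i j assume "i \<in> S" "j \<in> S" "\<sigma> i = \<sigma> j"
    then have "int_simple i = int_simple j" using \<sigma>(2) inv(1) by metis
    then show "i = j" by (simp add: int_simple_inject)
  qed
  have form: "int_form S (int_simple i) (int_simple j) = cartan i j" if "i \<in> S" "j \<in> S" for i j
    using that by (simp add: int_form_simple_left int_pairing_simple assms(1))
  have "cartan (\<sigma> i) (\<sigma> j) = cartan i j" if ij: "i \<in> S" "j \<in> S" for i j
  proof -
    have "cartan i j = int_form S (\<lambda>x. - int_simple (\<sigma> i) x) (\<lambda>x. - int_simple (\<sigma> j) x)"
      using form[OF ij] int_form_act[OF assms(1) wS(1)] \<sigma>(2) ij by metis
    also have "\<dots> = int_form S (int_simple (\<sigma> i)) (int_simple (\<sigma> j))"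
      by (simp add: int_form_def int_pairing_def sum_negf)
    finally show ?thesis using form \<sigma>(1) ij by simp
  qed
  then show ?thesis using that wS(1) \<sigma> inj by blast
qed

section \<open>Weights modulo the root lattice\<close>

text \<open>If all \<open>B(\<alpha>\<^sub>i, v)\<close> are divisible by \<open>m\<close>, then \<open>v / m\<close> is a weight, and each simple
  reflection moves a weight by an element of the root lattice.\<close>

lemma int_act_mod:
  assumes "finite S" "u \<in> lists S" "\<And>i. i \<in> S \<Longrightarrow> m dvd int_pairing S i v"
  shows "m dvd int_act S u v x - v x"
  using assms(2)
proof (induction u arbitrary: x)
  case (Cons i u)
  have "int_pairing S i (int_act S u v) - int_pairing S i v =
      (\<Sum>j\<in>S. cartan i j * (int_act S u v j - v j))"
    by (simp add: int_pairing_def sum_subtractf right_diff_distrib)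
  then have "m dvd int_pairing S i (int_act S u v) - int_pairing S i v"
    using Cons by (auto intro: dvd_sum)
  moreover have "m dvd int_pairing S i v" using assms(3)[of i] Cons.hyps by simp
  ultimately have "m dvd int_pairing S i (int_act S u v)"
    using dvd_add[of m "int_pairing S i (int_act S u v) - int_pairing S i v"] by fastforce
  then have "m dvd (int_act S u v x - v x) - int_pairing S i (int_act S u v) * int_simple i x"
    using Cons by (intro dvd_diff[OF _ dvd_mult2]) auto
  then show ?case by (simp add: int_act_Cons int_refl_def algebra_simps)
qed simp

section \<open>Coordinates along the arms of the diagram\<close>

definition arm_len :: "nat \<Rightarrow> nat \<Rightarrow> nat \<Rightarrow> nat \<Rightarrow> nat" where
  "arm_len a b c k = (if k = 0 then a else if k = 1 then b else if k = 2 then c else 0)"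

text \<open>The branch vertex counts as the vertex at distance zero on each arm.\<close>

definition along :: "nat \<Rightarrow> nat \<Rightarrow> vertex" where
  "along k d = (if d = 0 then Branch else Arm k d)"

lemma Branch_in_Y [simp]: "Branch \<in> Y a b c"
  by (simp add: Y_def)

lemma Arm_in_Y: "Arm k d \<in> Y a b c \<longleftrightarrow> 1 \<le> d \<and> d \<le> arm_len a b c k"
  by (auto simp: Y_def arm_len_def)

lemma cartan_sum_Branch:
  fixes v :: "vertex \<Rightarrow> 'r::comm_ring_1"
  assumes "supported (Y a b c) v"
  shows "(\<Sum>j\<in>Y a b c. of_int (cartan Branch j) * v j) =
    2 * v Branch - (\<Sum>h\<in>{0, 1, 2}. v (Arm h 1))"
proof -
  let ?T = "{Branch, Arm 0 1, Arm 1 1, Arm 2 1}"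
  have adj: "adjacent Branch j \<Longrightarrow> j \<in> Y a b c \<Longrightarrow> j \<in> ?T" for j
    by (cases j) (auto simp: Arm_in_Y arm_len_def split: if_splits)
  have "(\<Sum>j\<in>Y a b c. of_int (cartan Branch j) * v j) =
      (\<Sum>j\<in>?T. of_int (cartan Branch j) * v j)"
    by (rule sum.mono_neutral_cong) (use assms adj in \<open>auto simp: finite_Y cartan_def supportedD\<close>)
  then show ?thesis by (simp add: cartan_def algebra_simps)
qed

text \<open>Because \<open>v\<close> vanishes outside the diagram, the last vertex of an arm is no exception.\<close>

lemma cartan_sum_Arm:
  fixes v :: "vertex \<Rightarrow> 'r::comm_ring_1"
  assumes "supported (Y a b c) v" "d \<ge> 1"
  shows "(\<Sum>j\<in>Y a b c. of_int (cartan (Arm k d) j) * v j) =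
    2 * v (Arm k d) - v (along k (d - 1)) - v (Arm k (Suc d))"
proof -
  let ?T = "{Arm k d, along k (d - 1), Arm k (Suc d)}"
  have adj: "adjacent (Arm k d) j \<Longrightarrow> j \<in> Y a b c \<Longrightarrow> j \<in> ?T" for j
    using assms(2) by (cases j) (auto simp: along_def Arm_in_Y)
  have "(\<Sum>j\<in>Y a b c. of_int (cartan (Arm k d) j) * v j) =
      (\<Sum>j\<in>?T. of_int (cartan (Arm k d) j) * v j)"
    by (rule sum.mono_neutral_cong) (use assms adj in \<open>auto simp: finite_Y cartan_def supportedD\<close>)
  moreover have "Arm k d \<noteq> along k (d - 1)" "along k (d - 1) \<noteq> Arm k (Suc d)"
    "adjacent (Arm k d) (along k (d - 1))" "adjacent (Arm k d) (Arm k (Suc d))"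
    using assms(2) by (auto simp: along_def)
  ultimately show ?thesis by (simp add: cartan_def algebra_simps)
qed

lemma int_pairing_Branch:
  assumes "supported (Y a b c) v"
  shows "int_pairing (Y a b c) Branch v = 2 * v Branch - (\<Sum>h\<in>{0, 1, 2}. v (Arm h 1))"
  using cartan_sum_Branch[of a b c v] assms by (simp add: int_pairing_def)

lemma int_pairing_Arm:
  assumes "supported (Y a b c) v" "d \<ge> 1"
  shows "int_pairing (Y a b c) (Arm k d) v =
    2 * v (Arm k d) - v (along k (d - 1)) - v (Arm k (Suc d))"
  using cartan_sum_Arm[of a b c v d k] assms by (simp add: int_pairing_def)

section \<open>Which diagrams give finite groups\<close>

text \<open>This is \<open>1/(a+1) + 1/(b+1) + 1/(c+1) > 1\<close> without denominators. If it fails, the vector that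
  decreases linearly along each arm and would reach zero one step beyond its end is
  antidominant: \<open>B(\<alpha>\<^sub>i, v)\<close> vanishes at the vertices of the arms, and at the branch vertex it
  is the sum of the three slopes minus the value there.\<close>

lemma finite_imp_reciprocals:
  assumes "finite (carrier (weyl_group (Y a b c)))"
  shows "(a + 1) * (b + 1) * (c + 1) < (b + 1) * (c + 1) + (a + 1) * (c + 1) + (a + 1) * (b + 1)"
proof (rule ccontr)
  assume "\<not> ?thesis"
  then have le: "int ((b + 1) * (c + 1)) + int ((a + 1) * (c + 1)) + int ((a + 1) * (b + 1))
      \<le> int ((a + 1) * (b + 1) * (c + 1))"
    by (simp only: not_less of_nat_add[symmetric] of_nat_le_iff)
  define m where "m = int ((a + 1) * (b + 1) * (c + 1))"
  \<comment> \<open>The slope on arm \<open>k\<close> is \<open>m\<close> divided by one plus its length; other indices count as empty arms.\<close>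
  define s where "s k = (if k = 0 then int ((b + 1) * (c + 1)) else
      if k = 1 then int ((a + 1) * (c + 1)) else
      if k = 2 then int ((a + 1) * (b + 1)) else m)" for k :: nat
  define h where "h k d = max 0 (m - int d * s k)" for k d
  define v where "v x = (case x of Branch \<Rightarrow> m | Arm k d \<Rightarrow> if d = 0 then 0 else h k d)" for x
  have m: "m > 0" unfolding m_def of_nat_0_less_iff by simp
  have s: "(int (arm_len a b c k) + 1) * s k = m" for k
    by (simp add: s_def m_def arm_len_def algebra_simps)
  have s_nonneg: "s k \<ge> 0" for k by (simp add: s_def m_def)
  have s_le: "s k \<le> m" for k
    using s[of k] s_nonneg[of k] mult_right_mono[of 1 "int (arm_len a b c k) + 1" "s k"] by simp
  have "v x = 0" if "x \<notin> Y a b c" for x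
  proof (cases x)
    case Branch
    then show ?thesis using that by simp
  next
    case (Arm k d)
    show ?thesis
    proof (cases "d = 0")
      case True
      then show ?thesis by (simp add: v_def Arm)
    next
      case False
      then have "int (arm_len a b c k) + 1 \<le> int d" using that Arm by (auto simp: Arm_in_Y)
      then have "m \<le> int d * s k" using s[of k] s_nonneg[of k] by (metis mult_right_mono)
      then show ?thesis by (simp add: v_def h_def Arm)
    qed
  qed
  then have out: "supported (Y a b c) v" by (rule supportedI)
  have along: "v (along k d) = h k d" for k d
    using m by (simp add: v_def along_def h_def)
  have "int_pairing (Y a b c) i v \<le> 0" if "i \<in> Y a b c" for i
  proof (cases i)
    case Branch
    have "int_pairing (Y a b c) Branch v = s 0 + s 1 + s 2 - m"
      using s_le by (simp add: int_pairing_Branch[OF out] v_def h_def)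
    then show ?thesis using le by (simp add: Branch s_def m_def)
  next
    case (Arm k d)
    then have d: "d \<ge> 1" using that by (simp add: Arm_in_Y)
    have "v (Arm k d) = h k d" "v (Arm k (Suc d)) = h k (Suc d)"
      using d by (simp_all add: v_def)
    then have "int_pairing (Y a b c) (Arm k d) v = 2 * h k d - h k (d - 1) - h k (Suc d)"
      using d by (simp add: int_pairing_Arm[OF out] along)
    moreover have "int (d - 1) * s k = int d * s k - s k" "int (Suc d) * s k = int d * s k + s k"
      using d by (simp_all add: of_nat_diff algebra_simps)
    \<comment> \<open>A truncated linear function is convex.\<close>
    moreover have "2 * max 0 y - max 0 (y + z) - max 0 (y - z) \<le> 0" for y z :: int
      by (auto simp: max_def)
    note this[of "m - int d * s k" "s k"]
    ultimately show ?thesis using Arm unfolding h_def by (simp add: diff_diff_eq algebra_simps)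
  qed
  moreover have "0 \<le> v x" for x
    using m by (simp add: v_def h_def split: vertex.split)
  ultimately have "v Branch = 0"
    using finite_no_antidominant[OF finite_Y assms _ out] by blast
  then show False using m by (simp add: v_def)
qed

lemma reciprocals_cases:
  fixes p q r :: nat
  assumes "1 \<le> p" "p \<le> q" "q \<le> r"
    and less: "(p + 1) * (q + 1) * (r + 1) <
      (q + 1) * (r + 1) + (p + 1) * (r + 1) + (p + 1) * (q + 1)"
  shows "p = 1 \<and> (q = 1 \<or> q = 2 \<and> r \<in> {2, 3, 4})"
proof -
  have "p = 1"
  proof (rule ccontr)
    assume "p \<noteq> 1"
    then have "3 * ((q + 1) * (r + 1)) \<le> (p + 1) * ((q + 1) * (r + 1))"
      using assms(1) by (intro mult_right_mono) auto
    moreover have "(p + 1) * (r + 1) \<le> (q + 1) * (r + 1)"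
      using assms by (intro mult_right_mono) auto
    moreover have "(p + 1) * (q + 1) \<le> (r + 1) * (q + 1)"
      using assms by (intro mult_right_mono) auto
    moreover have "(r + 1) * (q + 1) = (q + 1) * (r + 1)" by (rule mult.commute)
    moreover have "(p + 1) * (q + 1) * (r + 1) = (p + 1) * ((q + 1) * (r + 1))"
      by (rule mult.assoc)
    ultimately show False using less by linarith
  qed
  then have qr: "q * r < q + r + 3" using less by (simp add: algebra_simps)
  have "q < 3"
  proof (rule ccontr)
    assume "\<not> q < 3"
    then have "3 * r \<le> q * r" by (intro mult_right_mono) auto
    then show False using qr assms \<open>\<not> q < 3\<close> by linarith
  qed
  then have "q = 1 \<or> q = 2" using assms by linarith
  then show ?thesis using \<open>p = 1\<close> qr assms by auto
qed

lemma finite_imp_type: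
  assumes "1 \<le> a" "1 \<le> b" "1 \<le> c" "finite (carrier (weyl_group (Y a b c)))"
  shows "(\<exists>n. type_D a b c n) \<or> type_E a b c 6 \<or> type_E a b c 7 \<or> type_E a b c 8"
proof -
  have sorted: "(\<exists>n. type_D a b c n) \<or> type_E a b c 6 \<or> type_E a b c 7 \<or> type_E a b c 8"
    if "{#a, b, c#} = {#p, q, r#}" "1 \<le> p" "p \<le> q" "q \<le> r"
      "(p + 1) * (q + 1) * (r + 1) < (q + 1) * (r + 1) + (p + 1) * (r + 1) + (p + 1) * (q + 1)"
    for p q r
  proof -
    have "p = 1" "q = 1 \<or> q = 2 \<and> r \<in> {2, 3, 4}"
      using reciprocals_cases[OF that(2-5)] by auto
    moreover have "type_D a b c (r + 3)" if "p = 1" "q = 1"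
      using \<open>{#a, b, c#} = {#p, q, r#}\<close> that \<open>q \<le> r\<close> by (simp add: type_D_def)
    ultimately show ?thesis using that(1) by (auto simp: type_E_def)
  qed
  have less: "(a + 1) * (b + 1) * (c + 1) <
      (b + 1) * (c + 1) + (a + 1) * (c + 1) + (a + 1) * (b + 1)"
    using finite_imp_reciprocals[OF assms(4)] .
  consider "a \<le> b" "b \<le> c" | "a \<le> c" "c \<le> b" | "b \<le> a" "a \<le> c" | "b \<le> c" "c \<le> a"
    | "c \<le> a" "a \<le> b" | "c \<le> b" "b \<le> a" by linarith
  then show ?thesis
  proof cases
    case 1
    show ?thesis by (rule sorted[of a b c]) (use 1 assms less in auto)
  next
    case 2
    show ?thesis by (rule sorted[of a c b]) (use 2 assms less in \<open>auto simp: algebra_simps\<close>)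
  next
    case 3
    show ?thesis by (rule sorted[of b a c]) (use 3 assms less in \<open>auto simp: algebra_simps\<close>)
  next
    case 4
    show ?thesis by (rule sorted[of b c a]) (use 4 assms less in \<open>auto simp: algebra_simps\<close>)
  next
    case 5
    show ?thesis by (rule sorted[of c a b]) (use 5 assms less in \<open>auto simp: algebra_simps\<close>)
  next
    case 6
    show ?thesis by (rule sorted[of c b a]) (use 6 assms less in \<open>auto simp: algebra_simps\<close>)
  qed
qed

text \<open>The types \<open>D\<^sub>n\<close> and \<open>E\<^sub>n\<close> fix the lengths of the arms but not which arm has which length, so
  the arms are named by a permutation of their indices.\<close>

definition arms_perm :: "nat \<Rightarrow> nat \<Rightarrow> nat \<Rightarrow> bool" where
  "arms_perm k l m \<longleftrightarrow> distinct [k, l, m] \<and> {k, l, m} = {0, 1, 2}"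

lemma arms_perm_sum:
  fixes f :: "nat \<Rightarrow> 'r::comm_monoid_add"
  assumes "arms_perm k l m"
  shows "sum f {0, 1, 2} = f k + f l + f m"
proof -
  have "sum f {0, 1, 2} = sum f {k, l, m}" using assms unfolding arms_perm_def by metis
  moreover have "k \<noteq> l" "k \<noteq> m" "l \<noteq> m" using assms by (auto simp: arms_perm_def)
  ultimately show ?thesis by (simp add: add.assoc)
qed

lemma int_pairing_Branch_arms:
  assumes "arms_perm k l m" "supported (Y a b c) v"
  shows "int_pairing (Y a b c) Branch v = 2 * v Branch - (v (Arm k 1) + v (Arm l 1) + v (Arm m 1))"
  unfolding int_pairing_Branch[OF assms(2)] arms_perm_sum[OF assms(1)] by simp

lemma arms_perm_cases:
  assumes "arms_perm k l m" "h \<in> {0, 1, 2}"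
  shows "h = k \<or> h = l \<or> h = m"
  using assms by (auto simp: arms_perm_def)

lemma arm_len_pos_imp: "arm_len a b c h \<ge> 1 \<Longrightarrow> h \<in> {0, 1, 2}"
  by (auto simp: arm_len_def split: if_splits)

lemma multiset_eq_arms:
  assumes "{#a, b, c#} = {#x, y, z#}"
  obtains k l m where "arms_perm k l m"
    "arm_len a b c k = x" "arm_len a b c l = y" "arm_len a b c m = z"
proof -
  have "(a, b, c) \<in> {(x, y, z), (x, z, y), (y, x, z), (y, z, x), (z, x, y), (z, y, x)}"
    using assms by (auto simp: add_eq_conv_ex)
  then consider "a = x" "b = y" "c = z" | "a = x" "b = z" "c = y" | "a = y" "b = x" "c = z"
    | "a = y" "b = z" "c = x" | "a = z" "b = x" "c = y" | "a = z" "b = y" "c = x" by auto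
  then show ?thesis
  proof cases
    case 1 then show ?thesis by (intro that[of 0 1 2]) (auto simp: arms_perm_def arm_len_def)
  next
    case 2 then show ?thesis by (intro that[of 0 2 1]) (auto simp: arms_perm_def arm_len_def)
  next
    case 3 then show ?thesis by (intro that[of 1 0 2]) (auto simp: arms_perm_def arm_len_def)
  next
    case 4 then show ?thesis by (intro that[of 2 0 1]) (auto simp: arms_perm_def arm_len_def)
  next
    case 5 then show ?thesis by (intro that[of 1 2 0]) (auto simp: arms_perm_def arm_len_def)
  next
    case 6 then show ?thesis by (intro that[of 2 1 0]) (auto simp: arms_perm_def arm_len_def)
  qed
qed

section \<open>Weights that exclude minus the identity\<close>

text \<open>Since \<open>W\<close> acts trivially on weights modulo roots, \<open>-1 \<in> W\<close> would make \<open>2v / m\<close> an element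
  of the root lattice.\<close>

lemma no_minus_one_if_weight:
  assumes "finite S" "supported S v" "\<And>i. i \<in> S \<Longrightarrow> m dvd int_pairing S i v"
    and "\<not> m dvd 2 * v x"
  shows "\<not> minus_one_word S u"
proof
  assume u: "minus_one_word S u"
  have "int_act S u v x = - v x"
    using minus_one_act[OF assms(1) u assms(2)] by simp
  then have "m dvd - v x - v x"
    using int_act_mod[OF assms(1) _ assms(3), where u = u and x = x] u by (simp add: minus_one_word_def)
  then have "m dvd - (2 * v x)" by simp
  then show False using assms(4) by (simp only: dvd_minus_iff)
qed

text \<open>The quotient of the weight lattice by the root lattice is cyclic of order four.\<close>

lemma no_minus_one_D_odd:
  assumes "type_D a b c n" "odd n"
  shows "\<not> minus_one_word (Y a b c) u"
proof -
  obtain k l m where klm: "arms_perm k l m" and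
    len: "arm_len a b c k = 1" "arm_len a b c l = 1" "arm_len a b c m = n - 3"
    using assms(1) multiset_eq_arms[of a b c 1 1 "n - 3"] unfolding type_D_def by blast
  define L where "L = n - 3"
  have L: "L \<ge> 1" "even L" using assms by (auto simp: L_def type_D_def)
  have ne: "k \<noteq> l" "k \<noteq> m" "l \<noteq> m" using klm by (auto simp: arms_perm_def)
  \<comment> \<open>\<open>v / 4\<close> is a weight whose class generates the quotient.\<close>
  define v where "v x = (case x of Branch \<Rightarrow> 2 * (int L + 1)
    | Arm h d \<Rightarrow> if h = m \<and> 1 \<le> d \<and> d \<le> L then 2 * (int L + 1 - int d)
        else if x = Arm k 1 then 1 else if x = Arm l 1 then -1 else 0)" for x
  have out: "supported (Y a b c) v"
  proof (rule supportedI)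
    fix x assume "x \<notin> Y a b c"
    then show "v x = 0" using len by (cases x) (auto simp: v_def Arm_in_Y L_def)
  qed
  have am: "v (along m d) = 2 * (int L + 1 - int d)" if "d \<le> Suc L" for d
    using that ne L by (auto simp: v_def along_def)
  show ?thesis
  proof (rule no_minus_one_if_weight[OF finite_Y out, where m = 4 and x = "Arm k 1"])
    show "\<not> 4 dvd 2 * v (Arm k 1)" using ne by (simp add: v_def)
    fix i assume i: "i \<in> Y a b c"
    show "4 dvd int_pairing (Y a b c) i v"
    proof (cases i)
      case Branch
      have "int_pairing (Y a b c) Branch v = 2 * int L + 4"
        using ne L by (simp add: int_pairing_Branch_arms[OF klm out] v_def)
      then show ?thesis using L Branch by (auto elim!: evenE)
    next
      case (Arm h d)
      then have d: "1 \<le> d" "d \<le> arm_len a b c h" using i by (auto simp: Arm_in_Y)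
      have "h = k \<or> h = l \<or> h = m"
        using d arm_len_pos_imp[of a b c h] by (intro arms_perm_cases[OF klm]) auto
      moreover have "4 dvd int_pairing (Y a b c) (Arm m d) v" if "d \<le> L"
        using d that am[of d] am[of "d - 1"] am[of "Suc d"]
        by (simp add: int_pairing_Arm[OF out d(1)] of_nat_diff) (simp add: along_def)
      moreover have "4 dvd int_pairing (Y a b c) (Arm h 1) v" if "h = k \<or> h = l"
        using that ne L by (auto simp: int_pairing_Arm[OF out] along_def v_def elim!: evenE)
      ultimately show ?thesis using d len Arm by (auto simp: L_def)
    qed
  qed
qed

text \<open>The quotient of the weight lattice by the root lattice has order three.\<close>

lemma no_minus_one_E6:
  assumes "type_E a b c 6"
  shows "\<not> minus_one_word (Y a b c) u"
proof -
  have "{#a, b, c#} = {#1, 2, 2#}" using assms by (simp add: type_E_def)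
  then obtain k l m where klm: "arms_perm k l m" and
    len: "arm_len a b c k = 1" "arm_len a b c l = 2" "arm_len a b c m = 2"
    using multiset_eq_arms[of a b c 1 2 2] by blast
  have ne: "k \<noteq> l" "k \<noteq> m" "l \<noteq> m" using klm by (auto simp: arms_perm_def)
  \<comment> \<open>\<open>v / 3\<close> is a weight that is not in the root lattice.\<close>
  define v where "v x = (if x = Arm l 1 then 1 else if x = Arm l 2 then 2 else
    if x = Arm m 1 then -1 else if x = Arm m 2 then -2 else 0 :: int)" for x
  have out: "supported (Y a b c) v"
  proof (rule supportedI)
    fix x assume "x \<notin> Y a b c"
    then show "v x = 0" using len by (cases x) (auto simp: v_def Arm_in_Y)
  qed
  show ?thesis
  proof (rule no_minus_one_if_weight[OF finite_Y out, where m = 3 and x = "Arm l 1"])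
    show "\<not> 3 dvd 2 * v (Arm l 1)" using ne by (simp add: v_def)
    fix i assume i: "i \<in> Y a b c"
    show "3 dvd int_pairing (Y a b c) i v"
    proof (cases i)
      case Branch
      show ?thesis
        unfolding Branch using ne by (simp add: int_pairing_Branch_arms[OF klm out] v_def)
    next
      case (Arm h d)
      then have d: "1 \<le> d" "d \<le> arm_len a b c h" using i by (auto simp: Arm_in_Y)
      have "h = k \<or> h = l \<or> h = m"
        using d arm_len_pos_imp[of a b c h] by (intro arms_perm_cases[OF klm]) auto
      moreover have "d = 1 \<or> d = 2" using d calculation len by auto
      ultimately show ?thesis
        unfolding Arm int_pairing_Arm[OF out d(1)] using ne d len
        by (auto simp: v_def along_def)
    qed
  qed
qed

section \<open>Diagram automorphisms and the longest element\<close>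

lemma adjacent_iff_cartan: "adjacent i j \<longleftrightarrow> cartan i j = -1"
  by (cases i; cases j) (auto simp: cartan_def)

text \<open>The branch vertex is the only vertex with three neighbours, so it is fixed. The images of the
  arms are then determined by the images of their first vertices, and no arm is mapped into a shorter one.\<close>

lemma diagram_automorphism:
  assumes pos: "1 \<le> a" "1 \<le> b" "1 \<le> c"
    and \<sigma>: "\<sigma> ` Y a b c \<subseteq> Y a b c" "inj_on \<sigma> (Y a b c)"
    "\<And>i j. i \<in> Y a b c \<Longrightarrow> j \<in> Y a b c \<Longrightarrow> adjacent (\<sigma> i) (\<sigma> j) = adjacent i j"
  obtains \<pi> where "inj_on \<pi> {0, 1, 2}" "\<pi> ` {0, 1, 2} \<subseteq> {0, 1, 2}"
    "\<And>h. h \<in> {0, 1, 2} \<Longrightarrow> arm_len a b c h \<le> arm_len a b c (\<pi> h)"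
    "\<sigma> Branch = Branch"
    "\<And>h d. Arm h d \<in> Y a b c \<Longrightarrow> \<sigma> (Arm h d) = Arm (\<pi> h) d"
proof -
  let ?S = "Y a b c"
  have first: "Arm h 1 \<in> ?S" if "h \<in> {0, 1, 2}" for h
    using that pos by (auto simp: Arm_in_Y arm_len_def)
  have arm: "h \<in> {0, 1, 2}" if "Arm h d \<in> ?S" for h d
    using that arm_len_pos_imp[of a b c h] by (auto simp: Arm_in_Y)
  have inj: "inj_on (\<lambda>j. \<sigma> (Arm j 1)) {0, 1, 2}"
  proof (rule inj_onI)
    fix i j :: nat assume ij: "i \<in> {0, 1, 2}" "j \<in> {0, 1, 2}" "\<sigma> (Arm i 1) = \<sigma> (Arm j 1)"
    have "Arm i 1 = Arm j 1" by (rule inj_onD[OF \<sigma>(2) ij(3) first[OF ij(1)] first[OF ij(2)]])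
    then show "i = j" by simp
  qed
  have br: "\<sigma> Branch = Branch"
  proof (cases "\<sigma> Branch")
    case (Arm h d)
    have "\<sigma> (Arm j 1) \<in> {along h (d - 1), Arm h (Suc d)}" if "j \<in> {0, 1, 2}" for j
    proof -
      have mem: "\<sigma> (Arm j 1) \<in> ?S" "\<sigma> Branch \<in> ?S" using \<sigma>(1) first[OF that] by auto
      have "adjacent (\<sigma> Branch) (\<sigma> (Arm j 1))" using \<sigma>(3) first[OF that] by simp
      then show ?thesis
        using Arm mem by (cases "\<sigma> (Arm j 1)") (auto simp: along_def Arm_in_Y)
    qed
    then have sub: "(\<lambda>j. \<sigma> (Arm j 1)) ` {0, 1, 2} \<subseteq> {along h (d - 1), Arm h (Suc d)}" by blast
    have "card {0, 1, 2 :: nat} \<le> card {along h (d - 1), Arm h (Suc d)}"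
      using card_inj_on_le[OF inj sub] by simp
    also have "\<dots> \<le> 2" by (simp add: card_insert_if)
    finally show ?thesis by simp
  qed
  have "\<exists>h'. \<sigma> (Arm h 1) = Arm h' 1" if "h \<in> {0, 1, 2}" for h
  proof -
    have "adjacent Branch (\<sigma> (Arm h 1))" using \<sigma>(3)[OF Branch_in_Y first[OF that]] br by simp
    then show ?thesis by (cases "\<sigma> (Arm h 1)") auto
  qed
  then obtain \<pi> where \<pi>: "\<And>h. h \<in> {0, 1, 2} \<Longrightarrow> \<sigma> (Arm h 1) = Arm (\<pi> h) 1" by metis
  have step: "\<sigma> (Arm h d) = Arm (\<pi> h) d" if "Arm h d \<in> ?S" for h d
    using that
  proof (induction d rule: less_induct)
    case (less d)
    have h: "h \<in> {0, 1, 2}" using arm less.prems .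
    have d: "1 \<le> d" "d \<le> arm_len a b c h" using less.prems by (auto simp: Arm_in_Y)
    show ?case
    proof (cases "d = 1")
      case True
      then show ?thesis using \<pi> h by simp
    next
      case False
      then obtain e where e: "d = Suc e" "1 \<le> e" using d by (cases d) auto
      have eS: "Arm h e \<in> ?S" using d e by (simp add: Arm_in_Y)
      have \<sigma>e: "\<sigma> (Arm h e) = Arm (\<pi> h) e" using less.IH[OF _ eS] e by simp
      have prevS: "along h (e - 1) \<in> ?S" using d e by (auto simp: along_def Arm_in_Y)
      have \<sigma>prev: "\<sigma> (along h (e - 1)) = along (\<pi> h) (e - 1)"
        using less.IH[of "e - 1"] prevS e br by (auto simp: along_def)
      have ne: "\<sigma> (Arm h d) \<noteq> \<sigma> (along h (e - 1))"
        using inj_onD[OF \<sigma>(2) _ less.prems prevS] e by (auto simp: along_def)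
      have "adjacent (Arm (\<pi> h) e) (\<sigma> (Arm h d))"
        using \<sigma>(3)[OF eS less.prems] \<sigma>e e by simp
      moreover have "\<sigma> (Arm h d) \<in> ?S" using \<sigma>(1) less.prems by blast
      ultimately show ?thesis
        using ne e unfolding \<sigma>prev
        by (cases "\<sigma> (Arm h d)") (auto simp: along_def Arm_in_Y split: if_splits)
    qed
  qed
  have img: "Arm (\<pi> h) d \<in> ?S" if "Arm h d \<in> ?S" for h d
    using step[OF that] \<sigma>(1) that by (metis image_subset_iff)
  have "inj_on \<pi> {0, 1, 2}"
  proof (rule inj_onI)
    fix h j :: nat assume hj: "h \<in> {0, 1, 2}" "j \<in> {0, 1, 2}" "\<pi> h = \<pi> j"
    then have "\<sigma> (Arm h 1) = \<sigma> (Arm j 1)" using \<pi> by simp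
    then show "h = j" by (rule inj_onD[OF inj _ hj(1,2)])
  qed
  moreover have "\<pi> ` {0, 1, 2} \<subseteq> {0, 1, 2}"
    by (rule image_subsetI) (rule arm[OF img[OF first]])
  moreover have "arm_len a b c h \<le> arm_len a b c (\<pi> h)" if "h \<in> {0, 1, 2}" for h
  proof -
    have "1 \<le> arm_len a b c h" using that pos by (auto simp: arm_len_def)
    then have "Arm h (arm_len a b c h) \<in> ?S" by (simp add: Arm_in_Y)
    from img[OF this] show ?thesis by (simp add: Arm_in_Y)
  qed
  ultimately show ?thesis using that br step by blast
qed

text \<open>The longest element is \<open>-1\<close> as soon as its diagram automorphism is trivial. By
  finiteness the type is \<open>D\<^sub>n\<close> with \<open>n\<close> even, \<open>E\<^sub>7\<close> or \<open>E\<^sub>8\<close>. For \<open>E\<^sub>7\<close> and \<open>E\<^sub>8\<close> the arms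
  have different lengths. For \<open>D\<^sub>n\<close> the two arms of length one could be exchanged; but then the
  longest element would map a half-spin weight to the negative of the other one, and for even
  \<open>n\<close> the two have order two and are distinct modulo the root lattice.\<close>

lemma minus_one_exists:
  assumes pos: "1 \<le> a" "1 \<le> b" "1 \<le> c" and fin: "finite (carrier (weyl_group (Y a b c)))"
    and "\<not> type_D a b c 4" "\<not> (\<exists>n. type_D a b c n \<and> odd n)" "\<not> type_E a b c 6"
  obtains w where "minus_one_word (Y a b c) w"
proof -
  let ?S = "Y a b c"
  obtain w \<sigma> where w: "w \<in> lists ?S" and \<sigma>: "\<sigma> ` ?S \<subseteq> ?S" "inj_on \<sigma> ?S"
      "\<And>i. i \<in> ?S \<Longrightarrow> int_act ?S w (int_simple i) = (\<lambda>x. - int_simple (\<sigma> i) x)"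
      "\<And>i j. i \<in> ?S \<Longrightarrow> j \<in> ?S \<Longrightarrow> cartan (\<sigma> i) (\<sigma> j) = cartan i j"
    using longest_word_automorphism[OF finite_Y fin] by metis
  have adj: "adjacent (\<sigma> i) (\<sigma> j) = adjacent i j" if "i \<in> ?S" "j \<in> ?S" for i j
    using \<sigma>(4) that by (simp add: adjacent_iff_cartan)
  obtain \<pi> where \<pi>: "inj_on \<pi> {0, 1, 2}" "\<pi> ` {0, 1, 2} \<subseteq> {0, 1, 2}"
      "\<And>h. h \<in> {0, 1, 2} \<Longrightarrow> arm_len a b c h \<le> arm_len a b c (\<pi> h)"
      "\<sigma> Branch = Branch" "\<And>h d. Arm h d \<in> ?S \<Longrightarrow> \<sigma> (Arm h d) = Arm (\<pi> h) d"
    using diagram_automorphism[OF pos \<sigma>(1,2) adj] by metis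
  have \<pi>_id: "\<pi> h = h" if "h \<in> {0, 1, 2}" for h
  proof -
    consider (D) n where "type_D a b c n" | (E) r where "{#a, b, c#} = {#1, 2, r#}" "r > 2"
      using finite_imp_type[OF pos fin] assms(7) by (auto simp: type_E_def)
    then show ?thesis
    proof cases
      case E
      then obtain k l m where klm: "arms_perm k l m" and
        len: "arm_len a b c k = 1" "arm_len a b c l = 2" "arm_len a b c m = r"
        using multiset_eq_arms[of a b c 1 2 r] by blast
      have set: "{0, 1, 2} = {k, l, m}" using klm unfolding arms_perm_def by metis
      have ne: "k \<noteq> l" "k \<noteq> m" "l \<noteq> m" using klm by (auto simp: arms_perm_def)
      have mem: "\<pi> j \<in> {k, l, m}" "arm_len a b c j \<le> arm_len a b c (\<pi> j)" if "j \<in> {k, l, m}" for j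
        using \<pi>(2,3) that unfolding set by blast+
      have "\<pi> m = m" using mem[of m] len E(2) by auto
      moreover have "\<pi> l = l"
        using mem[of l] len E(2) calculation inj_onD[OF \<pi>(1)[unfolded set], of l m] ne by auto
      moreover have "\<pi> k = k"
        using mem[of k] calculation inj_onD[OF \<pi>(1)[unfolded set], of k m]
          inj_onD[OF \<pi>(1)[unfolded set], of k l] ne by auto
      ultimately show ?thesis using that unfolding set by blast
    next
      case D
      have n: "n \<ge> 4" "even n" "n \<noteq> 4" using D assms(5,6) by (auto simp: type_D_def)
      obtain k l m where klm: "arms_perm k l m" and
        len: "arm_len a b c k = 1" "arm_len a b c l = 1" "arm_len a b c m = n - 3"
        using D multiset_eq_arms[of a b c 1 1 "n - 3"] unfolding type_D_def by blast
      define L where "L = n - 3"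
      have L: "L \<ge> 2" "odd L" using n by (auto simp: L_def)
      have set: "{0, 1, 2} = {k, l, m}" using klm unfolding arms_perm_def by metis
      have ne: "k \<noteq> l" "k \<noteq> m" "l \<noteq> m" using klm by (auto simp: arms_perm_def)
      have mem: "\<pi> j \<in> {k, l, m}" "arm_len a b c j \<le> arm_len a b c (\<pi> j)" if "j \<in> {k, l, m}" for j
        using \<pi>(2,3) that unfolding set by blast+
      have \<pi>m: "\<pi> m = m" using mem[of m] len L by (auto simp: L_def)
      \<comment> \<open>\<open>v / 2\<close> is congruent to a half-spin weight; exchanging \<open>k\<close> and \<open>l\<close> yields the other one.\<close>
      define v where "v x = (case x of Branch \<Rightarrow> (0::int)
        | Arm h d \<Rightarrow> if h = m \<and> d \<le> L then of_bool (odd d)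
            else if x = Arm k 1 then 1 else 0)" for x
      have out: "supported ?S v"
      proof (rule supportedI)
        fix x assume "x \<notin> ?S"
        then show "v x = 0" using len by (cases x) (auto simp: v_def Arm_in_Y L_def not_le)
      qed
      have even: "2 dvd int_pairing ?S i v" if i: "i \<in> ?S" for i
      proof (cases i)
        case Branch
        show ?thesis
          unfolding Branch using ne L by (simp add: int_pairing_Branch_arms[OF klm out] v_def)
      next
        case (Arm h d)
        then have d: "1 \<le> d" "d \<le> arm_len a b c h" using i by (auto simp: Arm_in_Y)
        have "h = k \<or> h = l \<or> h = m"
          using d arm_len_pos_imp[of a b c h] by (intro arms_perm_cases[OF klm]) auto
        then consider "h = k" "d = 1" | "h = l" "d = 1" | "h = m" "d \<le> L"
          using d len by (auto simp: L_def)
        then show ?thesis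
        proof cases
          case 3
          then have "even d \<Longrightarrow> Suc d \<le> L" using L by (metis Suc_leI le_neq_implies_less)
          then have "v (along m (d - 1)) = of_bool (even d)" "v (Arm m (Suc d)) = of_bool (even d)"
            using 3 d L by (auto simp: v_def along_def)
          then show ?thesis using d 3 Arm by (auto simp: int_pairing_Arm[OF out d(1)])
        qed (use Arm ne in \<open>auto simp: int_pairing_Arm[OF out] v_def along_def\<close>)
      qed
      have "\<pi> k \<noteq> l"
      proof
        assume "\<pi> k = l"
        then have "\<pi> l = k"
          using mem[of l] \<pi>m ne inj_onD[OF \<pi>(1)[unfolded set], of l m]
            inj_onD[OF \<pi>(1)[unfolded set], of l k] by auto
        have z: "v i * int_act ?S w (int_simple i) (Arm k 1) = 0" if i: "i \<in> ?S" for i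
        proof (cases "\<sigma> i = Arm k 1")
          case True
          have "\<sigma> (Arm l 1) = Arm k 1" "Arm l 1 \<in> ?S"
            using \<pi>(5) \<open>\<pi> l = k\<close> len by (auto simp: Arm_in_Y)
          then have "i = Arm l 1" using inj_onD[OF \<sigma>(2)] i True by metis
          then show ?thesis using ne by (simp add: v_def)
        next
          case False
          then show ?thesis using \<sigma>(3)[OF i] by (auto simp: int_simple_def)
        qed
        have "int_act ?S w v (Arm k 1) = (\<Sum>i\<in>?S. v i * int_act ?S w (int_simple i) (Arm k 1))"
          using int_act_expand[OF finite_Y out] by simp
        also have "\<dots> = 0" by (rule sum.neutral) (use z in blast)
        finally have "int_act ?S w v (Arm k 1) = 0" .
        moreover have "v (Arm k 1) = 1" using ne by (simp add: v_def)
        ultimately show False using int_act_mod[OF finite_Y w even, where x = "Arm k 1"] by simp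
      qed
      then have "\<pi> k = k"
        using mem[of k] \<pi>m ne inj_onD[OF \<pi>(1)[unfolded set], of k m] by auto
      moreover have "\<pi> l = l"
        using mem[of l] \<pi>m ne calculation inj_onD[OF \<pi>(1)[unfolded set], of l m]
            inj_onD[OF \<pi>(1)[unfolded set], of l k] by auto
      ultimately show ?thesis using that \<pi>m unfolding set by blast
    qed
  qed
  have "\<sigma> i = i" if i: "i \<in> ?S" for i
  proof (cases i)
    case (Arm h d)
    then have "h \<in> {0, 1, 2}" using i arm_len_pos_imp[of a b c h] by (simp add: Arm_in_Y)
    then show ?thesis using \<pi>(5)[of h d] \<pi>_id i Arm by simp
  qed (use \<pi>(4) in simp)
  then have "minus_one_word ?S w" using w \<sigma>(3) by (auto simp: minus_one_word_def)
  then show ?thesis using that by blast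
qed

section \<open>The action on the symmetric square\<close>

lemma carrier_weyl_group: "carrier (weyl_group S) = (\<lambda>u. weyl_cong S `` {u}) ` lists S"
  by (auto simp: weyl_group_def quotient_def)

lemma one_weyl_group: "\<one>\<^bsub>weyl_group S\<^esub> = weyl_cong S `` {[]}"
  by (simp add: weyl_group_def)

lemma class_eq_iff:
  assumes "u \<in> lists S" "v \<in> lists S"
  shows "weyl_cong S `` {u} = weyl_cong S `` {v} \<longleftrightarrow> (u, v) \<in> weyl_cong S"
  using eq_equiv_class_iff[OF equiv_weyl_cong assms] .

lemma refl_space_supported: "v \<in> refl_space S \<longleftrightarrow> supported S v"
  by (simp add: refl_space_def supported_def)

lemma of_int_vec_refl_space: "supported S v \<Longrightarrow> of_int_vec v \<in> refl_space S"
  by (simp add: refl_space_def supported_def of_int_vec_def)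

lemma bil_linear:
  "bil S z (\<lambda>x. p * v x + q * w x) = p * bil S z v + q * bil S z w"
  by (simp add: bil_def sum_distrib_left sum.distrib algebra_simps)

lemma word_act_Cons: "word_act S (i # u) v = reflection S i (word_act S u v)"
  by (simp add: word_act_def)

lemma word_act_linear:
  "word_act S u (\<lambda>x. p * v x + q * w x) = (\<lambda>x. p * word_act S u v x + q * word_act S u w x)"
proof (induction u)
  case (Cons i u)
  show ?case
    unfolding word_act_Cons Cons.IH
    by (rule ext) (simp add: reflection_apply bil_linear algebra_simps)
qed (simp add: word_act_def)

lemma word_act_sum:
  assumes "finite A"
  shows "word_act S u (\<lambda>x. \<Sum>i\<in>A. c i * f i x) = (\<lambda>x. \<Sum>i\<in>A. c i * word_act S u (f i) x)"
  using assms
proof (induction A rule: finite_induct)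
  case empty
  then show ?case using word_act_linear[of S u 0 "\<lambda>x. 0" 0 "\<lambda>x. 0"] by simp
next
  case (insert a A)
  then show ?case
    using word_act_linear[of S u "c a" "f a" 1 "\<lambda>x. \<Sum>i\<in>A. c i * f i x"] by simp
qed

lemma word_act_expand:
  assumes "finite S" "v \<in> refl_space S"
  shows "word_act S u v = (\<lambda>x. \<Sum>i\<in>S. v i * word_act S u (simple_root i) x)"
proof -
  have "v = (\<lambda>x. \<Sum>i\<in>S. v i * simple_root i x)"
  proof
    fix x
    have "(\<Sum>i\<in>S. v i * simple_root i x) = (\<Sum>i\<in>S. if i = x then v x else 0)"
      by (intro sum.cong) (auto simp: simple_root_def)
    then show "v x = (\<Sum>i\<in>S. v i * simple_root i x)"
      using assms by (simp add: refl_space_def)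
  qed
  then show ?thesis using word_act_sum[OF assms(1), of S u v simple_root] by simp
qed

lemma word_act_refl_space:
  assumes "u \<in> lists S" "v \<in> refl_space S"
  shows "word_act S u v \<in> refl_space S"
  using assms(1)
  by (induction u)
    (use assms(2) in \<open>auto simp: word_act_def refl_space_def reflection_apply simple_root_def\<close>)

lemma sum_fun_apply: "(\<Sum>i\<in>A. f i) x = (\<Sum>i\<in>A. f i x)"
  by (induction A rule: infinite_finite_induct) simp_all

lemma diag_act_apply:
  assumes "finite S" "u \<in> lists S"
  shows "diag_act S (weyl_cong S `` {u}) t (x, y) = (\<Sum>i\<in>S. \<Sum>j\<in>S.
    t (i, j) * (word_act S u (simple_root i) x * word_act S u (simple_root j) y))"
  using assms by (simp add: diag_act_def weyl_act_class sum_fun_apply fun_scale_def tensor_def)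

lemma diag_act_add: "diag_act S g (s + t) = diag_act S g s + diag_act S g t"
  by (simp add: diag_act_def fun_space.scale_left_distrib sum.distrib)

lemma diag_act_scale: "diag_act S g (fun_scale r t) = fun_scale r (diag_act S g t)"
  by (simp add: diag_act_def fun_space.scale_sum_right) (simp add: fun_scale_def mult.assoc)

lemma diag_act_zero: "diag_act S g 0 = 0"
  using diag_act_scale[of S g 0 0] by simp

lemma diag_act_vee:
  fixes v w :: "vertex \<Rightarrow> 'f::field_char_0"
  assumes "finite S" "u \<in> lists S" "v \<in> refl_space S" "w \<in> refl_space S"
  shows "diag_act S (weyl_cong S `` {u}) (vee v w) = vee (word_act S u v) (word_act S u w)"
proof
  fix z :: "vertex \<times> vertex"
  obtain x y where z: "z = (x, y)" by fastforce
  let ?m = "\<lambda>i x. word_act S u (simple_root i) x :: 'f"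
  have prod: "(\<Sum>i\<in>S. \<Sum>j\<in>S. (v i * w j) * (?m i x * ?m j y)) =
      word_act S u v x * word_act S u w y" if "v \<in> refl_space S" "w \<in> refl_space S" for v w
    unfolding word_act_expand[OF assms(1) that(1)] word_act_expand[OF assms(1) that(2)] sum_product
    by (simp add: mult_ac)
  have "diag_act S (weyl_cong S `` {u}) (vee v w) (x, y) =
      (\<Sum>i\<in>S. \<Sum>j\<in>S. (v i * w j) * (?m i x * ?m j y)) +
      (\<Sum>i\<in>S. \<Sum>j\<in>S. (w i * v j) * (?m i x * ?m j y))"
    unfolding diag_act_apply[OF assms(1,2)] vee_def tensor_def
    by (simp add: distrib_right sum.distrib)
  then show "diag_act S (weyl_cong S `` {u}) (vee v w) z =
      vee (word_act S u v) (word_act S u w) z"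
    using prod[OF assms(3,4)] prod[OF assms(4,3)] by (simp add: z vee_def tensor_def)
qed

lemma sym_square_induct [consumes 1, case_names zero add scale vee]:
  fixes t :: "vertex \<times> vertex \<Rightarrow> 'f::field_char_0"
  assumes "t \<in> sym_square S"
    and "P 0" "\<And>s t. P s \<Longrightarrow> P t \<Longrightarrow> P (s + t)" "\<And>r t. P t \<Longrightarrow> P (fun_scale r t)"
    and "\<And>v w. v \<in> refl_space S \<Longrightarrow> w \<in> refl_space S \<Longrightarrow> P (vee v w)"
  shows "P t"
proof -
  have "fun_space.subspace {t. P t}"
    using assms(2-4) by (simp add: fun_space.subspace_def)
  then show ?thesis
    using fun_space.span_induct[OF assms(1)[unfolded sym_square_def], of P] assms(5) by blast
qed

lemma diag_act_append:
  assumes "finite S" "u \<in> lists S" "v \<in> lists S" "t \<in> sym_square S"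
  shows "diag_act S (weyl_cong S `` {u @ v}) t =
    diag_act S (weyl_cong S `` {u}) (diag_act S (weyl_cong S `` {v}) t)"
  using assms(4)
proof (induction rule: sym_square_induct)
  case (vee x y)
  then show ?case
    using assms by (simp add: diag_act_vee word_act_refl_space word_act_append append_in_lists_conv)
qed (simp_all only: diag_act_zero diag_act_add diag_act_scale)

lemma diag_act_Nil:
  assumes "finite S" "t \<in> sym_square S"
  shows "diag_act S (weyl_cong S `` {[]}) t = t"
  using assms(2)
proof (induction rule: sym_square_induct)
  case (vee x y)
  then show ?case
    using assms by (simp add: diag_act_vee) (simp add: word_act_def)
qed (simp_all only: diag_act_zero diag_act_add diag_act_scale)

lemma diag_act_cancel:
  assumes "finite S" "u \<in> lists S" "t \<in> sym_square S"
  shows "diag_act S (weyl_cong S `` {rev u}) (diag_act S (weyl_cong S `` {u}) t) = t"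
proof -
  have r: "rev u \<in> lists S" using assms(2) by (simp add: in_lists_conv_set)
  have "weyl_cong S `` {rev u @ u} = weyl_cong S `` {[]}"
    using weyl_cong_rev_cancel[OF assms(2)] assms(2) r by (subst class_eq_iff) auto
  then show ?thesis
    using diag_act_append[OF assms(1) r assms(2,3)] diag_act_Nil[OF assms(1,3)] by simp
qed

lemma submodule_class:
  assumes "submodule S N" "u \<in> lists S" "t \<in> N"
  shows "diag_act S (weyl_cong S `` {u}) t \<in> N" "t \<in> sym_square S"
  using assms by (auto simp: submodule_def carrier_weyl_group)

lemma action_on_group_action:
  fixes N :: "(vertex \<times> vertex \<Rightarrow> 'f::field_char_0) set"
  assumes "finite S" "submodule S N"
  shows "group_action (weyl_group S) N (action_on S N)"
proof -
  have bij: "action_on S N g \<in> Bij N" if g: "g \<in> carrier (weyl_group S)" for g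
  proof -
    obtain u where u: "u \<in> lists S" "g = weyl_cong S `` {u}"
      using g by (auto simp: carrier_weyl_group)
    have r: "rev u \<in> lists S" using u(1) by (simp add: in_lists_conv_set)
    have "bij_betw (diag_act S g) N N"
      unfolding u(2)
    proof (rule bij_betw_byWitness[where f' = "diag_act S (weyl_cong S `` {rev u})"])
      show "\<forall>t\<in>N. diag_act S (weyl_cong S `` {rev u}) (diag_act S (weyl_cong S `` {u}) t) = t"
        using diag_act_cancel[OF assms(1) u(1)] submodule_class(2)[OF assms(2) u(1)] by blast
      show "\<forall>t\<in>N. diag_act S (weyl_cong S `` {u}) (diag_act S (weyl_cong S `` {rev u}) t) = t"
        using submodule_class(2)[OF assms(2) u(1)] diag_act_cancel[OF assms(1) r, unfolded rev_rev_ident]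
        by blast
    qed (use submodule_class(1)[OF assms(2)] u(1) r in blast)+
    then show ?thesis
      unfolding Bij_def action_on_def by (auto cong: bij_betw_cong)
  qed
  have mult: "action_on S N (g \<otimes>\<^bsub>weyl_group S\<^esub> h) = compose N (action_on S N g) (action_on S N h)"
    if gh: "g \<in> carrier (weyl_group S)" "h \<in> carrier (weyl_group S)" for g h
  proof -
    obtain u v where u: "u \<in> lists S" "g = weyl_cong S `` {u}"
      and v: "v \<in> lists S" "h = weyl_cong S `` {v}"
      using gh by (auto simp: carrier_weyl_group)
    show ?thesis
    proof
      fix t
      show "action_on S N (g \<otimes>\<^bsub>weyl_group S\<^esub> h) t = compose N (action_on S N g) (action_on S N h) t"
      proof (cases "t \<in> N")
        case True
        then show ?thesis
          using submodule_class[OF assms(2) v(1) True] diag_act_append[OF assms(1) u(1) v(1)]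
          unfolding u(2) v(2) weyl_mult_class[OF u(1) v(1)] action_on_def
          by (simp add: compose_def)
      qed (simp add: compose_def action_on_def)
    qed
  qed
  have "action_on S N \<in> hom (weyl_group S) (BijGroup N)"
    by (rule homI) (use bij mult in \<open>auto simp: BijGroup_def\<close>)
  then show ?thesis
    by (intro group_action.intro group_hom.intro group_weyl_group group_BijGroup)
      (simp add: group_hom_axioms_def)
qed

text \<open>The words that represent elements of the kernel of the action on \<open>N\<close>.\<close>

definition fixing_word ::
  "vertex set \<Rightarrow> (vertex \<times> vertex \<Rightarrow> 'f::field_char_0) set \<Rightarrow> vertex list \<Rightarrow> bool" where
  "fixing_word S N u \<longleftrightarrow> u \<in> lists S \<and> (\<forall>t\<in>N. diag_act S (weyl_cong S `` {u}) t = t)"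

lemma kernel_action_on:
  assumes "u \<in> lists S"
  shows "weyl_cong S `` {u} \<in> kernel (weyl_group S) (BijGroup N) (action_on S N) \<longleftrightarrow>
    fixing_word S N u"
  using assms unfolding kernel_def carrier_weyl_group fixing_word_def BijGroup_def action_on_def
  by (auto simp: fun_eq_iff restrict_def split: if_splits)

lemma fixing_word_conj:
  assumes "finite S" "submodule S N" "fixing_word S N u" "g \<in> lists S"
  shows "fixing_word S N (rev g @ u @ g)"
proof -
  have u: "u \<in> lists S" using assms(3) by (simp add: fixing_word_def)
  have r: "rev g \<in> lists S" using assms(4) by (simp add: in_lists_conv_set)
  have "diag_act S (weyl_cong S `` {rev g @ u @ g}) t = t" if t: "t \<in> N" for t
  proof -
    note s = submodule_class[OF assms(2) assms(4) t]
    have "diag_act S (weyl_cong S `` {rev g @ u @ g}) t =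
        diag_act S (weyl_cong S `` {rev g}) (diag_act S (weyl_cong S `` {u})
          (diag_act S (weyl_cong S `` {g}) t))"
      using s u r assms(1,4) by (simp add: diag_act_append)
    also have "\<dots> = t"
      using assms(3) s diag_act_cancel[OF assms(1,4)] by (simp add: fixing_word_def)
    finally show ?thesis .
  qed
  then show ?thesis using u r assms(4) by (simp add: fixing_word_def)
qed

section \<open>The centre\<close>

definition identity_word :: "vertex set \<Rightarrow> vertex list \<Rightarrow> bool" where
  "identity_word S u \<longleftrightarrow> u \<in> lists S \<and> (\<forall>s\<in>S. int_act S u (int_simple s) = int_simple s)"

lemma supported_simple: "s \<in> S \<Longrightarrow> supported S (int_simple s)"
  by (auto simp: supported_def int_simple_def)

lemma supported_act:
  "u \<in> lists S \<Longrightarrow> supported S v \<Longrightarrow> supported S (int_act S u v)"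
  by (simp add: supported_def int_act_outside)

lemma weyl_cong_if_act_eq:
  assumes "finite S" "u \<in> lists S" "v \<in> lists S"
    and "\<And>s. s \<in> S \<Longrightarrow> int_act S u (int_simple s) = int_act S v (int_simple s)"
  shows "(u, v) \<in> weyl_cong S"
proof -
  have r: "rev v \<in> lists S" using assms(3) by (simp add: in_lists_conv_set)
  have "(rev v @ u, []) \<in> weyl_cong S"
    using assms r int_act_cong[OF assms(1) weyl_cong_rev_cancel[OF assms(3)]]
    by (intro int_act_faithful) (simp_all add: int_act_append)
  then have "(v @ rev v @ u, v) \<in> weyl_cong S" using weyl_cong_left[OF _ assms(3)] by fastforce
  moreover have "(v @ rev v @ u, u) \<in> weyl_cong S"
    using weyl_cong_right[OF weyl_cong_rev_cancel[OF r] assms(2)] by simp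
  ultimately show ?thesis by (blast intro: weyl_cong.sym weyl_cong.trans)
qed

lemma Y_connected:
  assumes "P i" "i \<in> Y a b c"
    and step: "\<And>i j. i \<in> Y a b c \<Longrightarrow> j \<in> Y a b c \<Longrightarrow> adjacent i j \<Longrightarrow> P i \<Longrightarrow> P j"
    and "j \<in> Y a b c"
  shows "P j"
proof -
  have down: "P Branch" if "P (Arm h d)" "Arm h d \<in> Y a b c" for h d
    using that
  proof (induction d)
    case (Suc d)
    show ?case
    proof (cases "d = 0")
      case True
      then show ?thesis using step[OF Suc.prems(2) Branch_in_Y _ Suc.prems(1)] by simp
    next
      case False
      then have d: "Arm h d \<in> Y a b c" using Suc.prems(2) by (simp add: Arm_in_Y)
      then show ?thesis using step[OF Suc.prems(2) d _ Suc.prems(1)] Suc.IH by simp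
    qed
  qed (simp add: Arm_in_Y)
  have B: "P Branch" using down assms(1,2) by (cases i) auto
  have up: "P (Arm h d)" if "Arm h d \<in> Y a b c" for h d
    using that
  proof (induction d)
    case (Suc d)
    show ?case
    proof (cases "d = 0")
      case True
      then show ?thesis using step[OF Branch_in_Y Suc.prems _ B] by simp
    next
      case False
      then have d: "Arm h d \<in> Y a b c" using Suc.prems by (simp add: Arm_in_Y)
      then show ?thesis using step[OF d Suc.prems _ Suc.IH[OF d]] by simp
    qed
  qed (simp add: Arm_in_Y)
  show ?thesis using B up assms(4) by (cases j) auto
qed

text \<open>If \<open>u(\<alpha>\<^sub>i) = e\<^sub>i \<alpha>\<^sub>i\<close> for all \<open>i\<close>, invariance of \<open>B\<close> gives \<open>e\<^sub>i\<^sup>2 = 1\<close>, and \<open>e\<^sub>i e\<^sub>j = 1\<close> for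
  adjacent \<open>i\<close> and \<open>j\<close>; the diagram is connected.\<close>

lemma diagonal_imp_sign:
  assumes u: "u \<in> lists (Y a b c)"
    and diag: "\<And>i x. i \<in> Y a b c \<Longrightarrow> x \<noteq> i \<Longrightarrow> int_act (Y a b c) u (int_simple i) x = 0"
  shows "identity_word (Y a b c) u \<or> minus_one_word (Y a b c) u"
proof -
  let ?S = "Y a b c"
  define e where "e i = int_act ?S u (int_simple i) i" for i
  have act: "int_act ?S u (int_simple i) = (\<lambda>x. e i * int_simple i x)" if "i \<in> ?S" for i
    using diag[OF that] by (auto simp: e_def int_simple_def fun_eq_iff)
  have form: "e i * e j * cartan i j = cartan i j" if ij: "i \<in> ?S" "j \<in> ?S" for i j
  proof -
    have "cartan i j = int_form ?S (int_simple i) (int_simple j)"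
      using ij by (simp add: int_form_simple_left int_pairing_simple finite_Y)
    also have "\<dots> = int_form ?S (\<lambda>x. e i * int_simple i x) (\<lambda>x. e j * int_simple j x)"
      using int_form_act[OF finite_Y u] act ij by metis
    also have "\<dots> = e i * e j * int_form ?S (int_simple i) (int_simple j)"
      by (simp add: int_form_def int_pairing_def sum_distrib_left mult_ac)
    also have "int_form ?S (int_simple i) (int_simple j) = cartan i j"
      using ij by (simp add: int_form_simple_left int_pairing_simple finite_Y)
    finally show ?thesis by simp
  qed
  have "e Branch * e Branch = 1" using form[of Branch Branch] by simp
  then have B: "e Branch = 1 \<or> e Branch = -1" by (simp add: zmult_eq_1_iff)
  have const: "e j = e Branch" if "j \<in> ?S" for j
  proof (rule Y_connected[where P = "\<lambda>j. e j = e Branch" and i = Branch, OF HOL.refl Branch_in_Y _ that])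
    fix i j assume "i \<in> ?S" "j \<in> ?S" "adjacent i j" "e i = e Branch"
    then have "e Branch * e j = 1" using form[of i j] by (simp add: adjacent_iff_cartan)
    then show "e j = e Branch" using B by auto
  qed
  from B show ?thesis
  proof
    assume "e Branch = 1"
    then have "int_act ?S u (int_simple i) = int_simple i" if "i \<in> ?S" for i
      using act[OF that] const[OF that] by simp
    then show ?thesis using u by (simp add: identity_word_def)
  next
    assume "e Branch = -1"
    then have "int_act ?S u (int_simple i) = (\<lambda>x. - int_simple i x)" if "i \<in> ?S" for i
      using act[OF that] const[OF that] by simp
    then show ?thesis using u by (simp add: minus_one_word_def)
  qed
qed

text \<open>A central element commutes with \<open>s\<^sub>i\<close> and hence preserves the line of \<open>\<alpha>\<^sub>i\<close>, which is the
  eigenspace of \<open>s\<^sub>i\<close> for the eigenvalue \<open>-1\<close>. The converse needs that \<open>W\<close> acts faithfully.\<close>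

lemma centre_iff:
  assumes u: "u \<in> lists (Y a b c)"
  shows "weyl_cong (Y a b c) `` {u} \<in> centre (weyl_group (Y a b c)) \<longleftrightarrow>
    identity_word (Y a b c) u \<or> minus_one_word (Y a b c) u"
proof
  let ?S = "Y a b c"
  assume z: "weyl_cong ?S `` {u} \<in> centre (weyl_group ?S)"
  show "identity_word ?S u \<or> minus_one_word ?S u"
  proof (rule diagonal_imp_sign[OF u])
    fix i x assume i: "i \<in> ?S" "x \<noteq> i"
    have iS: "[i] \<in> lists ?S" using i by simp
    have "weyl_cong ?S `` {u @ [i]} = weyl_cong ?S `` {[i] @ u}"
      using z iS unfolding centre_def carrier_weyl_group
      using weyl_mult_class[OF u iS] weyl_mult_class[OF iS u] by auto
    then have "(u @ [i], [i] @ u) \<in> weyl_cong ?S"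
      using class_eq_iff[of "u @ [i]" ?S "[i] @ u"] u i by simp
    then have "int_act ?S (u @ [i]) (int_simple i) x = int_act ?S ([i] @ u) (int_simple i) x"
      using int_act_cong[OF finite_Y] by metis
    then show "int_act ?S u (int_simple i) x = 0"
      using i int_act_snoc_self[OF finite_Y i(1), of u]
      by (simp add: int_act_Cons int_refl_def int_simple_def)
  qed
next
  let ?S = "Y a b c"
  assume sign: "identity_word ?S u \<or> minus_one_word ?S u"
  have "weyl_cong ?S `` {u @ v} = weyl_cong ?S `` {v @ u}" if v: "v \<in> lists ?S" for v
  proof -
    have "(u @ v, v @ u) \<in> weyl_cong ?S"
    proof (rule weyl_cong_if_act_eq[OF finite_Y])
      fix s assume s: "s \<in> ?S"
      let ?y = "int_act ?S v (int_simple s)"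
      have y: "supported ?S ?y" using supported_act[OF v supported_simple[OF s]] .
      show "int_act ?S (u @ v) (int_simple s) = int_act ?S (v @ u) (int_simple s)"
        using sign
      proof
        assume id: "identity_word ?S u"
        have "int_act ?S u ?y = (\<lambda>x. \<Sum>i\<in>?S. ?y i * int_simple i x)"
          using int_act_expand[OF finite_Y y, of u] id by (simp add: identity_word_def)
        then show ?thesis
          using int_vec_expand[OF finite_Y y] id s by (simp add: int_act_append identity_word_def)
      next
        assume m: "minus_one_word ?S u"
        show ?thesis
          using minus_one_act[OF finite_Y m y] minus_one_act[OF finite_Y m supported_simple[OF s]]
            int_act_uminus[of ?S v "int_simple s"] by (simp add: int_act_append)
      qed
    qed (use u v in auto)
    then show ?thesis using class_eq_iff[of "u @ v" ?S "v @ u"] u v by simp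
  qed
  then show "weyl_cong ?S `` {u} \<in> centre (weyl_group ?S)"
    using u by (auto simp: centre_def carrier_weyl_group weyl_mult_class)
qed

section \<open>Words that fix an orthogonal pair of simple roots\<close>

lemma diag_act_vee_int:
  assumes "finite S" "u \<in> lists S" "supported S p" "supported S q"
  shows "diag_act S (weyl_cong S `` {u})
      (vee (of_int_vec p) (of_int_vec q) :: vertex \<times> vertex \<Rightarrow> 'f::field_char_0) =
    vee (of_int_vec (int_act S u p)) (of_int_vec (int_act S u q))"
  using assms by (simp add: diag_act_vee of_int_vec_refl_space word_act_of_int_vec)

lemma vee_of_int_vec_eqD:
  assumes "vee (of_int_vec p) (of_int_vec q) =
    (vee (of_int_vec p') (of_int_vec q') :: vertex \<times> vertex \<Rightarrow> 'f::field_char_0)"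
  shows "p x * q y + q x * p y = p' x * q' y + q' x * p' y"
proof -
  have "(of_int (p x * q y + q x * p y) :: 'f) = of_int (p' x * q' y + q' x * p' y)"
    using fun_cong[OF assms, of "(x, y)"] by (simp add: vee_def tensor_def of_int_vec_def)
  then show ?thesis by (simp only: of_int_eq_iff)
qed

text \<open>The tensor \<open>p \<or> q\<close> determines the unordered pair of lines of its factors. Here this is read
  off from coordinates.\<close>

lemma vee_simple_factor:
  assumes "i \<noteq> j"
    and eq: "\<And>x y. p x * q y + q x * p y =
      int_simple i x * int_simple j y + int_simple j x * int_simple i y"
  shows "(\<forall>x. x \<noteq> i \<longrightarrow> p x = 0) \<or> (\<forall>x. x \<noteq> j \<longrightarrow> p x = 0)"
proof -
  have sq: "p x * q x = 0" for x
    using eq[of x x] assms(1) by (auto simp: int_simple_def split: if_splits)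
  have one: "p i * q j + q i * p j = 1" using eq[of i j] assms(1) by (simp add: int_simple_def)
  have rest: "p x * q y + q x * p y = 0" if "y \<noteq> i" "y \<noteq> j" for x y
    using eq[of x y] that by (simp add: int_simple_def)
  show ?thesis
  proof (cases "p i = 0")
    case False
    then have "q i = 0" using sq[of i] by simp
    then have "q j \<noteq> 0" using one by auto
    then have "p x = 0" if "x \<noteq> i" for x
      using that sq[of j] rest[where x = i and y = x] rest[where x = j and y = x] eq[of x i] eq[of x j] one False \<open>q i = 0\<close>
      by (cases "x = j") auto
    then show ?thesis by blast
  next
    case True
    then have "q i \<noteq> 0" "p j \<noteq> 0" using one by auto
    then have "p x = 0" if "x \<noteq> j" for x
      using that rest[where x = i and y = x] True by (cases "x = i") auto
    then show ?thesis by blast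
  qed
qed

lemma fixing_word_pair:
  fixes N :: "(vertex \<times> vertex \<Rightarrow> 'f::field_char_0) set"
  assumes "finite S" "fixing_word S N u" "i \<in> S" "j \<in> S" "i \<noteq> j"
    and "vee (simple_root i) (simple_root j) \<in> N"
  shows "(\<forall>x. x \<noteq> i \<longrightarrow> int_act S u (int_simple i) x = 0) \<or>
    (\<forall>x. x \<noteq> j \<longrightarrow> int_act S u (int_simple i) x = 0)"
proof (rule vee_simple_factor[OF assms(5)])
  have u: "u \<in> lists S" using assms(2) by (simp add: fixing_word_def)
  have "vee (of_int_vec (int_act S u (int_simple i))) (of_int_vec (int_act S u (int_simple j))) =
      (vee (of_int_vec (int_simple i)) (of_int_vec (int_simple j)) :: vertex \<times> vertex \<Rightarrow> 'f)"
    using assms(2,6) diag_act_vee_int[OF assms(1) u supported_simple[OF assms(3)]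
        supported_simple[OF assms(4)], where 'f = 'f]
    by (simp add: fixing_word_def of_int_vec_simple)
  then show "int_act S u (int_simple i) x * int_act S u (int_simple j) y +
      int_act S u (int_simple j) x * int_act S u (int_simple i) y =
      int_simple i x * int_simple j y + int_simple j x * int_simple i y" for x y
    by (rule vee_of_int_vec_eqD)
qed

text \<open>Besides \<open>\<alpha>\<^sub>i \<or> \<alpha>\<^sub>j\<close> the module contains its image \<open>\<alpha>\<^sub>i \<or> (\<alpha>\<^sub>j + \<alpha>\<^sub>k)\<close> under \<open>s\<^sub>k\<close>. An element of
  the kernel permutes the two lines of each of these tensors, so it preserves the only common
  line, that of \<open>\<alpha>\<^sub>i\<close>. For the second tensor this is expressed by conjugating with \<open>s\<^sub>k\<close>.\<close>

lemma fixing_word_partner: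
  fixes N :: "(vertex \<times> vertex \<Rightarrow> 'f::field_char_0) set"
  assumes "finite S" "submodule S N" "i \<in> S" "j \<in> S" "k \<in> S" "i \<noteq> j" "i \<noteq> k"
    and "adjacent k j" "\<not> adjacent k i"
    and N: "vee (simple_root i) (simple_root j) \<in> N"
    and u: "fixing_word S N u" and "x \<noteq> i"
  shows "int_act S u (int_simple i) x = 0"
proof -
  have kj: "k \<noteq> j" using assms(8) by (cases j) auto
  have cart: "cartan k j = -1" "cartan k i = 0" "cartan k k = 2"
    using assms(7,8,9) kj by (auto simp: cartan_def)
  let ?u = "[k] @ u @ [k]"
  have "fixing_word S N ?u"
    using fixing_word_conj[OF assms(1,2) u, of "[k]"] assms(5) by simp
  from fixing_word_pair[OF assms(1) this assms(3,4,6) N]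
  have two: "(\<forall>x. x \<noteq> i \<longrightarrow> int_act S ?u (int_simple i) x = 0) \<or>
      (\<forall>x. x \<noteq> j \<longrightarrow> int_act S ?u (int_simple i) x = 0)" .
  from fixing_word_pair[OF assms(1) u assms(3,4,6) N] show ?thesis
  proof
    assume j: "\<forall>x. x \<noteq> j \<longrightarrow> int_act S u (int_simple i) x = 0"
    define e where "e = int_act S u (int_simple i) j"
    have "int_act S u (int_simple i) = (\<lambda>x. e * int_simple j x)"
      using j by (auto simp: e_def int_simple_def fun_eq_iff)
    moreover have "int_refl S k (int_simple i) = int_simple i"
      using assms(1,3) cart by (simp add: int_refl_simple)
    ultimately have "int_act S ?u (int_simple i) = (\<lambda>x. e * (int_simple j x + int_simple k x))"
      using int_act_scale[of S "[k]" e "int_simple j"] assms(1,4) cart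
      by (simp add: int_act_append int_act_Cons int_refl_simple)
    then have "e = 0"
      using two assms(6,7) kj by (auto simp: int_simple_def)
    then show ?thesis using j by (cases "x = j") (auto simp: e_def)
  qed (use assms(12) in auto)
qed

lemma int_act_adjacent:
  assumes "finite S" "i \<in> S" "j \<in> S" "adjacent i j"
  shows "int_act S [i, j] (int_simple i) = int_simple j"
proof -
  have cart: "cartan i j = -1" "cartan j i = -1"
    using assms(4) adjacent_iff_cartan cartan_sym by metis+
  have "int_refl S j (int_simple i) = (\<lambda>x. 1 * int_simple i x + 1 * int_simple j x)"
    using assms cart by (simp add: int_refl_simple)
  then have "int_act S [i, j] (int_simple i) =
      (\<lambda>x. 1 * int_refl S i (int_simple i) x + 1 * int_refl S i (int_simple j) x)"
    by (simp only: int_act_Cons int_act_Nil int_refl_linear)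
  then show ?thesis using assms cart by (simp add: int_refl_simple)
qed

text \<open>The kernel is normal and \<open>s\<^sub>i s\<^sub>j\<close> maps \<open>\<alpha>\<^sub>i\<close> to \<open>\<alpha>\<^sub>j\<close>, so the property of preserving the line of
  a simple root spreads along edges.\<close>

lemma fixing_word_adjacent:
  assumes "finite S" "submodule S N" "i \<in> S" "j \<in> S" "adjacent i j"
    and diag: "\<And>u x. fixing_word S N u \<Longrightarrow> x \<noteq> i \<Longrightarrow> int_act S u (int_simple i) x = 0"
    and u: "fixing_word S N u" and x: "x \<noteq> j"
  shows "int_act S u (int_simple j) x = 0"
proof -
  let ?g = "[i, j]" and ?u = "[j, i] @ u @ [i, j]"
  have g: "?g \<in> lists S" "rev ?g \<in> lists S" using assms(3,4) by auto
  have fixu: "fixing_word S N ?u" using fixing_word_conj[OF assms(1,2) u g(1)] by simp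
  define e where "e = int_act S ?u (int_simple i) i"
  have u_act: "int_act S ?u (int_simple i) = (\<lambda>x. e * int_simple i x)"
    using diag[OF fixu] by (auto simp: e_def int_simple_def fun_eq_iff)
  have inv: "int_act S ?g (int_act S (rev ?g) y) = y" for y
    using int_act_cong[OF assms(1) weyl_cong_rev_cancel[OF g(2)], of y]
    by (simp add: int_act_append[symmetric])
  have "int_act S u (int_simple j) = int_act S ?g (int_act S (rev ?g) (int_act S u (int_simple j)))"
    using inv by simp
  also have "\<dots> = int_act S ?g (int_act S ?u (int_simple i))"
    unfolding int_act_append int_act_adjacent[OF assms(1,3,4,5)] by simp
  also have "\<dots> = (\<lambda>x. e * int_simple j x)"
    unfolding u_act int_act_scale int_act_adjacent[OF assms(1,3,4,5)] ..
  finally show ?thesis using x by (simp add: int_simple_def)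
qed

lemma fixing_word_imp_sign:
  assumes "submodule (Y a b c) N" "i \<in> Y a b c" "fixing_word (Y a b c) N u"
    and "\<And>u x. fixing_word (Y a b c) N u \<Longrightarrow> x \<noteq> i \<Longrightarrow> int_act (Y a b c) u (int_simple i) x = 0"
  shows "identity_word (Y a b c) u \<or> minus_one_word (Y a b c) u"
proof (rule diagonal_imp_sign)
  let ?S = "Y a b c"
  show "u \<in> lists ?S" using assms(3) by (simp add: fixing_word_def)
  fix j x assume j: "j \<in> ?S" "x \<noteq> j"
  have "\<forall>u x. fixing_word ?S N u \<longrightarrow> x \<noteq> j \<longrightarrow> int_act ?S u (int_simple j) x = 0"
  proof (rule Y_connected[OF _ assms(2) _ j(1)])
    show "\<forall>u x. fixing_word ?S N u \<longrightarrow> x \<noteq> i \<longrightarrow> int_act ?S u (int_simple i) x = 0"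
      using assms(4) by blast
  next
    fix h j assume "h \<in> ?S" "j \<in> ?S" "adjacent h j"
      "\<forall>u x. fixing_word ?S N u \<longrightarrow> x \<noteq> h \<longrightarrow> int_act ?S u (int_simple h) x = 0"
    then show "\<forall>u x. fixing_word ?S N u \<longrightarrow> x \<noteq> j \<longrightarrow> int_act ?S u (int_simple j) x = 0"
      using fixing_word_adjacent[OF finite_Y assms(1)] by metis
  qed
  then show "int_act ?S u (int_simple j) x = 0" using assms(3) j(2) by blast
qed

section \<open>Every orbit contains an orthogonal pair of simple roots\<close>

lemma adjacent_common:
  assumes "adjacent h i" "adjacent i j" "h \<noteq> j"
  shows "cartan h j = 0"
  using assms by (cases h; cases i; cases j) (auto simp: cartan_def)

lemma path_reduction:
  assumes "finite S" "h \<in> S" "i \<in> S" "j \<in> S" "adjacent h i" "adjacent i j" "h \<noteq> j"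
  shows "int_act S [i, h] (int_simple i) = int_simple h"
    and "int_act S [i, h] (\<lambda>x. int_simple h x + int_simple i x + int_simple j x) = int_simple j"
proof -
  show "int_act S [i, h] (int_simple i) = int_simple h"
    using int_act_adjacent[OF assms(1,3,2)] assms(5) adjacent_sym by blast
  have cart: "cartan h i = -1" "cartan i h = -1" "cartan i j = -1" "cartan h j = 0"
    using assms(5,6) adjacent_common[OF assms(5-7)] adjacent_iff_cartan cartan_sym by metis+
  have "int_pairing S h (\<lambda>x. int_simple h x + int_simple i x + int_simple j x) = 1"
    using int_pairing_linear[of S h 1 "\<lambda>x. int_simple h x + int_simple i x" 1 "int_simple j"]
      int_pairing_linear[of S h 1 "int_simple h" 1 "int_simple i"] assms cart
    by (simp add: int_pairing_simple)
  then have 1: "int_refl S h (\<lambda>x. int_simple h x + int_simple i x + int_simple j x) =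
      (\<lambda>x. int_simple i x + int_simple j x)"
    by (simp add: int_refl_def)
  have "int_pairing S i (\<lambda>x. int_simple i x + int_simple j x) = 1"
    using int_pairing_linear[of S i 1 "int_simple i" 1 "int_simple j"] assms cart
    by (simp add: int_pairing_simple)
  then have "int_refl S i (\<lambda>x. int_simple i x + int_simple j x) = int_simple j"
    by (simp add: int_refl_def)
  with 1 show "int_act S [i, h] (\<lambda>x. int_simple h x + int_simple i x + int_simple j x) =
      int_simple j"
    by (simp add: int_act_Cons)
qed

text \<open>The highest root \<open>\<theta>\<^sub>i\<close> for \<open>i = Arm k d\<close>, with explicit coefficients.\<close>

definition int_theta :: "nat \<Rightarrow> nat \<Rightarrow> vertex \<Rightarrow> int" where
  "int_theta k d x = (case x of Branch \<Rightarrow> 2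
    | Arm h e \<Rightarrow> if h = k \<and> 1 \<le> e \<and> e < d then 2
        else if (h = k \<and> e = d) \<or> (h \<in> {0, 1, 2} \<and> h \<noteq> k \<and> e = 1) then 1 else 0)"

lemma theta_eq_int_theta:
  assumes pos: "1 \<le> a" "1 \<le> b" "1 \<le> c" and k: "Arm k d \<in> Y a b c"
  shows "theta (Y a b c) (Arm k d) = (of_int_vec (int_theta k d) :: vertex \<Rightarrow> 'f::field_char_0)"
proof
  fix j
  let ?D = "D_vertices (Y a b c) (Arm k d)"
  have d: "1 \<le> d" and k3: "k \<in> {0, 1, 2}"
    using k arm_len_pos_imp[of a b c k] by (auto simp: Arm_in_Y)
  have first: "Arm h e \<in> Y a b c \<and> e = 1 \<longleftrightarrow> h \<in> {0, 1, 2} \<and> e = 1" for h e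
    using pos by (auto simp: Arm_in_Y arm_len_def)
  have D: "Branch \<in> ?D"
    "Arm h e \<in> ?D \<longleftrightarrow> (h = k \<and> 1 \<le> e \<and> e \<le> d) \<or> (h \<in> {0, 1, 2} \<and> e = 1)" for h e
    using first[of h e] by (auto simp: D_vertices_def)
  show "theta (Y a b c) (Arm k d) j = (of_int_vec (int_theta k d) j :: 'f)"
  proof (cases j)
    case Branch
    have "{h \<in> ?D. adjacent h Branch} = {Arm 0 1, Arm 1 1, Arm 2 1}"
    proof (rule Set.set_eqI)
      fix h show "h \<in> {h \<in> ?D. adjacent h Branch} \<longleftrightarrow> h \<in> {Arm 0 1, Arm 1 1, Arm 2 1}"
        using k3 d by (cases h) (auto simp: D)
    qed
    then have "card {h \<in> ?D. adjacent h Branch} = 3" by simp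
    then show ?thesis using D(1) by (simp add: Branch theta_def of_int_vec_def int_theta_def)
  next
    case (Arm h e)
    consider (out) "Arm h e \<notin> ?D" | (mid) "h = k" "1 \<le> e" "e < d" | (last) "h = k" "e = d"
      | (side) "h \<noteq> k" "h \<in> {0, 1, 2}" "e = 1"
      using D(2)[of h e] k3 d by fastforce
    then show ?thesis
    proof cases
      case out
      then show ?thesis
        using d k3 D(2)[of h e] by (auto simp: Arm theta_def of_int_vec_def int_theta_def)
    next
      case mid
      have "{x \<in> ?D. adjacent x j} = {along k (e - 1), Arm k (Suc e)}"
      proof (rule Set.set_eqI)
        fix x show "x \<in> {x \<in> ?D. adjacent x j} \<longleftrightarrow> x \<in> {along k (e - 1), Arm k (Suc e)}"
          unfolding Arm using mid d D(1) by (cases x) (auto simp: D(2) along_def)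
      qed
      moreover have "along k (e - 1) \<noteq> Arm k (Suc e)" by (auto simp: along_def)
      ultimately have "card {x \<in> ?D. adjacent x j} = 2" by simp
      then show ?thesis
        using mid D(2)[of h e] by (simp add: Arm theta_def of_int_vec_def int_theta_def)
    next
      case last
      have "{x \<in> ?D. adjacent x j} = {along k (d - 1)}"
      proof (rule Set.set_eqI)
        fix x show "x \<in> {x \<in> ?D. adjacent x j} \<longleftrightarrow> x \<in> {along k (d - 1)}"
          unfolding Arm using last d D(1) k3 by (cases x) (auto simp: D(2) along_def)
      qed
      then have "card {x \<in> ?D. adjacent x j} = 1" by simp
      then show ?thesis
        using last d D(2)[of h e] by (simp add: Arm theta_def of_int_vec_def int_theta_def)
    next
      case side
      have "{x \<in> ?D. adjacent x j} = {Branch}"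
      proof (rule Set.set_eqI)
        fix x show "x \<in> {x \<in> ?D. adjacent x j} \<longleftrightarrow> x \<in> {Branch}"
          unfolding Arm using side d D(1) by (cases x) (auto simp: D(2))
      qed
      then have "card {x \<in> ?D. adjacent x j} = 1" by simp
      then show ?thesis
        using side d D(2)[of h e] by (simp add: Arm theta_def of_int_vec_def int_theta_def)
    qed
  qed
qed

lemma supported_int_theta:
  assumes "1 \<le> a" "1 \<le> b" "1 \<le> c" "Arm k d \<in> Y a b c"
  shows "supported (Y a b c) (int_theta k d)"
proof (rule supportedI)
  fix x assume x: "x \<notin> Y a b c"
  have first: "Arm h 1 \<in> Y a b c" if "h \<in> {0, 1, 2}" for h
    using that assms by (auto simp: Arm_in_Y arm_len_def)
  show "int_theta k d x = 0"
  proof (cases x)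
    case (Arm h e)
    have "\<not> (h \<in> {0, 1, 2} \<and> e = 1)" using first[of h] x Arm by metis
    moreover have "\<not> (h = k \<and> 1 \<le> e \<and> e \<le> d)"
      using assms(4) x Arm by (auto simp: Arm_in_Y)
    moreover have "1 \<le> d" using assms(4) by (simp add: Arm_in_Y)
    ultimately show ?thesis unfolding Arm int_theta_def vertex.case by (metis le_refl less_imp_le)
  qed (use x in simp)
qed

lemma arms_perm_exists:
  assumes "k \<in> {0, 1, 2}"
  obtains l m where "arms_perm k l m"
proof -
  have "arms_perm 0 1 2" "arms_perm 1 0 2" "arms_perm 2 0 1"
    by (auto simp: arms_perm_def)
  then show ?thesis using assms that by auto
qed

text \<open>Everything happens in the subsystem \<open>D\<^sub>4\<close> around the branch vertex, where \<open>V p q r s\<close> is the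
  vector with the given coefficients at \<open>Arm k 1\<close>, \<open>Branch\<close>, \<open>Arm l 1\<close> and \<open>Arm m 1\<close>.\<close>

lemma theta_reduction_base:
  assumes pos: "1 \<le> a" "1 \<le> b" "1 \<le> c" and klm: "arms_perm k l m"
  defines "w \<equiv> [Branch, Arm k 1, Arm l 1, Branch]"
  shows "int_act (Y a b c) w (int_simple (Arm k 1)) = int_simple (Arm l 1)"
    and "int_act (Y a b c) w (int_theta k 1) = int_simple (Arm m 1)"
proof -
  let ?S = "Y a b c"
  have ne: "k \<noteq> l" "k \<noteq> m" "l \<noteq> m" using klm by (auto simp: arms_perm_def)
  have mem3: "k \<in> {0, 1, 2}" "l \<in> {0, 1, 2}" "m \<in> {0, 1, 2}"
    using klm unfolding arms_perm_def by (metis insertCI)+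
  have mem: "Arm h 1 \<in> ?S" if "h \<in> {0, 1, 2}" for h
    using that pos by (auto simp: Arm_in_Y arm_len_def)
  define V where "V p q r s = (\<lambda>x. p * int_simple (Arm k 1) x + q * int_simple Branch x +
    r * int_simple (Arm l 1) x + s * int_simple (Arm m 1) x)" for p q r s
  have V_pairing: "int_pairing ?S j (V p q r s) = p * cartan j (Arm k 1) + q * cartan j Branch +
      r * cartan j (Arm l 1) + s * cartan j (Arm m 1)" for j p q r s
  proof -
    have "int_pairing ?S j (V p q r s) = p * int_pairing ?S j (int_simple (Arm k 1)) +
        q * int_pairing ?S j (int_simple Branch) + r * int_pairing ?S j (int_simple (Arm l 1)) +
        s * int_pairing ?S j (int_simple (Arm m 1))"
      by (simp add: V_def int_pairing_def distrib_left sum.distrib sum_distrib_left mult.left_commute)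
    then show ?thesis using mem mem3 by (simp add: int_pairing_simple finite_Y)
  qed
  have V_refl:
    "int_refl ?S Branch (V p q r s) = V p (p + r + s - q) r s"
    "int_refl ?S (Arm k 1) (V p q r s) = V (q - p) q r s"
    "int_refl ?S (Arm l 1) (V p q r s) = V p q (q - r) s" for p q r s
    unfolding int_refl_def V_pairing using ne
    by (auto simp: V_def cartan_def algebra_simps fun_eq_iff)
  have "int_simple (Arm k 1) = V 1 0 0 0" "int_simple (Arm l 1) = V 0 0 1 0"
    "int_simple (Arm m 1) = V 0 0 0 1"
    by (simp_all add: V_def)
  moreover have "int_theta k 1 = V 1 2 1 1"
  proof
    fix x show "int_theta k 1 x = V 1 2 1 1 x"
      using ne mem3 arms_perm_cases[OF klm]
      by (cases x) (auto simp: V_def int_theta_def int_simple_def)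
  qed
  ultimately show "int_act ?S w (int_simple (Arm k 1)) = int_simple (Arm l 1)"
    "int_act ?S w (int_theta k 1) = int_simple (Arm m 1)"
    by (simp_all only: w_def int_act_Cons int_act_Nil V_refl) simp_all
qed

text \<open>In the coordinates with \<open>\<alpha>\<^sub>i = \<epsilon>\<^sub>1 - \<epsilon>\<^sub>2\<close> and \<open>\<theta>\<^sub>i = \<epsilon>\<^sub>1 + \<epsilon>\<^sub>2\<close>, where \<open>i\<close> is the outer of the two
  vertices, the word is the cycle that replaces \<open>\<epsilon>\<^sub>1\<close> and \<open>\<epsilon>\<^sub>2\<close> by \<open>\<epsilon>\<^sub>2\<close> and \<open>\<epsilon>\<^sub>3\<close>.\<close>

lemma theta_reduction_step:
  assumes pos: "1 \<le> a" "1 \<le> b" "1 \<le> c" and S: "Arm k (Suc d) \<in> Y a b c" and d: "1 \<le> d"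
  defines "w \<equiv> [Arm k (Suc d), Arm k d]"
  shows "int_act (Y a b c) w (int_simple (Arm k (Suc d))) = int_simple (Arm k d)"
    and "int_act (Y a b c) w (int_theta k (Suc d)) = int_theta k d"
proof -
  let ?S = "Y a b c"
  have dS: "Arm k d \<in> ?S" using S d by (simp add: Arm_in_Y)
  show "int_act ?S w (int_simple (Arm k (Suc d))) = int_simple (Arm k d)"
    unfolding w_def using int_act_adjacent[OF finite_Y S dS] by simp
  let ?t = "int_theta k (Suc d)"
  have sup: "supported ?S ?t" using supported_int_theta[OF pos S] .
  have t: "?t (along k e) = 2" if "e \<le> d" for e
    using that by (simp add: along_def int_theta_def)
  have p1: "int_pairing ?S (Arm k d) ?t = 1"
    using int_pairing_Arm[OF sup d, of k] t[of "d - 1"] t[of d] d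
    by (simp add: along_def[of k d]) (simp add: int_theta_def)
  then have r1: "int_refl ?S (Arm k d) ?t = (\<lambda>x. 1 * ?t x + -1 * int_simple (Arm k d) x)"
    by (simp add: int_refl_def)
  have "int_pairing ?S (Arm k (Suc d)) ?t = 0"
    using int_pairing_Arm[OF sup, of "Suc d" k] t[of d] by simp (simp add: int_theta_def)
  moreover have "int_pairing ?S (Arm k (Suc d)) (int_simple (Arm k d)) = -1"
    using dS by (simp add: int_pairing_simple finite_Y cartan_def)
  ultimately have "int_refl ?S (Arm k (Suc d)) (int_refl ?S (Arm k d) ?t) =
      (\<lambda>x. ?t x - int_simple (Arm k d) x - int_simple (Arm k (Suc d)) x)"
    unfolding r1 int_refl_def[of ?S "Arm k (Suc d)"] int_pairing_linear by simp
  also have "\<dots> = int_theta k d"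
  proof
    fix x show "?t x - int_simple (Arm k d) x - int_simple (Arm k (Suc d)) x = int_theta k d x"
      using d by (cases x) (auto simp: int_theta_def int_simple_def)
  qed
  finally show "int_act ?S w ?t = int_theta k d"
    by (simp add: w_def int_act_Cons)
qed

lemma theta_reduction:
  assumes pos: "1 \<le> a" "1 \<le> b" "1 \<le> c" and klm: "arms_perm k l m" and "Arm k d \<in> Y a b c"
  shows "\<exists>w\<in>lists (Y a b c). int_act (Y a b c) w (int_simple (Arm k d)) = int_simple (Arm l 1) \<and>
    int_act (Y a b c) w (int_theta k d) = int_simple (Arm m 1)"
  using assms(5)
proof (induction d)
  case (Suc d)
  have mem3: "k \<in> {0, 1, 2}" "l \<in> {0, 1, 2}"
    using klm unfolding arms_perm_def by (metis insertCI)+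
  have mem: "Arm h 1 \<in> Y a b c" if "h \<in> {0, 1, 2}" for h
    using that pos by (auto simp: Arm_in_Y arm_len_def)
  show ?case
  proof (cases "d = 0")
    case True
    then show ?thesis
      using theta_reduction_base[OF pos klm] mem mem3
      by (intro bexI[of _ "[Branch, Arm k 1, Arm l 1, Branch]"]) auto
  next
    case False
    then have d: "1 \<le> d" "Arm k d \<in> Y a b c" using Suc.prems by (auto simp: Arm_in_Y)
    obtain w where w: "w \<in> lists (Y a b c)"
      "int_act (Y a b c) w (int_simple (Arm k d)) = int_simple (Arm l 1)"
      "int_act (Y a b c) w (int_theta k d) = int_simple (Arm m 1)"
      using Suc.IH[OF d(2)] by blast
    show ?thesis
      using theta_reduction_step[OF pos Suc.prems d(1)] w Suc.prems d
      by (intro bexI[of _ "w @ [Arm k (Suc d), Arm k d]"]) (simp_all add: int_act_append)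
  qed
qed (simp add: Arm_in_Y)

text \<open>It suffices to study orthogonal pairs of simple roots: for a path \<open>h\<close>--\<open>i\<close>--\<open>j\<close> the product
  \<open>s\<^sub>i s\<^sub>h\<close> turns \<open>\<alpha>\<^sub>i \<or> (\<alpha>\<^sub>h + \<alpha>\<^sub>i + \<alpha>\<^sub>j)\<close> into \<open>\<alpha>\<^sub>h \<or> \<alpha>\<^sub>j\<close>, and \<open>\<alpha>\<^sub>i \<or> \<theta>\<^sub>i\<close> is moved towards the branch
  vertex until it becomes the pair of the first vertices of the other two arms.\<close>

lemma elementary_reduction:
  fixes \<beta> :: "vertex \<Rightarrow> 'f::field_char_0"
  assumes pos: "1 \<le> a" "1 \<le> b" "1 \<le> c" and i: "i \<in> Y a b c" "elementary (Y a b c) i \<beta>"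
  obtains w x y where "w \<in> lists (Y a b c)" "x \<in> Y a b c" "y \<in> Y a b c" "x \<noteq> y" "cartan x y = 0"
    "diag_act (Y a b c) (weyl_cong (Y a b c) `` {w}) (vee (simple_root i) \<beta>) =
      vee (simple_root x) (simple_root y)"
proof -
  let ?S = "Y a b c"
  note found = that
  have reduce: thesis
    if w: "w \<in> lists ?S" "x \<in> ?S" "y \<in> ?S" "x \<noteq> y" "cartan x y = 0"
      and q: "\<beta> = of_int_vec q" "supported ?S q"
      and act: "int_act ?S w (int_simple i) = int_simple x" "int_act ?S w q = int_simple y"
    for w x y q
  proof (rule found[OF w])
    show "diag_act ?S (weyl_cong ?S `` {w}) (vee (simple_root i) \<beta>) =
        vee (simple_root x) (simple_root y)"
      using diag_act_vee_int[OF finite_Y w(1) supported_simple[OF i(1)] q(2), where 'f = 'f]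
      by (simp only: q(1) act of_int_vec_simple)
  qed
  consider (1) j where "j \<in> ?S" "cartan i j = 0" "\<beta> = simple_root j"
    | (2) h j where "h \<in> ?S" "j \<in> ?S" "h \<noteq> j" "adjacent h i" "adjacent i j"
        "\<beta> = simple_root h + simple_root i + simple_root j"
    | (3) k d where "i = Arm k d" "\<beta> = theta ?S i"
    using i(2) unfolding elementary_def by (cases i) blast+
  then show thesis
  proof cases
    case 1
    then have "i \<noteq> j" by auto
    then show thesis
      using 1 i(1) by (intro reduce[of "[]" i j "int_simple j"])
        (auto simp: of_int_vec_simple supported_simple)
  next
    case 2
    show thesis
    proof (rule reduce[of "[i, h]" h j "\<lambda>x. int_simple h x + int_simple i x + int_simple j x"])
      show "\<beta> = of_int_vec (\<lambda>x. int_simple h x + int_simple i x + int_simple j x)"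
        unfolding 2(6) of_int_vec_simple[symmetric] by (auto simp: of_int_vec_def fun_eq_iff)
      show "supported ?S (\<lambda>x. int_simple h x + int_simple i x + int_simple j x)"
        using 2(1,2) i(1) by (auto simp: supported_def int_simple_def)
    qed (use 2 i(1) path_reduction[OF finite_Y 2(1) i(1) 2(2,4,5,3)] adjacent_common[OF 2(4,5,3)]
        in auto)
  next
    case 3
    have iS: "Arm k d \<in> ?S" using i(1) 3(1) by simp
    then have "k \<in> {0, 1, 2}" using arm_len_pos_imp[of a b c k] by (simp add: Arm_in_Y)
    then obtain l m where klm: "arms_perm k l m" by (rule arms_perm_exists)
    obtain w where w: "w \<in> lists ?S" "int_act ?S w (int_simple (Arm k d)) = int_simple (Arm l 1)"
      "int_act ?S w (int_theta k d) = int_simple (Arm m 1)"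
      using theta_reduction[OF pos klm iS] by blast
    have mem3: "l \<in> {0, 1, 2}" "m \<in> {0, 1, 2}" "l \<noteq> m"
      using klm unfolding arms_perm_def by (metis insertCI distinct_length_2_or_more)+
    have mem: "Arm h 1 \<in> ?S" if "h \<in> {0, 1, 2}" for h
      using that pos by (auto simp: Arm_in_Y arm_len_def)
    show thesis
      by (rule reduce[OF w(1) mem[OF mem3(1)] mem[OF mem3(2)] _ _ _ supported_int_theta[OF pos iS]])
        (use w mem3(3) 3 theta_eq_int_theta[OF pos iS] in \<open>auto simp: cartan_def\<close>)
  qed
qed

section \<open>The orthonormal coordinates in type D\<close>

lemma arms_perm_enum:
  assumes "arms_perm k l m"
  shows "(k, l, m) \<in> {(0, 1, 2), (0, 2, 1), (1, 0, 2), (1, 2, 0), (2, 0, 1), (2, 1, 0)}"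
proof -
  have "k \<in> {0, 1, 2}" "l \<in> {0, 1, 2}" "m \<in> {0, 1, 2}" "k \<noteq> l" "k \<noteq> m" "l \<noteq> m"
    using assms unfolding arms_perm_def by (metis insertCI distinct_length_2_or_more)+
  then show ?thesis by auto
qed

lemma arms_multiset:
  assumes "arms_perm k l m"
  shows "{#a, b, c#} = {#arm_len a b c k, arm_len a b c l, arm_len a b c m#}"
  using arms_perm_enum[OF assms] by (auto simp: arm_len_def)

definition swap_below :: "nat \<Rightarrow> nat \<Rightarrow> nat" where
  "swap_below r p = (if p = r then r - 1 else if p = r - 1 then r else p)"

lemma swap_below_inject: "swap_below r p = swap_below r q \<longleftrightarrow> p = q"
  by (auto simp: swap_below_def split: if_splits)

lemma swap_below_le: "r \<le> M \<Longrightarrow> p \<le> M \<Longrightarrow> swap_below r p \<le> M"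
  by (auto simp: swap_below_def)

text \<open>The adjacent transpositions take the pair \<open>(1, 0)\<close> to every pair \<open>(p, q)\<close> with \<open>q < p\<close>
  without ever reversing the order: first raise the larger entry, then the smaller one.\<close>

lemma ordered_pair_induct:
  assumes start: "P 1 0"
    and swap: "\<And>r p q. 1 \<le> r \<Longrightarrow> r \<le> M \<Longrightarrow> p \<le> M \<Longrightarrow> q \<le> M \<Longrightarrow> P p q \<Longrightarrow>
      P (swap_below r p) (swap_below r q)"
    and "q < p" "p \<le> (M :: nat)"
  shows "P p q"
proof -
  have "P p 0" if "1 \<le> p" "p \<le> M" for p
    using that
  proof (induction p rule: dec_induct)
    case base
    then show ?case using start by simp
  next
    case (step p)
    then show ?case using swap[of "Suc p" p 0] by (simp add: swap_below_def)
  qed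
  then have p0: "P p 0" using assms(3,4) by simp
  show ?thesis using assms(3)
  proof (induction q)
    case 0
    then show ?case using p0 by simp
  next
    case (Suc q)
    then show ?case using swap[of "Suc q" p q] assms(4) by (simp add: swap_below_def)
  qed
qed

lemma minus_one_not_Nats: "(-1 :: 'f::field_char_0) \<notin> \<nat>"
proof
  assume "(-1 :: 'f) \<in> \<nat>"
  then obtain n where "(-1 :: 'f) = of_nat n" by (auto elim: Nats_cases)
  then have "of_nat (Suc n) = (0 :: 'f)" by (simp flip: \<open>- 1 = of_nat n\<close>)
  then show False by (simp only: of_nat_eq_0_iff)
qed

lemma vee_diff_sum: "vee (x - y) (x + y) = vee x x - vee y y"
  by (rule ext) (auto simp: vee_def tensor_def algebra_simps)

lemma vee_commute: "vee x y = vee y x"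
  by (simp add: vee_def add.commute)

lemma bil_Branch:
  fixes v :: "vertex \<Rightarrow> 'f::field_char_0"
  assumes "arms_perm k l m" "v \<in> refl_space (Y a b c)"
  shows "bil (Y a b c) (simple_root Branch) v =
    2 * v Branch - (v (Arm k 1) + v (Arm l 1) + v (Arm m 1))"
  using cartan_sum_Branch[of a b c v] assms(2)
  by (simp only: bil_simple_left[OF finite_Y Branch_in_Y] refl_space_supported
      arms_perm_sum[OF assms(1)])

lemma bil_Arm:
  fixes v :: "vertex \<Rightarrow> 'f::field_char_0"
  assumes "Arm h d \<in> Y a b c" "v \<in> refl_space (Y a b c)"
  shows "bil (Y a b c) (simple_root (Arm h d)) v =
    2 * v (Arm h d) - v (along h (d - 1)) - v (Arm h (Suc d))"
  using cartan_sum_Arm[of a b c v d h] assms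
  by (simp only: bil_simple_left[OF finite_Y assms(1)] refl_space_supported Arm_in_Y)

text \<open>The diagram \<open>D\<^sub>n\<close> with \<open>n = L + 3\<close>: the arms \<open>k\<close> and \<open>l\<close> are short, and the arm \<open>m\<close> may be
  long.\<close>

locale type_D_diagram =
  fixes a b c k l m L :: nat
  assumes klm: "arms_perm k l m"
    and len: "arm_len a b c k = 1" "arm_len a b c l = 1" "arm_len a b c m = L"
    and L: "1 \<le> L"
begin

abbreviation S :: "vertex set" where "S \<equiv> Y a b c"

abbreviation M :: nat where "M \<equiv> L + 2"

definition node :: "nat \<Rightarrow> vertex" where
  "node p = (if p = 0 then Arm l 1 else if p = 1 then Arm k 1 else along m (p - 2))"

text \<open>The vectors \<open>eps p\<close> for \<open>p < n\<close> are \<open>\<epsilon>\<^sub>n, \<dots>, \<epsilon>\<^sub>1\<close> in this order, so that for \<open>p \<ge> 1\<close> the simple root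
  at \<open>node p\<close> is \<open>eps p - eps (p - 1)\<close>, whatever the length of the long arm; the remaining one,
  at \<open>node 0\<close>, is \<open>eps 1 + eps 0\<close>.\<close>

definition eps :: "nat \<Rightarrow> vertex \<Rightarrow> 'f::field_char_0" where
  "eps p x = (if x = Arm l 1 then 1 / 2 else if x = Arm k 1 then (if p = 0 then - (1 / 2) else 1 / 2)
    else if \<exists>r. 2 \<le> r \<and> r \<le> p \<and> x = node r then 1 else 0)"

lemma ne: "k \<noteq> l" "k \<noteq> m" "l \<noteq> m"
  using klm by (auto simp: arms_perm_def)

lemma node_0: "node 0 = Arm l 1" and node_1: "node 1 = Arm k 1"
  by (simp_all add: node_def)

lemma node_in_S: "p \<le> M \<Longrightarrow> node p \<in> S"
  using len by (auto simp: node_def along_def Arm_in_Y)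

lemma node_inject: "node p = node q \<longleftrightarrow> p = q"
  using ne by (auto simp: node_def along_def split: if_splits)

lemma S_eq_nodes: "S = node ` {..M}"
proof (intro equalityI subsetI)
  fix x assume x: "x \<in> S"
  show "x \<in> node ` {..M}"
  proof (cases x)
    case Branch
    then show ?thesis by (intro image_eqI[of _ _ 2]) (auto simp: node_def along_def)
  next
    case (Arm h d)
    then have d: "1 \<le> d" "d \<le> arm_len a b c h" using x by (auto simp: Arm_in_Y)
    have "h = k \<or> h = l \<or> h = m"
      using d arm_len_pos_imp[of a b c h] by (intro arms_perm_cases[OF klm]) auto
    then consider "x = node 1" | "x = node 0" | "x = node (d + 2)" "d \<le> L"
      using d len Arm by (auto simp: node_def along_def)
    then show ?thesis by cases auto
  qed
qed (use node_in_S in auto)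

lemma card_S: "card S = L + 3"
proof -
  have "inj_on node {..M}" by (simp add: inj_on_def node_inject)
  then show ?thesis unfolding S_eq_nodes by (simp add: card_image)
qed

lemma eps_node: "eps p (node r) =
    (if r = 0 then 1 / 2 else if r = 1 then (if p = 0 then - (1 / 2) else 1 / 2)
     else if r \<le> p then 1 else 0)"
proof -
  have "node r = Arm l 1 \<longleftrightarrow> r = 0" "node r = Arm k 1 \<longleftrightarrow> r = 1"
    using node_inject[of r 0] node_inject[of r 1] by (simp_all add: node_def)
  then show ?thesis by (auto simp: eps_def node_inject)
qed

lemma eps_refl_space:
  assumes "p \<le> M"
  shows "eps p \<in> refl_space S"
  unfolding refl_space_def
proof (intro CollectI allI impI)
  fix x assume x: "x \<notin> S"
  have "x \<noteq> node r" if "r \<le> M" for r using node_in_S[OF that] x by metis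
  then have "x \<noteq> node 0" "x \<noteq> node 1" "\<not> (\<exists>r. 2 \<le> r \<and> r \<le> p \<and> x = node r)"
    using assms by auto
  then show "eps p x = 0" unfolding node_0 node_1 by (simp add: eps_def)
qed

lemma simple_root_node_0: "simple_root (node 0) = eps 1 + eps 0"
proof
  fix x
  show "simple_root (node 0) x = (eps 1 + eps 0) x"
    by (auto simp: simple_root_def eps_def node_def)
qed

lemma simple_root_node:
  assumes "1 \<le> p"
  shows "simple_root (node p) = eps p - eps (p - 1)"
proof
  fix x
  show "simple_root (node p) x = (eps p - eps (p - 1)) x"
  proof (cases "\<exists>r. x = node r")
    case True
    then show ?thesis using assms by (auto simp: simple_root_def node_inject eps_node)
  next
    case False
    then have "x \<noteq> node 0" "x \<noteq> node 1" "\<And>r. x \<noteq> node r" by auto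
    then show ?thesis unfolding node_0 node_1 by (simp add: simple_root_def eps_def)
  qed
qed

lemma bil_node:
  assumes "p \<le> M" "q \<le> M"
  shows "bil S (simple_root (node p)) (eps q :: vertex \<Rightarrow> 'f::field_char_0) =
    (if p = 0 then of_bool (q \<le> 1) else of_bool (q = p) - of_bool (q = p - 1))"
proof -
  let ?e = "eps q :: vertex \<Rightarrow> 'f"
  have n: "node 0 = Arm l 1" "node 1 = Arm k 1" "node 2 = Branch" "node 3 = Arm m 1"
    by (simp_all add: node_def along_def)
  have "p = 0 \<or> p = 1 \<or> p = 2 \<or> (p = (p - 2) + 2 \<and> 1 \<le> p - 2 \<and> p - 2 \<le> L)"
    using assms(1) by auto
  then consider "p = 0" | "p = 1" | "p = 2" | d where "p = d + 2" "1 \<le> d" "d \<le> L"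
    by blast
  then show ?thesis
  proof cases
    case 1
    have "?e (Arm l 2) = 0" using node_in_S[of 0] ne by (auto simp: eps_def node_def along_def)
    then have "bil S (simple_root (node 0)) ?e = 2 * ?e (node 0) - ?e (node 2)"
      using bil_Arm[OF node_in_S[of 0, unfolded n] eps_refl_space[OF assms(2), where 'a = 'f]] n
      by (simp add: along_def numeral_2_eq_2)
    then show ?thesis using 1 by (auto simp: eps_node)
  next
    case 2
    have "?e (Arm k 2) = 0" using ne by (auto simp: eps_def node_def along_def)
    then have "bil S (simple_root (node 1)) ?e = 2 * ?e (node 1) - ?e (node 2)"
      using bil_Arm[OF node_in_S[of 1, unfolded n] eps_refl_space[OF assms(2), where 'a = 'f]] n
      by (simp add: along_def numeral_2_eq_2)
    then show ?thesis using 2 by (auto simp: eps_node)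
  next
    case 3
    have "bil S (simple_root (node 2)) ?e =
        2 * ?e (node 2) - (?e (node 1) + ?e (node 0) + ?e (node 3))"
      using bil_Branch[OF klm eps_refl_space[OF assms(2), where 'a = 'f]] by (simp only: n)
    then show ?thesis using 3 by (auto simp: eps_node)
  next
    case 4
    have "node p = Arm m d" "along m (d - 1) = node (p - 1)" "Arm m (Suc d) = node (p + 1)"
      using 4 by (auto simp: node_def along_def)
    then have "bil S (simple_root (node p)) ?e =
        2 * ?e (node p) - ?e (node (p - 1)) - ?e (node (p + 1))"
      using bil_Arm[of m d a b c "?e"] node_in_S[OF assms(1)] eps_refl_space[OF assms(2), where 'a = 'f] by simp
    then show ?thesis using 4 by (auto simp: eps_node)
  qed
qed

lemma bil_add_left: "bil S (x + y) z = bil S x z + bil S y z"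
  by (simp add: bil_def distrib_right sum.distrib)

lemma bil_diff_left: "bil S (x - y) z = bil S x z - bil S y z"
  by (simp add: bil_def left_diff_distrib sum_subtractf)

lemma eps_orthonormal:
  assumes "p \<le> M" "q \<le> M"
  shows "bil S (eps p) (eps q :: vertex \<Rightarrow> 'f::field_char_0) = (if p = q then 1 else 0)"
  using assms(1)
proof (induction p)
  case 0
  let ?b = "\<lambda>p. bil S (eps p) (eps q :: vertex \<Rightarrow> 'f)"
  have sum: "?b 1 + ?b 0 = of_bool (q \<le> 1)"
    using bil_node[of 0 q, where 'f = 'f] assms(2)
    unfolding simple_root_node_0 bil_add_left by simp
  have diff: "?b 1 - ?b 0 = of_bool (q = 1) - of_bool (q = 0)"
    using bil_node[of 1 q, where 'f = 'f] assms(2)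
    unfolding simple_root_node[OF order_refl] bil_diff_left by simp
  have "2 * ?b 0 = (?b 1 + ?b 0) - (?b 1 - ?b 0)" by simp
  also have "\<dots> = (if q = 0 then 2 else 0)" unfolding sum diff by auto
  finally show ?case by (auto split: if_splits)
next
  case (Suc p)
  have "bil S (eps (Suc p) - eps p) (eps q :: vertex \<Rightarrow> 'f) = of_bool (q = Suc p) - of_bool (q = p)"
    using bil_node[of "Suc p" q, where 'f = 'f] assms(2) Suc.prems
      simple_root_node[of "Suc p", where 'a = 'f] by simp
  then show ?case using Suc by (cases "p = q") (auto simp: bil_diff_left)
qed

lemma reflection_node:
  assumes "1 \<le> r" "r \<le> M" "p \<le> M"
  shows "reflection S (node r) (eps p) = eps (swap_below r p)"
proof -
  have "reflection S (node r) (eps p) =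
      eps p - fun_scale (of_bool (p = r) - of_bool (p = r - 1)) (eps r - eps (r - 1))"
    unfolding reflection_def bil_node[OF assms(2,3)] unfolding simple_root_node[OF assms(1)]
    using assms(1) by simp
  then show ?thesis
    using assms(1) by (auto simp: swap_below_def fun_scale_def fun_eq_iff)
qed

lemma reflection_node_0:
  assumes "p \<le> M"
  shows "reflection S (node 0) (eps p) = (if p \<le> 1 then - eps (swap_below 1 p) else eps p)"
proof -
  have "reflection S (node 0) (eps p) = eps p - fun_scale (of_bool (p \<le> 1)) (eps 1 + eps 0)"
    unfolding reflection_def bil_node[OF le0 assms] unfolding simple_root_node_0 by simp
  moreover have "p \<le> 1 \<longleftrightarrow> p = 0 \<or> p = 1" by auto
  ultimately show ?thesis by (auto simp: swap_below_def fun_scale_def fun_eq_iff)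
qed

end

section \<open>Roots and the small orbit in type D\<close>

lemma real_roots_words:
  assumes "finite S"
  shows "real_roots S = {word_act S u (simple_root i) :: vertex \<Rightarrow> 'f::field_char_0 | u i.
    u \<in> lists S \<and> i \<in> S}"
  unfolding real_roots_def carrier_weyl_group
proof (intro equalityI subsetI)
  fix \<beta> :: "vertex \<Rightarrow> 'f"
  assume "\<beta> \<in> {weyl_act S w (simple_root i) | w i.
    w \<in> (\<lambda>u. weyl_cong S `` {u}) ` lists S \<and> i \<in> S}"
  then obtain u i where "u \<in> lists S" "i \<in> S"
    "\<beta> = weyl_act S (weyl_cong S `` {u}) (simple_root i)" by blast
  then show "\<beta> \<in> {word_act S u (simple_root i) | u i. u \<in> lists S \<and> i \<in> S}"
    unfolding weyl_act_class[OF assms \<open>u \<in> lists S\<close>] by blast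
next
  fix \<beta> :: "vertex \<Rightarrow> 'f"
  assume "\<beta> \<in> {word_act S u (simple_root i) | u i. u \<in> lists S \<and> i \<in> S}"
  then obtain u i where u: "u \<in> lists S" "i \<in> S" "\<beta> = word_act S u (simple_root i)" by blast
  then show "\<beta> \<in> {weyl_act S w (simple_root i) | w i.
      w \<in> (\<lambda>u. weyl_cong S `` {u}) ` lists S \<and> i \<in> S}"
    unfolding weyl_act_class[OF assms u(1), symmetric, where 'f = 'f] u(3) by blast
qed

lemma simple_root_refl_space: "i \<in> S \<Longrightarrow> simple_root i \<in> refl_space S"
  by (auto simp: refl_space_def simple_root_def)

lemma real_roots_refl_space:
  assumes "finite S" "\<beta> \<in> real_roots S"
  shows "\<beta> \<in> refl_space S"
  using assms(2) word_act_refl_space simple_root_refl_space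
  unfolding real_roots_words[OF assms(1)] by blast

lemma real_roots_simple:
  assumes "finite S" "i \<in> S"
  shows "simple_root i \<in> real_roots S"
proof -
  have "word_act S [] (simple_root i) = simple_root i" by (simp add: word_act_def)
  then show ?thesis
    unfolding real_roots_words[OF assms(1)] using assms(2) by (metis (mono_tags, lifting) lists.Nil mem_Collect_eq)
qed

lemma real_roots_reflection:
  assumes "finite S" "i \<in> S" "\<beta> \<in> real_roots S"
  shows "reflection S i \<beta> \<in> real_roots S"
proof -
  obtain u j where u: "u \<in> lists S" "j \<in> S" "\<beta> = word_act S u (simple_root j)"
    using assms(3) unfolding real_roots_words[OF assms(1)] by blast
  then have "reflection S i \<beta> = word_act S (i # u) (simple_root j)" "i # u \<in> lists S"
    using assms(2) by (simp_all add: word_act_Cons)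
  then show ?thesis using u(2) unfolding real_roots_words[OF assms(1)] by blast
qed

lemma reflection_linear:
  "reflection S i (\<lambda>x. p * v x + q * w x) = (\<lambda>x. p * reflection S i v x + q * reflection S i w x)"
  using word_act_linear[of S "[i]" p v q w] by (simp add: word_act_def)

lemma reflection_add: "reflection S i (v + w) = reflection S i v + reflection S i w"
  using reflection_linear[of S i 1 v 1 w] by (simp add: plus_fun_def)

lemma reflection_diff: "reflection S i (v - w) = reflection S i v - reflection S i w"
  using reflection_linear[of S i 1 v "-1" w] by (simp add: fun_diff_def)

lemma diag_act_diff: "diag_act S g (s - t) = diag_act S g s - diag_act S g t"
proof -
  have "s - t = s + fun_scale (-1) t" by (simp add: fun_scale_def fun_eq_iff)
  then have "diag_act S g (s - t) = diag_act S g s + fun_scale (-1) (diag_act S g t)"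
    by (simp only: diag_act_add diag_act_scale)
  then show ?thesis by (simp add: fun_scale_def fun_eq_iff)
qed

lemma vee_sym_square: "v \<in> refl_space S \<Longrightarrow> w \<in> refl_space S \<Longrightarrow> vee v w \<in> sym_square S"
  unfolding sym_square_def by (rule fun_space.span_base) blast

lemma positive_2_rootsI:
  "\<alpha> \<in> positive_roots S \<Longrightarrow> \<beta> \<in> positive_roots S \<Longrightarrow> bil S \<alpha> \<beta> = 0 \<Longrightarrow>
    vee \<alpha> \<beta> \<in> positive_2_roots S"
  unfolding positive_2_roots_def by blast

lemma positive_2_roots_Nats:
  assumes "t \<in> positive_2_roots S" "i \<in> S" "j \<in> S"
  shows "t (i, j) \<in> \<nat>"
  using assms unfolding positive_2_roots_def positive_roots_def
  by (auto simp: vee_def tensor_def)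

context type_D_diagram
begin

lemma node_cases:
  assumes "i \<in> S"
  obtains r where "r \<le> M" "i = node r"
  using assms unfolding S_eq_nodes by auto

text \<open>Each simple reflection permutes the vectors \<open>eps p\<close> up to sign; the one at \<open>node 0\<close> exchanges
  \<open>eps 0\<close> and \<open>- eps 1\<close>.\<close>

lemma reflection_eps:
  assumes "r \<le> M" "p \<le> M"
  shows "reflection S (node r) (eps p) =
    (\<lambda>x. (if r = 0 \<and> p \<le> 1 then -1 else 1) * eps (swap_below (max r 1) p) x)"
proof (cases "r = 0")
  case True
  then show ?thesis
    using reflection_node_0[OF assms(2)] by (auto simp: swap_below_def fun_eq_iff)
next
  case False
  then have "max r 1 = r" "1 \<le> r" by auto
  then show ?thesis
    using False reflection_node[OF \<open>1 \<le> r\<close> assms] by simp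
qed

text \<open>The roots \<open>\<plusminus>eps p \<plusminus> eps q\<close> with \<open>p \<noteq> q\<close>.\<close>

definition signed_pair :: "(vertex \<Rightarrow> 'f::field_char_0) \<Rightarrow> bool" where
  "signed_pair \<beta> \<longleftrightarrow> (\<exists>p q s t. p \<le> M \<and> q \<le> M \<and> p \<noteq> q \<and> s \<in> {1, -1} \<and> t \<in> {1, -1} \<and>
    \<beta> = (\<lambda>x. s * eps p x + t * eps q x))"

lemma signed_pair_reflection:
  assumes "i \<in> S" "signed_pair \<beta>"
  shows "signed_pair (reflection S i \<beta>)"
proof -
  obtain r where r: "r \<le> M" "i = node r" using node_cases[OF assms(1)] .
  obtain p q s t where pq: "p \<le> M" "q \<le> M" "p \<noteq> q" "s \<in> {1, -1}" "t \<in> {1, -1}"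
    "\<beta> = (\<lambda>x. s * eps p x + t * eps q x)"
    using assms(2) unfolding signed_pair_def by blast
  let ?w = "swap_below (max r 1)" and ?g = "\<lambda>p. if r = 0 \<and> p \<le> 1 then -1 else 1"
  have "reflection S i \<beta> = (\<lambda>x. (s * ?g p) * eps (?w p) x + (t * ?g q) * eps (?w q) x)"
    unfolding pq(6) reflection_linear r(2) reflection_eps[OF r(1) pq(1)]
      reflection_eps[OF r(1) pq(2)] by (simp add: mult.assoc)
  moreover have "?w p \<le> M" "?w q \<le> M" "?w p \<noteq> ?w q"
    using swap_below_le[of "max r 1" M] r(1) pq(1-3) by (auto simp: swap_below_inject)
  moreover have "s * ?g p \<in> {1, -1}" "t * ?g q \<in> {1, -1}" using pq(4,5) by auto
  ultimately show ?thesis unfolding signed_pair_def by blast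
qed

lemma signed_pair_simple:
  assumes "i \<in> S"
  shows "signed_pair (simple_root i)"
proof -
  obtain r where r: "r \<le> M" "i = node r" using node_cases[OF assms] .
  show ?thesis
  proof (cases "r = 0")
    case True
    then have "simple_root i = (\<lambda>x. 1 * eps 1 x + 1 * eps 0 x)"
      unfolding r(2) True simple_root_node_0 by (simp add: fun_eq_iff)
    moreover have "(1 :: nat) \<le> M" "0 \<le> M" "(1 :: nat) \<noteq> 0" by auto
    ultimately show ?thesis unfolding signed_pair_def by blast
  next
    case False
    then have "1 \<le> r" by simp
    then have "simple_root i = (\<lambda>x. 1 * eps r x + -1 * eps (r - 1) x)"
      unfolding r(2) simple_root_node[OF \<open>1 \<le> r\<close>] by (simp add: fun_eq_iff)
    moreover have "r \<le> M" "r - 1 \<le> M" "r \<noteq> r - 1" using r False by auto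
    ultimately show ?thesis unfolding signed_pair_def by blast
  qed
qed

lemma real_root_form:
  assumes "\<beta> \<in> real_roots S"
  obtains p q where "q < p" "p \<le> M"
    "\<beta> = eps p - eps q \<or> \<beta> = - (eps p - eps q) \<or> \<beta> = eps p + eps q \<or> \<beta> = - (eps p + eps q)"
proof -
  obtain u i where u: "u \<in> lists S" "i \<in> S" "\<beta> = word_act S u (simple_root i)"
    using assms unfolding real_roots_words[OF finite_Y] by blast
  have "signed_pair (word_act S u (simple_root i))"
    using u(1)
  proof (induction u)
    case Nil
    then show ?case using signed_pair_simple[OF u(2)] by (simp add: word_act_def)
  next
    case (Cons j u)
    then show ?case by (simp add: word_act_Cons signed_pair_reflection)
  qed
  then obtain p q s t where pq: "p \<le> M" "q \<le> M" "p \<noteq> q" "s \<in> {1, -1}" "t \<in> {1, -1}"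
    "\<beta> = (\<lambda>x. s * eps p x + t * eps q x)"
    unfolding u(3) signed_pair_def by blast
  have "\<beta> = eps p - eps q \<or> \<beta> = - (eps p - eps q) \<or> \<beta> = eps p + eps q \<or> \<beta> = - (eps p + eps q)"
    using pq(4,5) unfolding pq(6) by (auto simp: fun_eq_iff)
  moreover have "eps p - eps q = - (eps q - eps p)" "- (eps p - eps q) = eps q - eps p"
    "eps p + eps q = eps q + eps p" by (auto simp: add.commute)
  ultimately show ?thesis
    using that[of p q] that[of q p] pq(1-3) by (metis linorder_neqE_nat)
qed

lemma positive_coordinates:
  assumes "q < p" "p \<le> M" "i \<in> S"
  shows "(eps p - eps q :: vertex \<Rightarrow> 'f::field_char_0) i \<in> \<nat>"
    and "(eps p + eps q :: vertex \<Rightarrow> 'f) i \<in> \<nat>"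
proof -
  obtain r where r: "r \<le> M" "i = node r" using node_cases[OF assms(3)] .
  have "(eps p - eps q :: vertex \<Rightarrow> 'f) i \<in> {0, 1}" "(eps p + eps q :: vertex \<Rightarrow> 'f) i \<in> {0, 1, 2}"
    using assms(1) by (auto simp: r(2) eps_node)
  then show "(eps p - eps q :: vertex \<Rightarrow> 'f) i \<in> \<nat>" "(eps p + eps q :: vertex \<Rightarrow> 'f) i \<in> \<nat>" by auto
qed

lemma unit_coordinates:
  assumes "q < p"
  shows "(eps p - eps q) (node p) = 1" "(eps p + eps q) (node 0) = 1" "(eps p - eps q) (node 0) = 0"
  using assms by (auto simp: eps_node)

lemma real_roots_eps:
  assumes "q < p" "p \<le> M"
  shows "eps p - eps q \<in> (real_roots S :: (vertex \<Rightarrow> 'f::field_char_0) set)"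
    and "eps p + eps q \<in> (real_roots S :: (vertex \<Rightarrow> 'f) set)"
proof -
  let ?R = "real_roots S :: (vertex \<Rightarrow> 'f) set"
  show "eps p - eps q \<in> ?R"
  proof (rule ordered_pair_induct[where P = "\<lambda>p q. eps p - eps q \<in> ?R", OF _ _ assms])
    have "simple_root (node 1) = (eps 1 - eps 0 :: vertex \<Rightarrow> 'f)"
      by (subst simple_root_node) simp_all
    then show "eps 1 - eps 0 \<in> ?R"
      using real_roots_simple[OF finite_Y node_in_S[of 1], where 'a = 'f] by simp
    fix r p q :: nat assume r: "1 \<le> r" "r \<le> M" "p \<le> M" "q \<le> M" "eps p - eps q \<in> ?R"
    have "reflection S (node r) (eps p - eps q) =
        (eps (swap_below r p) - eps (swap_below r q) :: vertex \<Rightarrow> 'f)"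
      using r by (simp add: reflection_diff reflection_node)
    then show "eps (swap_below r p) - eps (swap_below r q) \<in> ?R"
      using real_roots_reflection[OF finite_Y node_in_S[OF r(2)] r(5)] by simp
  qed
  show "eps p + eps q \<in> ?R"
  proof (rule ordered_pair_induct[where P = "\<lambda>p q. eps p + eps q \<in> ?R", OF _ _ assms])
    have "simple_root (node 0) = (eps 1 + eps 0 :: vertex \<Rightarrow> 'f)" by (rule simple_root_node_0)
    then show "eps 1 + eps 0 \<in> ?R"
      using real_roots_simple[OF finite_Y node_in_S[OF le0], where 'a = 'f] by simp
    fix r p q :: nat assume r: "1 \<le> r" "r \<le> M" "p \<le> M" "q \<le> M" "eps p + eps q \<in> ?R"
    have "reflection S (node r) (eps p + eps q) =
        (eps (swap_below r p) + eps (swap_below r q) :: vertex \<Rightarrow> 'f)"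
      using r by (simp add: reflection_add reflection_node)
    then show "eps (swap_below r p) + eps (swap_below r q) \<in> ?R"
      using real_roots_reflection[OF finite_Y node_in_S[OF r(2)] r(5)] by simp
  qed
qed

text \<open>A coordinate equal to \<open>1\<close> shows that \<open>- (eps p \<plusminus> eps q)\<close> with \<open>q < p\<close> is not positive.\<close>

lemma positive_roots_eps:
  "positive_roots S = {eps p - eps q | p q. q < p \<and> p \<le> M} \<union>
    {eps p + eps q :: vertex \<Rightarrow> 'f::field_char_0 | p q. q < p \<and> p \<le> M}"
proof (intro equalityI subsetI)
  fix \<beta> :: "vertex \<Rightarrow> 'f" assume \<beta>: "\<beta> \<in> positive_roots S"
  then have root: "\<beta> \<in> real_roots S" and nat: "\<And>i. i \<in> S \<Longrightarrow> \<beta> i \<in> \<nat>"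
    by (auto simp: positive_roots_def)
  obtain p q where pq: "q < p" "p \<le> M"
    "\<beta> = eps p - eps q \<or> \<beta> = - (eps p - eps q) \<or> \<beta> = eps p + eps q \<or> \<beta> = - (eps p + eps q)"
    using real_root_form[OF root] .
  have "\<beta> \<noteq> - (eps p - eps q)"
  proof
    assume "\<beta> = - (eps p - eps q)"
    then have "\<beta> (node p) = - ((eps p - eps q) (node p))" by simp
    then show False
      using nat[OF node_in_S[OF pq(2)]] minus_one_not_Nats[where 'f = 'f] unfolding unit_coordinates[OF pq(1)] by simp
  qed
  moreover have "\<beta> \<noteq> - (eps p + eps q)"
  proof
    assume "\<beta> = - (eps p + eps q)"
    then have "\<beta> (node 0) = - ((eps p + eps q) (node 0))" by simp
    then show False
      using nat[OF node_in_S[OF le0]] minus_one_not_Nats[where 'f = 'f] unfolding unit_coordinates[OF pq(1)] by simp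
  qed
  ultimately show "\<beta> \<in> {eps p - eps q | p q. q < p \<and> p \<le> M} \<union> {eps p + eps q | p q. q < p \<and> p \<le> M}"
    using pq by blast
next
  fix \<beta> :: "vertex \<Rightarrow> 'f"
  assume "\<beta> \<in> {eps p - eps q | p q. q < p \<and> p \<le> M} \<union> {eps p + eps q | p q. q < p \<and> p \<le> M}"
  then obtain p q where pq: "q < p" "p \<le> M" "\<beta> = eps p - eps q \<or> \<beta> = eps p + eps q" by blast
  then have "\<beta> \<in> real_roots S" using real_roots_eps[OF pq(1,2), where 'f = 'f] by metis
  moreover have "\<beta> i \<in> \<nat>" if "i \<in> S" for i
    using positive_coordinates[OF pq(1,2) that, where 'f = 'f] pq(3) by metis
  ultimately show "\<beta> \<in> positive_roots S" unfolding positive_roots_def by blast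
qed

lemma diag_act_eps:
  assumes "r \<le> M" "p \<le> M"
  shows "diag_act S (weyl_cong S `` {[node r]}) (vee (eps p) (eps p)) =
    (vee (eps (swap_below (max r 1) p)) (eps (swap_below (max r 1) p))
      :: vertex \<times> vertex \<Rightarrow> 'f::field_char_0)"
proof -
  have "[node r] \<in> lists S" using node_in_S[OF assms(1)] by simp
  then have "diag_act S (weyl_cong S `` {[node r]}) (vee (eps p) (eps p)) =
      (vee (reflection S (node r) (eps p)) (reflection S (node r) (eps p))
        :: vertex \<times> vertex \<Rightarrow> 'f)"
    by (simp add: diag_act_vee[OF finite_Y _ eps_refl_space[OF assms(2)] eps_refl_space[OF assms(2)]]
        word_act_def)
  then show ?thesis
    unfolding reflection_eps[OF assms] by (auto simp: vee_def tensor_def)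
qed

lemma eps_sym_square: "p \<le> M \<Longrightarrow> vee (eps p) (eps p) \<in> sym_square S"
  by (intro vee_sym_square eps_refl_space)

lemma sym_square_diff: "s \<in> sym_square S \<Longrightarrow> t \<in> sym_square S \<Longrightarrow> s - t \<in> sym_square S"
  unfolding sym_square_def by (rule fun_space.span_diff)

text \<open>As \<open>(x - y) \<or> (x + y) = x \<or> x - y \<or> y\<close>, the two short arms contribute the 2-root
  \<open>eps 1 \<or> eps 1 - eps 0 \<or> eps 0\<close>. Signs disappear in \<open>x \<or> x\<close>, so \<open>W\<close> merely permutes the indices.\<close>

lemma orbit_form:
  assumes "u \<in> lists S"
  obtains p q where "p \<le> M" "q \<le> M" "p \<noteq> q"
    "diag_act S (weyl_cong S `` {u}) (vee (eps 1) (eps 1) - vee (eps 0) (eps 0)) =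
      (vee (eps p) (eps p) - vee (eps q) (eps q) :: vertex \<times> vertex \<Rightarrow> 'f::field_char_0)"
proof -
  let ?t = "vee (eps 1) (eps 1) - vee (eps 0) (eps 0) :: vertex \<times> vertex \<Rightarrow> 'f"
  have t: "?t \<in> sym_square S" by (intro sym_square_diff eps_sym_square) auto
  have "\<exists>p q. p \<le> M \<and> q \<le> M \<and> p \<noteq> q \<and> diag_act S (weyl_cong S `` {u}) ?t =
      vee (eps p) (eps p) - vee (eps q) (eps q)"
    using assms
  proof (induction u)
    case Nil
    show ?case
      unfolding diag_act_Nil[OF finite_Y t] by (intro exI[of _ 1] exI[of _ 0]) auto
  next
    case (Cons i u)
    have uS: "u \<in> lists S" "[i] \<in> lists S" using Cons.hyps by auto
    obtain p q where pq: "p \<le> M" "q \<le> M" "p \<noteq> q"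
      "diag_act S (weyl_cong S `` {u}) ?t = vee (eps p) (eps p) - vee (eps q) (eps q)"
      using Cons.IH by blast
    obtain r where r: "r \<le> M" "i = node r" using node_cases[of i] uS(2) by auto
    let ?w = "swap_below (max r 1)"
    have "diag_act S (weyl_cong S `` {i # u}) ?t =
        diag_act S (weyl_cong S `` {[i]}) (diag_act S (weyl_cong S `` {u}) ?t)"
      using diag_act_append[OF finite_Y uS(2,1) t] by simp
    also have "\<dots> = vee (eps (?w p)) (eps (?w p)) - vee (eps (?w q)) (eps (?w q))"
      unfolding pq(4) unfolding diag_act_diff r(2) diag_act_eps[OF r(1) pq(1)] diag_act_eps[OF r(1) pq(2)] ..
    finally have "diag_act S (weyl_cong S `` {i # u}) ?t =
        vee (eps (?w p)) (eps (?w p)) - vee (eps (?w q)) (eps (?w q))" .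
    moreover have "?w p \<le> M" "?w q \<le> M" "?w p \<noteq> ?w q"
      using swap_below_le[of "max r 1" M] r(1) pq(1-3) by (auto simp: swap_below_inject)
    ultimately show ?case by blast
  qed
  then show ?thesis using that by blast
qed

text \<open>The orthonormal vectors \<open>\<epsilon>\<^sub>i\<close> are \<open>eps (n - i)\<close>. Among the 2-roots of the orbit, \<open>orbit_form\<close> leaves
  only the question of the sign, and a coordinate equal to \<open>-1\<close> excludes the wrong one.\<close>

lemma small_orbit_of_short_arms:
  fixes X :: "(vertex \<times> vertex \<Rightarrow> 'f::field_char_0) set"
  assumes "X \<in> two_root_orbits S"
    and X: "X = {diag_act S (weyl_cong S `` {u})
      (vee (simple_root (Arm k 1)) (simple_root (Arm l 1))) | u. u \<in> lists S}"
  shows "small_orbit S X"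
proof -
  let ?Q = "\<lambda>p. vee (eps p) (eps p) :: vertex \<times> vertex \<Rightarrow> 'f"
  have start: "vee (simple_root (Arm k 1)) (simple_root (Arm l 1)) = ?Q 1 - ?Q 0"
  proof -
    have "simple_root (Arm k 1) = (eps 1 - eps 0 :: vertex \<Rightarrow> 'f)"
      unfolding node_1[symmetric] by (subst simple_root_node) simp_all
    moreover have "simple_root (Arm l 1) = (eps 1 + eps 0 :: vertex \<Rightarrow> 'f)"
      unfolding node_0[symmetric] by (rule simple_root_node_0)
    ultimately show ?thesis by (simp only: vee_diff_sum)
  qed
  have X': "X = {diag_act S (weyl_cong S `` {u}) (?Q 1 - ?Q 0) | u. u \<in> lists S}"
    unfolding X start ..
  have Q_sym: "?Q 1 - ?Q 0 \<in> sym_square S" by (intro sym_square_diff eps_sym_square) auto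
  have in_X: "?Q p - ?Q q \<in> X" if "q < p" "p \<le> M" for p q
  proof (rule ordered_pair_induct[where P = "\<lambda>p q. ?Q p - ?Q q \<in> X", OF _ _ that])
    show "?Q 1 - ?Q 0 \<in> X"
      unfolding X' using diag_act_Nil[OF finite_Y Q_sym] by (metis (mono_tags, lifting) lists.Nil mem_Collect_eq)
    fix r p q :: nat assume r: "1 \<le> r" "r \<le> M" and pq: "p \<le> M" "q \<le> M" "?Q p - ?Q q \<in> X"
    obtain u where u: "u \<in> lists S" "?Q p - ?Q q = diag_act S (weyl_cong S `` {u}) (?Q 1 - ?Q 0)"
      using pq(3) unfolding X' by blast
    have n: "[node r] \<in> lists S" using node_in_S[OF r(2)] by simp
    have "?Q (swap_below r p) - ?Q (swap_below r q) =
        diag_act S (weyl_cong S `` {[node r]}) (?Q p - ?Q q)"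
    proof -
      have "max r 1 = r" using r(1) by simp
      then show ?thesis
        using diag_act_eps[OF r(2) pq(1), where 'f = 'f] diag_act_eps[OF r(2) pq(2), where 'f = 'f]
        by (simp only: diag_act_diff)
    qed
    also have "\<dots> = diag_act S (weyl_cong S `` {[node r] @ u}) (?Q 1 - ?Q 0)"
      unfolding u(2) diag_act_append[OF finite_Y n u(1) Q_sym] ..
    finally show "?Q (swap_below r p) - ?Q (swap_below r q) \<in> X"
      unfolding X' using append_in_lists_conv[of "[node r]" u S] n u(1) by blast
  qed
  have pos: "vee (eps p - eps q) (eps p + eps q :: vertex \<Rightarrow> 'f) \<in> positive_2_roots S" if "q < p" "p \<le> M" for p q
  proof -
    have "bil S (eps p - eps q) (eps p + eps q :: vertex \<Rightarrow> 'f) = 0"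
    proof -
      have right: "bil S z (eps p + eps q) = bil S z (eps p) + bil S z (eps q)"
        for z :: "vertex \<Rightarrow> 'f"
        by (simp add: bil_def distrib_left sum.distrib)
      show ?thesis using that by (simp add: right bil_diff_left eps_orthonormal)
    qed
    moreover have "(eps p - eps q :: vertex \<Rightarrow> 'f) \<in> positive_roots S"
      "(eps p + eps q :: vertex \<Rightarrow> 'f) \<in> positive_roots S"
      unfolding positive_roots_eps using that by blast+
    ultimately show ?thesis
      using positive_2_rootsI by blast
  qed
  have not_pos: "?Q p - ?Q q \<notin> positive_2_roots S" if "p < q" "q \<le> M" for p q
  proof
    assume "?Q p - ?Q q \<in> positive_2_roots S"
    then have "(?Q p - ?Q q) (node q, node 0) \<in> \<nat>"
      by (rule positive_2_roots_Nats) (use node_in_S[OF that(2)] node_in_S[OF le0] in auto)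
    moreover have "(?Q p - ?Q q) (node q, node 0) = -1"
    proof -
      have "?Q p - ?Q q = - vee (eps q - eps p) (eps q + eps p)"
        by (simp only: vee_diff_sum minus_diff_eq)
      then have "(?Q p - ?Q q) (node q, node 0) =
          - ((eps q - eps p :: vertex \<Rightarrow> 'f) (node q) * (eps q + eps p) (node 0) +
             (eps q + eps p) (node q) * (eps q - eps p) (node 0))"
        by (simp add: vee_def tensor_def)
      then show ?thesis unfolding unit_coordinates[OF that(1)] by simp
    qed
    ultimately show False using minus_one_not_Nats[where 'f = 'f] by simp
  qed
  have inter: "X \<inter> positive_2_roots S =
      {vee (eps p - eps q) (eps p + eps q) | p q. q < p \<and> p \<le> M}"
  proof (intro equalityI subsetI)
    fix t assume t: "t \<in> X \<inter> positive_2_roots S"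
    then have "t \<in> X" by simp
    then obtain u where u: "u \<in> lists S" "t = diag_act S (weyl_cong S `` {u}) (?Q 1 - ?Q 0)"
      unfolding X' by blast
    obtain p q where pq: "p \<le> M" "q \<le> M" "p \<noteq> q" "t = ?Q p - ?Q q"
      using orbit_form[OF u(1), where 'f = 'f] unfolding u(2) by metis
    then have "q < p" using not_pos[of p q] t by (metis IntD2 linorder_neqE_nat)
    then show "t \<in> {vee (eps p - eps q) (eps p + eps q) | p q. q < p \<and> p \<le> M}"
      using pq unfolding vee_diff_sum by blast
  next
    fix t :: "vertex \<times> vertex \<Rightarrow> 'f"
    assume "t \<in> {vee (eps p - eps q) (eps p + eps q) | p q. q < p \<and> p \<le> M}"
    then obtain p q where pq: "q < p" "p \<le> M" "t = vee (eps p - eps q) (eps p + eps q)" by blast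
    then have "t \<in> X" using in_X[OF pq(1,2)] by (simp only: vee_diff_sum)
    then show "t \<in> X \<inter> positive_2_roots S" using pos[OF pq(1,2)] pq(3) by simp
  qed
  define e :: "nat \<Rightarrow> vertex \<Rightarrow> 'f" where "e i = eps (L + 3 - i)" for i
  have reindex: "{f (eps p) (eps q) | p q. q < p \<and> p \<le> M} =
      {f (e i) (e j) | i j. 1 \<le> i \<and> i < j \<and> j \<le> card S}"
    for f :: "(vertex \<Rightarrow> 'f) \<Rightarrow> (vertex \<Rightarrow> 'f) \<Rightarrow> 'c"
  proof (intro equalityI subsetI)
    fix z assume "z \<in> {f (eps p) (eps q) | p q. q < p \<and> p \<le> M}"
    then obtain p q where pq: "q < p" "p \<le> M" "z = f (eps p) (eps q)" by blast
    have "z = f (e (L + 3 - p)) (e (L + 3 - q))" using pq by (simp add: e_def)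
    moreover have "1 \<le> L + 3 - p" "L + 3 - p < L + 3 - q" "L + 3 - q \<le> card S"
      unfolding card_S using pq by auto
    ultimately show "z \<in> {f (e i) (e j) | i j. 1 \<le> i \<and> i < j \<and> j \<le> card S}" by blast
  next
    fix z assume "z \<in> {f (e i) (e j) | i j. 1 \<le> i \<and> i < j \<and> j \<le> card S}"
    then obtain i j where ij: "1 \<le> i" "i < j" "j \<le> card S" "z = f (e i) (e j)" by blast
    have "L + 3 - j < L + 3 - i" "L + 3 - i \<le> M" using ij unfolding card_S by auto
    then show "z \<in> {f (eps p) (eps q) | p q. q < p \<and> p \<le> M}"
      using ij(4) unfolding e_def by blast
  qed
  have orthonormal: "bil S (e i) (e j) = (if i = j then 1 else 0)"
    if "i \<in> {1..card S}" "j \<in> {1..card S}" for i j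
  proof -
    have "L + 3 - i \<le> M" "L + 3 - j \<le> M" "L + 3 - i = L + 3 - j \<longleftrightarrow> i = j"
      using that unfolding card_S by auto
    then show ?thesis unfolding e_def by (simp add: eps_orthonormal)
  qed
  have roots: "positive_roots S = {e i - e j | i j. 1 \<le> i \<and> i < j \<and> j \<le> card S} \<union>
      {e i + e j | i j. 1 \<le> i \<and> i < j \<and> j \<le> card S}"
    unfolding positive_roots_eps reindex[of "\<lambda>x y. x - y"] reindex[of "\<lambda>x y. x + y"] ..
  have two_roots: "X \<inter> positive_2_roots S =
      {vee (e i - e j) (e i + e j) | i j. 1 \<le> i \<and> i < j \<and> j \<le> card S}"
    unfolding inter reindex[of "\<lambda>x y. vee (x - y) (x + y)"] ..
  have space: "\<forall>i\<in>{1..card S}. e i \<in> refl_space S"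
    unfolding card_S e_def by (intro ballI eps_refl_space) auto
  show ?thesis
    unfolding small_orbit_def
  proof (rule conjI[OF assms(1)], rule exI[of _ e], intro conjI)
    show "\<forall>i\<in>{1..card S}. \<forall>j\<in>{1..card S}. bil S (e i) (e j) = (if i = j then 1 else 0)"
      by (intro ballI orthonormal)
  qed (fact space roots two_roots)+
qed

end

section \<open>The kernel of the action\<close>

text \<open>Any member of an orbit may serve as its base point, and classes of words may be replaced by
  words.\<close>

lemma two_root_orbit_words:
  fixes X :: "(vertex \<times> vertex \<Rightarrow> 'f::field_char_0) set"
  assumes "finite S" "X \<in> two_root_orbits S" "t \<in> X"
  shows "X = {diag_act S (weyl_cong S `` {u}) t | u. u \<in> lists S}"
proof -
  obtain t0 where t0: "t0 \<in> real_2_roots S"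
    and orb: "X = orbit (weyl_group S) (action_on S (real_2_roots S)) t0"
    using assms(2) unfolding two_root_orbits_def orbits_def by blast
  have X: "X = {diag_act S (weyl_cong S `` {u}) t0 | u. u \<in> lists S}"
    using t0 unfolding orb orbit_def action_on_def carrier_weyl_group by auto
  have t0_sym: "t0 \<in> sym_square S"
    using t0 real_roots_refl_space[OF assms(1)] vee_sym_square
    unfolding real_2_roots_def by blast
  obtain v where v: "v \<in> lists S" "t = diag_act S (weyl_cong S `` {v}) t0"
    using assms(3) unfolding X by blast
  have r: "rev v \<in> lists S" using v(1) by (simp add: in_lists_conv_set)
  have t_sym: "t \<in> sym_square S"
  proof -
    obtain \<alpha> \<beta> where "\<alpha> \<in> refl_space S" "\<beta> \<in> refl_space S" "t0 = vee \<alpha> \<beta>"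
      using t0 real_roots_refl_space[OF assms(1)] unfolding real_2_roots_def by blast
    then show ?thesis
      using v diag_act_vee[OF assms(1) v(1)] vee_sym_square word_act_refl_space by metis
  qed
  show ?thesis
  proof (intro equalityI subsetI)
    fix s assume "s \<in> X"
    then obtain u where u: "u \<in> lists S" "s = diag_act S (weyl_cong S `` {u}) t0"
      unfolding X by blast
    have "s = diag_act S (weyl_cong S `` {u @ rev v}) t"
      unfolding diag_act_append[OF assms(1) u(1) r t_sym] u(2)
      using diag_act_cancel[OF assms(1) v(1) t0_sym] v(2) by simp
    then show "s \<in> {diag_act S (weyl_cong S `` {u}) t | u. u \<in> lists S}"
      using append_in_lists_conv[of u "rev v" S] u(1) r by blast
  next
    fix s assume "s \<in> {diag_act S (weyl_cong S `` {u}) t | u. u \<in> lists S}"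
    then obtain u where u: "u \<in> lists S" "s = diag_act S (weyl_cong S `` {u}) t" by blast
    have "s = diag_act S (weyl_cong S `` {u @ v}) t0"
      unfolding u(2) v(2) diag_act_append[OF assms(1) u(1) v(1) t0_sym] ..
    then show "s \<in> X"
      unfolding X using append_in_lists_conv[of u v S] u(1) v(1) by blast
  qed
qed

text \<open>Outside the first vertex of an arm, the neighbour on the side of the branch vertex tells two
  vertices apart; for first vertices, the next vertex on the arm does so if there is one.\<close>

lemma same_neighbours:
  assumes pos: "1 \<le> a" "1 \<le> b" "1 \<le> c"
    and xy: "x \<in> Y a b c" "y \<in> Y a b c" "x \<noteq> y"
    and same: "\<And>z. z \<in> Y a b c \<Longrightarrow> adjacent z x \<longleftrightarrow> adjacent z y"
  obtains k l where "x = Arm k 1" "y = Arm l 1" "k \<noteq> l"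
    "arm_len a b c k = 1" "arm_len a b c l = 1"
proof -
  let ?S = "Y a b c"
  have first: "Arm 0 1 \<in> ?S" "Arm 1 1 \<in> ?S"
    using pos by (auto simp: Arm_in_Y arm_len_def)
  have no_branch: "v \<noteq> Branch"
    if "v \<in> ?S" "w \<in> ?S" "v \<noteq> w" "\<And>z. z \<in> ?S \<Longrightarrow> adjacent z v \<longleftrightarrow> adjacent z w" for v w
  proof
    assume "v = Branch"
    then have "adjacent (Arm 0 1) w" "adjacent (Arm 1 1) w"
      using that(4)[OF first(1)] that(4)[OF first(2)] by simp_all
    then show False using \<open>v = Branch\<close> that(3) by (cases w) auto
  qed
  obtain k d where x: "x = Arm k d" using no_branch[OF xy same] by (cases x) auto
  obtain l e where y: "y = Arm l e"
    using no_branch[OF xy(2,1) xy(3)[symmetric] same[symmetric]] by (cases y) auto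
  have d: "1 \<le> d" "d \<le> arm_len a b c k" and e: "1 \<le> e" "e \<le> arm_len a b c l"
    using xy by (simp_all add: x y Arm_in_Y)
  have first_vertex: "d = 1"
    if S: "Arm k d \<in> ?S" "Arm l e \<in> ?S" "Arm k d \<noteq> Arm l e"
      and nb: "\<And>z. z \<in> ?S \<Longrightarrow> adjacent z (Arm k d) \<longleftrightarrow> adjacent z (Arm l e)" for k d l e
  proof (rule ccontr)
    assume "d \<noteq> 1"
    then obtain d' where d': "d = Suc d'" "1 \<le> d'" using S(1) by (cases d) (auto simp: Arm_in_Y)
    then have "Arm k d' \<in> ?S" using S(1) by (simp add: Arm_in_Y)
    from nb[OF this] have kl: "k = l" "d' = Suc e" using S(3) d' by auto
    have e: "1 \<le> e" "along l (e - 1) \<in> ?S" using S(2) by (auto simp: along_def Arm_in_Y)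
    have "adjacent (along l (e - 1)) (Arm l e)" using e(1) by (auto simp: along_def)
    then have "adjacent (along l (e - 1)) (Arm l (Suc (Suc e)))"
      using nb[OF e(2)] d' kl by simp
    then show False using e(1) by (simp add: along_def split: if_splits)
  qed
  have "d = 1" using first_vertex xy same unfolding x y by blast
  moreover have "e = 1"
    using first_vertex[OF xy(2)[unfolded y] xy(1)[unfolded x]] xy(3) same unfolding x y by metis
  ultimately have x1: "x = Arm k 1" and y1: "y = Arm l 1" and kl: "k \<noteq> l" using xy(3) x y by auto
  have "arm_len a b c k = 1"
  proof (rule ccontr)
    assume "arm_len a b c k \<noteq> 1"
    then have "Arm k 2 \<in> ?S" using d by (simp add: Arm_in_Y)
    from same[OF this] show False using kl by (simp add: x1 y1)
  qed
  moreover have "arm_len a b c l = 1"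
  proof (rule ccontr)
    assume "arm_len a b c l \<noteq> 1"
    then have "Arm l 2 \<in> ?S" using e by (simp add: Arm_in_Y)
    from same[OF this] show False using kl by (simp add: x1 y1)
  qed
  ultimately show ?thesis using that x1 y1 kl by blast
qed

lemma two_short_arms:
  assumes pos: "1 \<le> a" "1 \<le> b" "1 \<le> c"
    and kl: "k \<noteq> l" "arm_len a b c k = 1" "arm_len a b c l = 1"
  obtains m where "arms_perm k l m" "type_D a b c (arm_len a b c m + 3)" "1 \<le> arm_len a b c m"
proof -
  have "k \<in> {0, 1, 2}" "l \<in> {0, 1, 2}"
    using arm_len_pos_imp[of a b c k] arm_len_pos_imp[of a b c l] kl by auto
  then have "(k, l) \<in> {(0, 1), (0, 2), (1, 0), (1, 2), (2, 0), (2, 1)}" using kl(1) by auto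
  then have "arms_perm k l (3 - k - l)" by (auto simp: arms_perm_def)
  then obtain m where m: "arms_perm k l m" by blast
  have "m \<in> {0, 1, 2}" using arms_perm_enum[OF m] by auto
  then have "1 \<le> arm_len a b c m" using pos by (auto simp: arm_len_def)
  moreover from this have "type_D a b c (arm_len a b c m + 3)"
    using arms_multiset[OF m, of a b c] kl by (simp add: type_D_def)
  ultimately show ?thesis using that m by blast
qed

text \<open>The module \<open>N\<close> contains some \<open>\<alpha>\<^sub>x \<or> \<alpha>\<^sub>y\<close> with \<open>x\<close> and \<open>y\<close> not adjacent. A vertex adjacent to exactly one of
  them makes elements of the kernel preserve the line of the other root, and then all lines of
  simple roots. If there is no such vertex, \<open>x\<close> and \<open>y\<close> form two arms of length one, and their
  2-root generates the small orbit.\<close>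

lemma fixing_word_sign:
  fixes X N :: "(vertex \<times> vertex \<Rightarrow> 'f::field_char_0) set"
  assumes pos: "1 \<le> a" "1 \<le> b" "1 \<le> c" and "\<not> type_D a b c 4"
    and X: "X \<in> two_root_orbits (Y a b c)"
    and N: "N = fun_space.span (canonical_basis (Y a b c) \<inter> X)"
    and sub: "submodule (Y a b c) N" and "N \<noteq> {0}"
    and not_small: "\<not> ((\<exists>n. type_D a b c n) \<and> small_orbit (Y a b c) X)"
    and u: "fixing_word (Y a b c) N u"
  shows "identity_word (Y a b c) u \<or> minus_one_word (Y a b c) u"
proof -
  let ?S = "Y a b c"
  have "canonical_basis ?S \<inter> X \<noteq> {}"
    using \<open>N \<noteq> {0}\<close> N by (metis fun_space.span_empty)
  then obtain i \<beta> where i: "i \<in> ?S" "elementary ?S i \<beta>" "vee (simple_root i) \<beta> \<in> X"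
    "vee (simple_root i) \<beta> \<in> canonical_basis ?S \<inter> X"
    unfolding canonical_basis_def by blast
  obtain w x y where w: "w \<in> lists ?S" and xy: "x \<in> ?S" "y \<in> ?S" "x \<noteq> y" "cartan x y = 0"
    and act: "diag_act ?S (weyl_cong ?S `` {w}) (vee (simple_root i) \<beta>) =
      vee (simple_root x) (simple_root y)"
    using elementary_reduction[OF pos i(1,2)] by blast
  have "vee (simple_root i) \<beta> \<in> N" unfolding N using i(4) by (rule fun_space.span_base)
  then have xyN: "vee (simple_root x) (simple_root y) \<in> N"
    using submodule_class(1)[OF sub w] act by metis
  have xyX: "vee (simple_root x) (simple_root y) \<in> X"
    by (subst two_root_orbit_words[OF finite_Y X i(3)]) (use w act[symmetric] in blast)
  have not_adj: "\<not> adjacent x y" "\<not> adjacent y x"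
    using xy(4) adjacent_iff_cartan[of x y] adjacent_sym[of x y] by auto
  show ?thesis
  proof (cases "\<forall>z\<in>?S. adjacent z x \<longleftrightarrow> adjacent z y")
    case False
    then obtain z where z: "z \<in> ?S" "adjacent z x \<noteq> adjacent z y" by blast
    then have zne: "x \<noteq> z" "y \<noteq> z"
      using not_adj adjacent_iff_cartan[of x x] adjacent_iff_cartan[of y y] by auto
    show ?thesis
    proof (cases "adjacent z y")
      case True
      then show ?thesis
        using z(2) fixing_word_partner[OF finite_Y sub xy(1,2) z(1) xy(3) zne(1) _ _ xyN]
        by (intro fixing_word_imp_sign[OF sub xy(1) u]) blast
    next
      case False
      have "vee (simple_root y) (simple_root x) \<in> N" using xyN vee_commute by metis
      then show ?thesis
        using False z(2) fixing_word_partner[OF finite_Y sub xy(2,1) z(1) xy(3)[symmetric] zne(2)]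
        by (intro fixing_word_imp_sign[OF sub xy(2) u]) blast
    qed
  next
    case True
    obtain k l where kl: "x = Arm k 1" "y = Arm l 1" "k \<noteq> l"
        "arm_len a b c k = 1" "arm_len a b c l = 1"
      using same_neighbours[OF pos xy(1-3)] True by blast
    obtain m where m: "arms_perm k l m" "type_D a b c (arm_len a b c m + 3)"
        "1 \<le> arm_len a b c m"
      using two_short_arms[OF pos kl(3-5)] by blast
    interpret type_D_diagram a b c k l m "arm_len a b c m"
      using m kl by unfold_locales auto
    have "small_orbit ?S X"
      using small_orbit_of_short_arms[OF X] two_root_orbit_words[OF finite_Y X xyX]
      unfolding kl(1,2) by blast
    then show ?thesis using not_small m(2) by blast
  qed
qed

lemma sign_word_fixing:
  fixes N :: "(vertex \<times> vertex \<Rightarrow> 'f::field_char_0) set"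
  assumes "finite S" "submodule S N" "identity_word S u \<or> minus_one_word S u"
  shows "fixing_word S N u"
proof -
  have u: "u \<in> lists S" using assms(3) by (auto simp: identity_word_def minus_one_word_def)
  obtain e :: 'f where e: "e * e = 1"
    and simple: "\<And>i. i \<in> S \<Longrightarrow> word_act S u (simple_root i) = (\<lambda>x. e * simple_root i x)"
  proof -
    have act: "word_act S u (simple_root i :: vertex \<Rightarrow> 'f) = of_int_vec (int_act S u (int_simple i))"
      for i
      using word_act_of_int_vec[OF assms(1) u, of "int_simple i", where 'f = 'f]
      by (simp only: of_int_vec_simple)
    from assms(3) show ?thesis
    proof
      assume "identity_word S u"
      then show ?thesis
        by (intro that[of 1]) (simp_all add: act identity_word_def of_int_vec_simple)
    next
      assume m: "minus_one_word S u"
      show ?thesis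
      proof (rule that[of "-1"])
        fix i assume "i \<in> S"
        then have "word_act S u (simple_root i :: vertex \<Rightarrow> 'f) = of_int_vec (\<lambda>x. - int_simple i x)"
          using m act by (simp add: minus_one_word_def)
        then show "word_act S u (simple_root i :: vertex \<Rightarrow> 'f) = (\<lambda>x. -1 * simple_root i x)"
          by (auto simp: of_int_vec_def int_simple_def simple_root_def)
      qed simp
    qed
  qed
  have scalar: "word_act S u v = (\<lambda>x. e * v x)" if "v \<in> refl_space S" for v
  proof -
    have "word_act S u v = (\<lambda>x. e * word_act S [] v x)"
      unfolding word_act_expand[OF assms(1) that, of u] word_act_expand[OF assms(1) that, of "[]"]
      using simple by (simp add: word_act_def sum_distrib_left mult.left_commute)
    then show ?thesis by (simp add: word_act_def)
  qed
  have fixed: "diag_act S (weyl_cong S `` {u}) t = t"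
    if "t \<in> sym_square S" for t :: "vertex \<times> vertex \<Rightarrow> 'f"
    using that
  proof (induction rule: sym_square_induct)
    case (vee v w)
    have "vee (\<lambda>x. e * v x) (\<lambda>x. e * w x) = (\<lambda>z. (e * e) * vee v w z)"
      by (auto simp: vee_def tensor_def algebra_simps)
    then show ?case
      using diag_act_vee[OF assms(1) u vee] by (simp add: scalar vee e)
  qed (simp_all only: diag_act_zero diag_act_add diag_act_scale)
  then show ?thesis
    using u assms(2) unfolding fixing_word_def submodule_def by blast
qed

theorem theorem8p6:
  fixes a b c :: nat
    and X N :: "(vertex \<times> vertex \<Rightarrow> 'f::field_char_0) set"
  assumes "a \<ge> 1" and "b \<ge> 1" and "c \<ge> 1"
    and "\<not> type_D a b c 4"
    and "X \<in> two_root_orbits (Y a b c)"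
    and "N = fun_space.span (canonical_basis (Y a b c) \<inter> X)"
    and "irreducible_submodule (Y a b c) N"
    and "direct_summand (Y a b c) N"
    and "\<not> trivial_module (Y a b c) N"
    and "\<not> ((\<exists>n. type_D a b c n) \<and> small_orbit (Y a b c) X)"
  shows "kernel (weyl_group (Y a b c)) (BijGroup N) (action_on (Y a b c) N)
           = centre (weyl_group (Y a b c)) \<and>
         (faithful_action (weyl_group (Y a b c)) N (action_on (Y a b c) N) \<longleftrightarrow>
           infinite (carrier (weyl_group (Y a b c))) \<or>
           (\<exists>n. type_D a b c n \<and> odd n) \<or>
           type_E a b c 6)"
proof -
  let ?S = "Y a b c" and ?W = "weyl_group (Y a b c)"
  have sub: "submodule ?S N" and "N \<noteq> {0}"
    using assms(7) by (auto simp: irreducible_submodule_def)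
  have fixing_iff: "fixing_word ?S N u \<longleftrightarrow> identity_word ?S u \<or> minus_one_word ?S u" for u
    using fixing_word_sign[OF assms(1-6) sub \<open>N \<noteq> {0}\<close> assms(10)]
      sign_word_fixing[OF finite_Y sub] by blast
  have kernel: "kernel ?W (BijGroup N) (action_on ?S N) = centre ?W"
  proof (rule Set.set_eqI)
    fix z
    show "z \<in> kernel ?W (BijGroup N) (action_on ?S N) \<longleftrightarrow> z \<in> centre ?W"
    proof (cases "z \<in> carrier ?W")
      case True
      then obtain u where u: "u \<in> lists ?S" "z = weyl_cong ?S `` {u}"
        unfolding carrier_weyl_group by blast
      show ?thesis
        unfolding u(2) kernel_action_on[OF u(1)] centre_iff[OF u(1)] by (rule fixing_iff)
    qed (simp add: kernel_def centre_def)
  qed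
  interpret group_action ?W N "action_on ?S N"
    by (rule action_on_group_action[OF finite_Y sub])
  have "faithful_action ?W N (action_on ?S N) \<longleftrightarrow> inj_on (action_on ?S N) (carrier ?W)"
    using group_action_axioms by (simp add: faithful_action_def faithful_action_axioms_def)
  also have "\<dots> \<longleftrightarrow> centre ?W = {\<one>\<^bsub>?W\<^esub>}"
    using group_hom.inj_iff_trivial_ker[OF group_hom] kernel by simp
  also have "\<dots> \<longleftrightarrow> \<not> (\<exists>u. minus_one_word ?S u)"
  proof
    assume triv: "centre ?W = {\<one>\<^bsub>?W\<^esub>}"
    show "\<not> (\<exists>u. minus_one_word ?S u)"
    proof
      assume "\<exists>u. minus_one_word ?S u"
      then obtain u where u: "minus_one_word ?S u" by blast
      then have uS: "u \<in> lists ?S" by (simp add: minus_one_word_def)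
      have "weyl_cong ?S `` {u} = weyl_cong ?S `` {[]}"
        using centre_iff[OF uS] u triv by (simp add: one_weyl_group)
      then have "(u, []) \<in> weyl_cong ?S" using class_eq_iff[OF uS, of "[]"] by simp
      then have "int_act ?S u (int_simple Branch) = int_simple Branch"
        using int_act_cong[OF finite_Y, of u "[]"] by simp
      then have "int_simple Branch Branch = - int_simple Branch Branch"
        using u by (metis Branch_in_Y minus_one_word_def)
      then show False by (simp add: int_simple_def)
    qed
  next
    assume none: "\<not> (\<exists>u. minus_one_word ?S u)"
    have "z = \<one>\<^bsub>?W\<^esub>" if z: "z \<in> centre ?W" for z
    proof -
      obtain u where u: "u \<in> lists ?S" "z = weyl_cong ?S `` {u}"
        using z unfolding centre_def carrier_weyl_group by blast
      have "identity_word ?S u" using z centre_iff[OF u(1)] none u(2) by blast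
      then have "(u, []) \<in> weyl_cong ?S"
        using int_act_faithful[OF finite_Y u(1)] by (simp add: identity_word_def)
      then show ?thesis using class_eq_iff[OF u(1), of "[]"] u(2) by (simp add: one_weyl_group)
    qed
    moreover have "\<one>\<^bsub>?W\<^esub> \<in> centre ?W"
      using centre_iff[of "[]" a b c] by (simp add: one_weyl_group identity_word_def)
    ultimately show "centre ?W = {\<one>\<^bsub>?W\<^esub>}" by blast
  qed
  also have "\<dots> \<longleftrightarrow> infinite (carrier ?W) \<or> (\<exists>n. type_D a b c n \<and> odd n) \<or> type_E a b c 6"
  proof
    assume "\<not> (\<exists>u. minus_one_word ?S u)"
    then show "infinite (carrier ?W) \<or> (\<exists>n. type_D a b c n \<and> odd n) \<or> type_E a b c 6"
      using minus_one_exists[OF assms(1-3) _ assms(4)] by blast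
  next
    assume "infinite (carrier ?W) \<or> (\<exists>n. type_D a b c n \<and> odd n) \<or> type_E a b c 6"
    moreover have "finite (carrier ?W)" if "minus_one_word ?S u" for u
      using minus_one_imp_finite[OF finite_Y that] .
    ultimately show "\<not> (\<exists>u. minus_one_word ?S u)"
      using no_minus_one_D_odd no_minus_one_E6 by blast
  qed
  finally show ?thesis using kernel by blast
qed

end
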